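(* There exists an algorithm which, given $A\in\mathbb{R}^{n\times n}$, has running time polynomial in $n$ and the number of bits in the entries of $A$ and which, under the assumption that $\mathcal{B}$ is nonempty, returns an element in $\mathcal{B}$ whose number of nonzero entries is at most $c'\log n$ times the number of nonzero entries of the sparsest element in $\mathcal{B}$, for some absolute constant $c'>0$. Moreover, the same statement is true with $\mathcal{B}$ replaced by $\mathcal{B}'$.
   Context: For a given matrix $A\in\mathbb{R}^{n\times n}$, $\mathcal{B}$ denotes the set of vectors $b\in\mathbb{R}^n$ such that the linear system $\dot x=Ax+bu$ (with scalar input $u$) is controllable, and $\mathcal{B}'$ denotes the set of diagonal matrices $B\in\mathbb{R}^{n\times n}$ such that the linear system $\dot x=Ax+Bu$ (with vector input $u\in\mathbb{R}^n$) is controllable. Controllability is in the usual (Kalman) sense: the controllability matrix $(B\ \ AB\ \cdots\ A^{n-1}B)$ (respectively with $b$ in place of $B$) has rank $n$. The sparsest element of a set of vectors or matrices is an element with the smallest number of nonzero entries. An absolute constant is a constant which does not depend on any of the problem parameters, i.e., here it does not depend on $A$ or $n$.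
   Formalization: The bound c' log n times the sparsest is claimed for n ≥ 2 only: at n = 1 it would read 1 ≤ 0, which is false (polynomial time and membership are still proved there). The entries of A are rational, so that their number of bits is defined. *)

theory Defs
  imports
    Complex_Main
    "HOL-Library.Log_Nat"
    "HOL-Computational_Algebra.Polynomial"
    "Jordan_Normal_Form.DL_Rank"
begin

section \<open>Controllability\<close>

text \<open>The block matrix (B, A B, ..., A^(n-1) B).\<close>

definition ctrb_mat :: "real mat \<Rightarrow> real mat \<Rightarrow> real mat" where
  "ctrb_mat A B =
     mat_of_cols (dim_row A) (concat (map (\<lambda>k. cols (A ^\<^sub>m k * B)) [0..<dim_row A]))"

definition controllable :: "real mat \<Rightarrow> real mat \<Rightarrow> bool" where
  "controllable A B \<longleftrightarrow> vec_space.rank (dim_row A) (ctrb_mat A B) = dim_row A"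

definition ctrb_vecs :: "real mat \<Rightarrow> real vec set" where
  "ctrb_vecs A =
     {b \<in> carrier_vec (dim_row A). controllable A (mat_of_cols (dim_row A) [b])}"

definition ctrb_diags :: "real mat \<Rightarrow> real mat set" where
  "ctrb_diags A =
     {B \<in> carrier_mat (dim_row A) (dim_row A). diagonal_mat B \<and> controllable A B}"

definition nnz_vec :: "real vec \<Rightarrow> nat" where
  "nnz_vec v = card {i. i < dim_vec v \<and> v $ i \<noteq> 0}"

definition nnz_mat :: "real mat \<Rightarrow> nat" where
  "nnz_mat M = card {(i, j). i < dim_row M \<and> j < dim_col M \<and> M $$ (i, j) \<noteq> 0}"

section \<open>Algorithms and their running time\<close>

text \<open>
  Algorithms are programs of a deterministic while language over integer arrays (a scalar is the
  cell with index 0 of an array). Running time is charged by the logarithmic cost criterion of random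
  access machines: every evaluation of a subexpression, the index of an array access included, costs
  the number of bits of its value. As an operator is also charged for its operands, the cost of
  a run agrees with the number of bit operations, hence with Turing machine time, up to a polynomial.
\<close>

definition int_bits :: "int \<Rightarrow> nat" where
  "int_bits k = floorlog 2 (nat \<bar>k\<bar>) + 1"

type_synonym vname = string
type_synonym state = "vname \<Rightarrow> int \<Rightarrow> int"

text \<open>\<open>Read x e\<close> is the cell of the array \<open>x\<close> whose index is the value of \<open>e\<close>;
  \<open>Quo\<close> rounds towards minus infinity, and division by 0 gives 0.\<close>

datatype aexp =
    Num int
  | Read vname aexp
  | Add aexp aexp
  | Sub aexp aexp
  | Mul aexp aexp
  | Quo aexp aexp

datatype bexp =
    Less aexp aexp
  | Neg bexp
  | Conj bexp bexp

text \<open>\<open>Store x i e\<close> writes the value of \<open>e\<close> to the cell of \<open>x\<close> whose index is the value of \<open>i\<close>.\<close>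

datatype com =
    Skip
  | Store vname aexp aexp
  | Seq com com
  | Cond bexp com com
  | While bexp com

fun aval :: "aexp \<Rightarrow> state \<Rightarrow> int" where
  "aval (Num k) s = k"
| "aval (Read x e) s = s x (aval e s)"
| "aval (Add a b) s = aval a s + aval b s"
| "aval (Sub a b) s = aval a s - aval b s"
| "aval (Mul a b) s = aval a s * aval b s"
| "aval (Quo a b) s = aval a s div aval b s"

fun acost :: "aexp \<Rightarrow> state \<Rightarrow> nat" where
  "acost (Num k) s = int_bits k"
| "acost (Read x e) s = acost e s + int_bits (aval (Read x e) s)"
| "acost (Add a b) s = acost a s + acost b s + int_bits (aval (Add a b) s)"
| "acost (Sub a b) s = acost a s + acost b s + int_bits (aval (Sub a b) s)"
| "acost (Mul a b) s = acost a s + acost b s + int_bits (aval (Mul a b) s)"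
| "acost (Quo a b) s = acost a s + acost b s + int_bits (aval (Quo a b) s)"

fun bval :: "bexp \<Rightarrow> state \<Rightarrow> bool" where
  "bval (Less a b) s \<longleftrightarrow> aval a s < aval b s"
| "bval (Neg b) s \<longleftrightarrow> \<not> bval b s"
| "bval (Conj b c) s \<longleftrightarrow> bval b s \<and> bval c s"

fun bcost :: "bexp \<Rightarrow> state \<Rightarrow> nat" where
  "bcost (Less a b) s = acost a s + acost b s + 1"
| "bcost (Neg b) s = bcost b s + 1"
| "bcost (Conj b c) s = bcost b s + bcost c s + 1"

text \<open>\<open>run c s t s'\<close>: started in \<open>s\<close>, the program \<open>c\<close> halts after time \<open>t\<close> in \<open>s'\<close>.\<close>

inductive run :: "com \<Rightarrow> state \<Rightarrow> nat \<Rightarrow> state \<Rightarrow> bool" where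
  Skip: "run Skip s 1 s"
| Store: "run (Store x i e) s (acost i s + acost e s + 1)
            (s(x := (s x)(aval i s := aval e s)))"
| Seq: "run c1 s t1 s1 \<Longrightarrow> run c2 s1 t2 s2 \<Longrightarrow> run (Seq c1 c2) s (t1 + t2) s2"
| CondT: "bval b s \<Longrightarrow> run c1 s t s' \<Longrightarrow> run (Cond b c1 c2) s (bcost b s + t + 1) s'"
| CondF: "\<not> bval b s \<Longrightarrow> run c2 s t s' \<Longrightarrow> run (Cond b c1 c2) s (bcost b s + t + 1) s'"
| WhileF: "\<not> bval b s \<Longrightarrow> run (While b c) s (bcost b s + 1) s"
| WhileT: "bval b s \<Longrightarrow> run c s t1 s1 \<Longrightarrow> run (While b c) s1 t2 s2 \<Longrightarrow>
             run (While b c) s (bcost b s + t1 + t2 + 1) s2"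

inductive_cases run_SkipE: "run Skip s t s'"
inductive_cases run_StoreE: "run (Store x i e) s t s'"
inductive_cases run_SeqE: "run (Seq c1 c2) s t s'"
inductive_cases run_CondE: "run (Cond b c1 c2) s t s'"
inductive_cases run_WhileE: "run (While b c) s t s'"

lemma run_deterministic:
  "run c s t s' \<Longrightarrow> run c s u s'' \<Longrightarrow> t = u \<and> s' = s''"
proof (induction arbitrary: u s'' rule: run.induct)
  case (Skip s) from Skip.prems show ?case by (rule run_SkipE) simp
next
  case (Store x i e s) from Store.prems show ?case by (rule run_StoreE) simp
next
  case (Seq c1 s t1 s1 c2 t2 s2)
  from Seq.prems obtain v1 r v2 where v: "u = v1 + v2" "run c1 s v1 r" "run c2 r v2 s''"
    by (rule run_SeqE)
  from Seq.IH(1)[OF v(2)] v(3) have "run c2 s1 v2 s''" by simp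
  from Seq.IH(2)[OF this] Seq.IH(1)[OF v(2)] v(1) show ?case by simp
next
  case (CondT b s c1 t s' c2) from CondT.prems CondT.hyps(1) obtain v
    where v: "u = bcost b s + v + 1" "run c1 s v s''" by - (erule run_CondE, auto)
  from CondT.IH[OF v(2)] v(1) show ?case by simp
next
  case (CondF b s c2 t s' c1) from CondF.prems CondF.hyps(1) obtain v
    where v: "u = bcost b s + v + 1" "run c2 s v s''" by - (erule run_CondE, auto)
  from CondF.IH[OF v(2)] v(1) show ?case by simp
next
  case (WhileF b s c) from WhileF.prems WhileF.hyps show ?case
    by - (erule run_WhileE, auto)
next
  case (WhileT b s c t1 s1 t2 s2) from WhileT.prems WhileT.hyps(1) obtain v1 r v2
    where v: "u = bcost b s + v1 + v2 + 1" "run c s v1 r" "run (While b c) r v2 s''"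
    by - (erule run_WhileE, auto)
  from WhileT.IH(1)[OF v(2)] v(3) have "run (While b c) s1 v2 s''" by simp
  from WhileT.IH(2)[OF this] WhileT.IH(1)[OF v(2)] v(1) show ?case by simp
qed

text \<open>
  A matrix with finitely many bits has rational entries. It is stored row by row, numerators in one
  array and denominators in another, each entry as a reduced fraction with positive denominator.
  A run starts with the dimension and the matrix in memory; all other cells are 0.
\<close>

definition input_state :: "rat mat \<Rightarrow> state" where
  "input_state A = (\<lambda>x k.
     let n = dim_row A; q = quotient_of (A $$ (nat k div n, nat k mod n))
     in if x = ''n'' \<and> k = 0 then int n
        else if x = ''num'' \<and> 0 \<le> k \<and> k < int (n * n) then fst q
        else if x = ''den'' \<and> 0 \<le> k \<and> k < int (n * n) then snd q
        else 0)"

definition input_bits :: "rat mat \<Rightarrow> nat" where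
  "input_bits A = (\<Sum>i<dim_row A. \<Sum>j<dim_col A.
     int_bits (fst (quotient_of (A $$ (i, j)))) + int_bits (snd (quotient_of (A $$ (i, j)))))"

definition outputs_mat :: "state \<Rightarrow> rat mat \<Rightarrow> bool" where
  "outputs_mat s Q \<longleftrightarrow> (\<forall>i<dim_row Q. \<forall>j<dim_col Q.
     (s ''outnum'' (int (i * dim_col Q + j)), s ''outden'' (int (i * dim_col Q + j)))
       = quotient_of (Q $$ (i, j)))"

definition outputs_vec :: "state \<Rightarrow> rat vec \<Rightarrow> bool" where
  "outputs_vec s v \<longleftrightarrow> (\<forall>i<dim_vec v.
     (s ''outnum'' (int i), s ''outden'' (int i)) = quotient_of (v $ i))"

abbreviation real_mat :: "rat mat \<Rightarrow> real mat" where
  "real_mat \<equiv> map_mat of_rat"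

abbreviation real_vec :: "rat vec \<Rightarrow> real vec" where
  "real_vec \<equiv> map_vec of_rat"

end

theory Submission
  imports Defs "HOL-Library.Function_Algebras" "Jordan_Normal_Form.Char_Poly"
begin

text \<open>
  Let \<open>K\<^sub>i\<close> be the span of \<open>A^k e\<^sub>i\<close>, \<open>k < n\<close>. A diagonal matrix with support \<open>X\<close> is controllable iff
  \<open>r(X) = dim (\<Sum>i\<in>X. K\<^sub>i)\<close> equals \<open>n\<close>, and the support of a controllable vector has this property, too.
  Adding greedily the index that maximises \<open>r\<close> multiplies \<open>n - r\<close> by at most \<open>1 - 1/k\<close> when some set of size
  \<open>k\<close> has full rank, so the greedy set has at most \<open>1 + k ln n\<close> elements.

  If some vector is controllable, then each eigenvalue of the transpose of \<open>A\<close> has, up to scaling, only one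
  eigenvector \<open>w\<close>, and \<open>w\<close> does not vanish on \<open>X\<close>. By the Popov-Belevitch-Hautus test the vector with
  entries \<open>t^i\<close> on \<open>X\<close> is controllable unless \<open>t\<close> is a root of one of at most \<open>n\<close> nonzero polynomials of degree
  less than \<open>n\<close>, so one of the values \<open>t < n^2\<close> works.

  After clearing denominators \<open>r(X)\<close> is the rank of the positive semidefinite integer matrix
  \<open>\<Sum>k<n. A^k E (A\<^sup>T)^k\<close> with \<open>E\<close> diagonal of support \<open>X\<close>. It is \<open>n\<close> minus the multiplicity of 0 as a root of
  the characteristic polynomial, which the Faddeev-LeVerrier recursion computes in integers of polynomial
  length.
\<close>

section \<open>Gramians\<close>

text \<open>Rank is computed without elimination because the size of every intermediate value has to
  be bounded: time is charged by bits. The Faddeev-LeVerrier recursion involves no choice of pivots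
  and one exact division per step. It yields a characteristic polynomial, and for a general matrix
  the multiplicity of 0 may exceed the dimension of the kernel; positive semidefiniteness excludes
  this, whence the Gramian. A single \<open>L\<close>, depending only on \<open>n\<close> and the
  input length, bounds the size of all cells throughout a run, so that timing reduces to counting
  loop iterations. Vectors are functions on \<open>nat\<close> vanishing from \<open>n\<close> on;
  all dimensions share the vector space \<open>fs\<close>, and rank conditions are stated by
  annihilation: a family spans when only 0 is orthogonal to it. Controllability is a real notion
  while eigenvectors are complex, and the passage goes through real and imaginary parts of
  annihilators. The programs never compute eigenvalues; they serve only to show that the search over
  \<open>t\<close> succeeds. The competitor in the approximation bound has real entries, but it
  enters through its support alone, so rational computation suffices.\<close>

definition ip :: "nat \<Rightarrow> (nat \<Rightarrow> 'a) \<Rightarrow> (nat \<Rightarrow> 'a) \<Rightarrow> 'a::comm_ring_1" where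
  "ip n v w = (\<Sum>i<n. v i * w i)"

definition nvecs :: "nat \<Rightarrow> (nat \<Rightarrow> 'a::zero) set" where
  "nvecs n = {v. \<forall>i\<ge>n. v i = 0}"

interpretation fs: vector_space "\<lambda>(c::real) (v::nat \<Rightarrow> real) i. c * v i"
  by unfold_locales (auto simp: fun_eq_iff algebra_simps)

lemma ip_commute: "ip n v w = ip n w v"
  by (simp add: ip_def mult.commute)

lemma ip_add: "ip n (v + w) x = ip n v x + ip n w x"
  by (simp add: ip_def sum.distrib distrib_right)

lemma ip_scale: "ip n (\<lambda>i. c * v i) x = c * ip n v x"
  by (simp add: ip_def sum_distrib_left mult.assoc)

lemma ip_sum: "ip n (\<lambda>i. \<Sum>a\<in>K. f a i) x = (\<Sum>a\<in>K. ip n (f a) x)"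
  unfolding ip_def sum_distrib_right by (rule sum.swap)

lemma sum_fun_apply: "(\<Sum>a\<in>K. f a) i = (\<Sum>a\<in>K. f a i)"
  for f :: "'b \<Rightarrow> nat \<Rightarrow> 'a::comm_monoid_add"
  by (induction K rule: infinite_finite_induct) auto

lemma ip_self_eq_0:
  fixes w :: "nat \<Rightarrow> real"
  assumes "w \<in> nvecs n" "ip n w w = 0"
  shows "w = 0"
proof
  fix i
  have "\<forall>i<n. w i * w i = 0"
    using assms(2) by (auto simp: ip_def sum_nonneg_eq_0_iff)
  then show "w i = 0 i" using assms(1) by (cases "i < n") (auto simp: nvecs_def)
qed

lemma subspace_nvecs: "fs.subspace (nvecs n)"
  by (auto simp: fs.subspace_def nvecs_def)

lemma span_subset_nvecs: "G \<subseteq> nvecs n \<Longrightarrow> fs.span G \<subseteq> nvecs n"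
  by (rule fs.span_minimal[OF _ subspace_nvecs])

lemma subspace_orthogonal: "fs.subspace {v. ip n v w = 0}"
  unfolding fs.subspace_def by (auto simp: ip_add ip_scale) (auto simp: ip_def)

lemma orthogonal_span:
  assumes "\<And>v. v \<in> G \<Longrightarrow> ip n v w = 0" "v \<in> fs.span G"
  shows "ip n v w = 0"
  using fs.span_minimal[OF _ subspace_orthogonal[of n w], of G] assms by blast

lemma independent_nvecs_bound:
  assumes "fs.independent B" "B \<subseteq> nvecs n"
  shows "finite B \<and> card B \<le> n"
proof -
  define e where "e k = (\<lambda>i. if i = k then 1 else 0 :: real)" for k :: nat
  have "nvecs n \<subseteq> fs.span (e ` {..<n})"
  proof
    fix v :: "nat \<Rightarrow> real" assume v: "v \<in> nvecs n"
    have "v = (\<Sum>k<n. (\<lambda>i. v k * e k i))"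
      using v by (auto simp: fun_eq_iff sum_fun_apply e_def nvecs_def if_distrib cong: if_cong)
    also have "\<dots> \<in> fs.span (e ` {..<n})"
      by (intro fs.span_sum fs.span_scale fs.span_base) auto
    finally show "v \<in> fs.span (e ` {..<n})" .
  qed
  then have "finite B \<and> card B \<le> card (e ` {..<n})"
    using assms by (intro fs.independent_span_bound) auto
  moreover have "card (e ` {..<n}) \<le> n" using card_image_le[of "{..<n}" e] by simp
  ultimately show ?thesis by linarith
qed

text \<open>Padding the fewer than \<open>n\<close> vectors by zero rows gives a singular square
  matrix, and a kernel vector of it is the required \<open>x\<close>.\<close>

lemma exists_orthogonal:
  fixes B :: "(nat \<Rightarrow> real) set"
  assumes "finite B" "card B < n"
  shows "\<exists>x\<in>nvecs n. x \<noteq> 0 \<and> (\<forall>b\<in>B. ip n b x = 0)"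
proof -
  obtain b where b: "bij_betw b {0..<card B} B" using ex_bij_betw_nat_finite[OF assms(1)] by blast
  define M where "M = mat n n (\<lambda>(i,j). if i < card B then b i j else 0)"
  have M: "M \<in> carrier_mat n n" by (simp add: M_def)
  have "det M = 0"
    by (subst laplace_expansion_row[OF M assms(2)]) (use assms(2) in \<open>auto simp: M_def\<close>)
  then obtain v where v: "v \<in> carrier_vec n" "v \<noteq> 0\<^sub>v n" "M *\<^sub>v v = 0\<^sub>v n"
    using det_0_iff_vec_prod_zero_field[OF M] by blast
  define x where "x i = (if i < n then v $ i else 0)" for i
  have "x \<noteq> 0"
  proof
    assume "x = 0"
    then have "\<forall>i<n. v $ i = 0" by (metis x_def zero_fun_apply)
    then have "v = 0\<^sub>v n" using v(1) by auto
    then show False using v(2) by simp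
  qed
  moreover have "ip n c x = 0" if "c \<in> B" for c
  proof -
    have "c \<in> b ` {0..<card B}" using b that by (simp add: bij_betw_def)
    then obtain i where i: "i < card B" "c = b i" by auto
    have "(M *\<^sub>v v) $ i = ip n c x"
      using i assms(2) v(1) by (auto simp: M_def ip_def scalar_prod_def x_def atLeast0LessThan)
    then show ?thesis using v(3) i assms(2) by simp
  qed
  ultimately show ?thesis by (intro bexI[of _ x]) (auto simp: x_def nvecs_def)
qed

text \<open>A basis of the whole space adapted to the span of \<open>G\<close> and its orthogonal
  complement. Extend a basis of the span by vectors of the complement. Fewer than \<open>n\<close>
  vectors would leave a nonzero \<open>x\<close> orthogonal to all of them; \<open>x\<close> is then
  in the complement, hence in their span, hence orthogonal to itself.\<close>

lemma orthogonal_basis: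
  assumes G: "finite G" "G \<subseteq> nvecs n"
  obtains I J where "I \<subseteq> G" "fs.independent (I \<union> J)" "I \<inter> J = {}" "G \<subseteq> fs.span I"
    "card I = fs.dim G" "J \<subseteq> {w \<in> nvecs n. \<forall>g\<in>G. ip n g w = 0}" "finite I" "finite J"
    "card I + card J = n" "{w \<in> nvecs n. \<forall>g\<in>G. ip n g w = 0} \<subseteq> fs.span (I \<union> J)"
proof -
  define N where "N = {w \<in> nvecs n. \<forall>g\<in>G. ip n g w = 0}"
  obtain I where I: "I \<subseteq> G" "fs.independent I" "G \<subseteq> fs.span I" "card I = fs.dim G"
    using fs.basis_exists by blast
  obtain B where B: "I \<subseteq> B" "B \<subseteq> I \<union> N" "fs.independent B" "I \<union> N \<subseteq> fs.span B"
    using fs.maximal_independent_subset_extend[OF Un_upper1 I(2)] by blast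
  have Bn: "B \<subseteq> nvecs n" using B(2) I(1) G(2) by (auto simp: N_def)
  then have fin: "finite B" "card B \<le> n" using independent_nvecs_bound[OF B(3)] by auto
  have "\<not> card B < n"
  proof
    assume "card B < n"
    then obtain x where x: "x \<in> nvecs n" "x \<noteq> 0" "\<forall>b\<in>B. ip n b x = 0"
      using exists_orthogonal fin(1) by blast
    have "ip n g x = 0" if "g \<in> G" for g
      using orthogonal_span[of I n x g] x(3) B(1) I(3) that by blast
    then have "x \<in> N" using x(1) by (simp add: N_def)
    then have "ip n x x = 0" using orthogonal_span[of B n x x] x(3) B(4) by blast
    then show False using ip_self_eq_0[OF x(1)] x(2) by blast
  qed
  then have cB: "card B = n" using fin by simp
  have "I \<union> (B - I) = B" using B(1) by blast
  moreover have "card I + card (B - I) = n"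
    using cB B(1) fin(1) card_Diff_subset[of I B] finite_subset[OF B(1)] card_mono[of B I] by simp
  ultimately show ?thesis
  proof (intro that[of I "B - I"])
    show "B - I \<subseteq> {w \<in> nvecs n. \<forall>g\<in>G. ip n g w = 0}" using B(2) by (auto simp: N_def)
    show "{w \<in> nvecs n. \<forall>g\<in>G. ip n g w = 0} \<subseteq> fs.span (I \<union> (B - I))"
      using B(4) \<open>I \<union> (B - I) = B\<close> by (simp add: N_def)
    show "finite I" "finite (B - I)" using fin(1) finite_subset[OF B(1)] by auto
  qed (use B(3) I in auto)
qed

text \<open>Duality between rank and annihilators: full dimension leaves no room for
  \<open>J\<close>, the part of an adapted basis that lies in the complement.\<close>

lemma dim_eq_full_iff:
  assumes "finite G" "G \<subseteq> nvecs n"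
  shows "fs.dim G = n \<longleftrightarrow> (\<forall>w\<in>nvecs n. (\<forall>g\<in>G. ip n g w = 0) \<longrightarrow> w = 0)"
proof -
  obtain I J where
    IJ: "I \<subseteq> G" "fs.independent (I \<union> J)" "I \<inter> J = {}" "G \<subseteq> fs.span I"
    "card I = fs.dim G" "J \<subseteq> {w \<in> nvecs n. \<forall>g\<in>G. ip n g w = 0}" "finite I" "finite J"
    "card I + card J = n" "{w \<in> nvecs n. \<forall>g\<in>G. ip n g w = 0} \<subseteq> fs.span (I \<union> J)"
    by (rule orthogonal_basis[OF assms]) (rule that; assumption)
  show ?thesis
  proof
    assume "fs.dim G = n"
    then have "J = {}" using IJ(5,8,9) by simp
    show "\<forall>w\<in>nvecs n. (\<forall>g\<in>G. ip n g w = 0) \<longrightarrow> w = 0"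
    proof (intro ballI impI)
      fix w assume w: "w \<in> nvecs n" "\<forall>g\<in>G. ip n g w = 0"
      have "w \<in> fs.span (I \<union> J)" by (rule subsetD[OF IJ(10)]) (simp add: w)
      then have wI: "w \<in> fs.span I" by (simp add: \<open>J = {}\<close>)
      have "ip n v w = 0" if "v \<in> I" for v
        using that IJ(1) w(2) by auto
      from orthogonal_span[OF this wI] have "ip n w w = 0" by simp
      then show "w = 0" by (rule ip_self_eq_0[OF w(1)])
    qed
  next
    assume *: "\<forall>w\<in>nvecs n. (\<forall>g\<in>G. ip n g w = 0) \<longrightarrow> w = 0"
    have "w = 0" if "w \<in> J" for w using IJ(6) that * by auto
    moreover have "0 \<notin> J" using IJ(2) fs.dependent_zero[of "I \<union> J"] by auto
    ultimately have "J = {}" by auto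
    then show "fs.dim G = n" using IJ(5,9) by simp
  qed
qed

lemma dim_le_n: "G \<subseteq> nvecs n \<Longrightarrow> fs.dim G \<le> n"
proof -
  assume "G \<subseteq> nvecs n"
  obtain B where B: "B \<subseteq> G" "fs.independent B" "G \<subseteq> fs.span B" "card B = fs.dim G"
    by (rule fs.basis_exists)
  have "card B \<le> n"
    using independent_nvecs_bound[OF B(2) subset_trans[OF B(1) \<open>G \<subseteq> nvecs n\<close>]] by (rule conjunct2)
  then show "fs.dim G \<le> n" using B(4) by simp
qed

text \<open>\<open>fs.independent\<close> speaks of sets, whereas the columns of a matrix are
  indexed by numbers; the bijection \<open>u\<close> transports the coefficients.\<close>

lemma independent_sum_reindex:
  fixes z :: "nat \<Rightarrow> real"
  assumes "fs.independent I" "bij_betw u {..<r} I" "(\<Sum>j<r. (\<lambda>i. z j * u j i)) = 0" "j < r"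
  shows "z j = 0"
proof -
  have fin: "finite I" using bij_betw_finite[OF assms(2)] by simp
  have inv: "inv_into {..<r} u (u k) = k" if "k < r" for k
    using that assms(2) by (simp add: bij_betw_def inv_into_f_f)
  define \<zeta> where "\<zeta> b = z (inv_into {..<r} u b)" for b
  define F where "F b = (\<lambda>i. \<zeta> b * b i)" for b :: "nat \<Rightarrow> real"
  have Fu: "F (u k) = (\<lambda>i. z k * u k i)" if "k < r" for k
    by (simp add: F_def \<zeta>_def inv[OF that])
  have "(\<Sum>b\<in>I. F b) = (\<Sum>k<r. F (u k))"
    by (rule sum.reindex_bij_betw[OF assms(2), symmetric])
  also have "\<dots> = (\<Sum>k<r. (\<lambda>i. z k * u k i))"
    by (rule sum.cong[OF refl]) (simp add: Fu)
  also have "\<dots> = 0" by (rule assms(3))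
  finally have "(\<Sum>b\<in>I. (\<lambda>i. \<zeta> b * b i)) = 0" by (simp only: F_def)
  moreover have "u j \<in> I" using bij_betwE[OF assms(2)] assms(4) by auto
  ultimately have "\<zeta> (u j) = 0" by (rule fs.independentD[OF assms(1) fin subset_refl, where u = \<zeta>])
  then show ?thesis by (simp add: \<zeta>_def inv[OF assms(4)])
qed

text \<open>In a basis adapted to the range of \<open>W\<close> and its orthogonal complement, \<open>x I - W\<close> becomes
  \<open>[x U - W U | x V]\<close>, and \<open>[W U | V]\<close> is nonsingular.\<close>

lemma char_poly_gram:
  fixes g :: "'b \<Rightarrow> nat \<Rightarrow> real" and W :: "nat \<Rightarrow> nat \<Rightarrow> real"
  assumes K: "finite K" and c: "\<And>a. a \<in> K \<Longrightarrow> c a > 0" and g: "g ` K \<subseteq> nvecs n"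
    and W: "\<And>i j. W i j = (\<Sum>a\<in>K. c a * g a i * g a j)"
    and \<chi>: "\<chi> = char_poly (mat n n (\<lambda>(i,j). W i j))"
  shows "\<And>j. j < n - fs.dim (g ` K) \<Longrightarrow> coeff \<chi> j = 0" "coeff \<chi> (n - fs.dim (g ` K)) \<noteq> 0"
proof -
  obtain I J where
    IJ: "I \<subseteq> g ` K" "fs.independent (I \<union> J)" "I \<inter> J = {}" "g ` K \<subseteq> fs.span I"
    "card I = fs.dim (g ` K)" "J \<subseteq> {w \<in> nvecs n. \<forall>b\<in>g ` K. ip n b w = 0}" "finite I" "finite J"
    "card I + card J = n"
    by (rule orthogonal_basis[OF finite_imageI[OF K] g]) (rule that; assumption)
  define r where "r = card I"
  define m where "m = card J"
  have rm: "r + m = n" using IJ by (simp add: r_def m_def)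
  obtain u where u: "bij_betw u {..<r} I"
    using ex_bij_betw_nat_finite[OF IJ(7)] by (auto simp: r_def atLeast0LessThan)
  obtain v where v: "bij_betw v {..<m} J"
    using ex_bij_betw_nat_finite[OF IJ(8)] by (auto simp: m_def atLeast0LessThan)
  have u_in: "u j \<in> I" if "j < r" for j using u that by (auto simp: bij_betw_def)
  have v_in: "v j \<in> J" if "j < m" for j using v that by (auto simp: bij_betw_def)
  define p where "p j = (if j < r then u j else v (j - r))" for j
  define Wv where "Wv y i = (\<Sum>l<n. W i l * y l)" for y i
  have Wv: "Wv y = (\<lambda>i. \<Sum>a\<in>K. c a * ip n (g a) y * g a i)" for y
  proof
    fix i
    have "Wv y i = (\<Sum>l<n. \<Sum>a\<in>K. c a * (g a l * y l) * g a i)"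
      unfolding Wv_def W by (simp add: sum_distrib_right ac_simps sum_distrib_left)
    also have "\<dots> = (\<Sum>a\<in>K. \<Sum>l<n. c a * (g a l * y l) * g a i)" by (rule sum.swap)
    finally show "Wv y i = (\<Sum>a\<in>K. c a * ip n (g a) y * g a i)"
      by (simp add: ip_def sum_distrib_left sum_distrib_right)
  qed
  have Wv0: "Wv (v j) = 0" if "j < m" for j
    using IJ(6) v_in[OF that] by (auto simp: Wv fun_eq_iff intro!: sum.neutral)
  \<comment> \<open>\<open>P\<close> has the adapted basis as columns, \<open>Q\<close> is
    [x U - W U | V], and \<open>D\<close> supplies the factor x of the last \<open>m\<close>
    columns.\<close>
  define P where "P = mat n n (\<lambda>(i,j). [:p j i:])"
  define Q where "Q = mat n n (\<lambda>(i,j). if j < r then [:- Wv (p j) i, p j i:] else [:p j i:])"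
  define D where "D = mat n n (\<lambda>(i,j). if i \<noteq> j then 0 else if j < r then 1 else [:0, 1::real:])"
  define Wm where "Wm = mat n n (\<lambda>(i,j). W i j)"
  have cP: "P \<in> carrier_mat n n" and cQ: "Q \<in> carrier_mat n n" and cD: "D \<in> carrier_mat n n"
    and cW: "Wm \<in> carrier_mat n n" by (auto simp: P_def Q_def D_def Wm_def)
  have eq: "char_poly_matrix Wm * P = Q * D"
  proof (rule eq_matI)
    fix i j assume "i < dim_row (Q * D)" "j < dim_col (Q * D)"
    then have ij: "i < n" "j < n" by (auto simp: Q_def D_def)
    have "(char_poly_matrix Wm * P) $$ (i, j)
        = (\<Sum>l<n. ((if i = l then [:0,1:] else 0) + [:- W i l:]) * [:p j l:])"
      using ij by (auto simp: char_poly_matrix_def Wm_def P_def scalar_prod_def atLeast0LessThan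
          intro!: sum.cong)
    also have "\<dots> = (\<Sum>l<n. (if i = l then [:0, p j l:] else 0) + [:- W i l * p j l:])"
      by (intro sum.cong) auto
    also have "\<dots> = (\<Sum>l<n. if i = l then [:0, p j l:] else 0) + (\<Sum>l<n. [:- W i l * p j l:])"
      by (rule sum.distrib)
    also have "(\<Sum>l<n. [:- W i l * p j l:]) = [:- Wv (p j) i:]"
    proof -
      have "(\<Sum>l<k. [:- W i l * p j l:]) = [:- (\<Sum>l<k. W i l * p j l):]" for k
        by (induction k) auto
      then show ?thesis by (simp add: Wv_def)
    qed
    also have "(\<Sum>l<n. if i = l then [:0, p j l:] else 0) = [:0, p j i:]" using ij by simp
    finally have 1: "(char_poly_matrix Wm * P) $$ (i, j) = [:- Wv (p j) i, p j i:]" by simp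
    have "(Q * D) $$ (i, j) = (\<Sum>l<n. Q $$ (i,l) * D $$ (l,j))"
      using ij by (auto simp: Q_def D_def scalar_prod_def atLeast0LessThan intro!: sum.cong)
    also have "\<dots> = (\<Sum>l<n. if l = j then Q $$ (i,j) * D $$ (j,j) else 0)"
      using ij by (intro sum.cong) (auto simp: D_def)
    also have "\<dots> = Q $$ (i,j) * D $$ (j,j)" using ij by simp
    also have "\<dots> = [:- Wv (p j) i, p j i:]"
      using ij Wv0[of "j - r"] rm by (auto simp: Q_def D_def p_def)
    finally show "(char_poly_matrix Wm * P) $$ (i, j) = (Q * D) $$ (i, j)" using 1 by simp
  qed (auto simp: char_poly_matrix_def Wm_def P_def Q_def D_def)
  have "det D = [:0,1:] ^ m"
  proof -
    have "upper_triangular D" by (auto simp: D_def upper_triangular_def)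
    then have "det D = prod_list (diag_mat D)" by (rule det_upper_triangular[OF _ cD])
    also have "\<dots> = (\<Prod>i<n. if i < r then 1 else [:0,1:])"
      by (auto simp: diag_mat_def D_def prod.list_conv_set_nth atLeast0LessThan intro!: prod.cong)
    also have "\<dots> = (\<Prod>i\<in>{..<n} - {..<r}. [:0,1:])"
      by (intro prod.mono_neutral_cong_right) auto
    also have "\<dots> = [:0,1:] ^ m" using rm[symmetric] by (simp add: card_Diff_subset)
    finally show ?thesis .
  qed
  then have *: "\<chi> * det P = det Q * [:0,1:] ^ m"
    using arg_cong[OF eq, of det] det_mult[of "char_poly_matrix Wm" n P] det_mult[OF cQ cD] cP cW
    by (simp add: \<chi> char_poly_def Wm_def)
  have "det P = [:det (mat n n (\<lambda>(i,j). p j i)):]"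
  proof -
    interpret pc: comm_ring_hom "\<lambda>a::real. [:a:]" by unfold_locales (auto simp: one_pCons)
    have "P = map_mat (\<lambda>a. [:a:]) (mat n n (\<lambda>(i,j). p j i))" by (rule eq_matI) (auto simp: P_def)
    then show ?thesis by (simp add: pc.hom_det)
  qed
  then obtain d where d: "det P = [:d:]" by blast
  \<comment> \<open>At the value 0 of the variable the matrix is [- W U | V]. A kernel vector gives
    \<open>x = W y\<close> with \<open>y\<close> in the span of the \<open>g a\<close> and
    \<open>x\<close> orthogonal to that span. As \<open>W y\<close> lies in it,
    \<open>x = 0\<close>; so \<open>W y = 0\<close>, the quadratic form of \<open>W\<close> vanishes
    at \<open>y\<close>, and \<open>y\<close> is orthogonal to every \<open>g a\<close>, hence to
    itself.\<close>
  have "poly (det Q) 0 \<noteq> 0"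
  proof
    assume "poly (det Q) 0 = 0"
    define Q0 where "Q0 = map_mat (\<lambda>q. poly q 0) Q"
    have ev: "comm_ring_hom (\<lambda>q::real poly. poly q 0)" by unfold_locales auto
    have "det Q0 = 0" using \<open>poly (det Q) 0 = 0\<close> unfolding Q0_def comm_ring_hom.hom_det[OF ev] .
    moreover have cQ0: "Q0 \<in> carrier_mat n n" using cQ by (simp add: Q0_def)
    ultimately obtain zv where zv: "zv \<in> carrier_vec n" "zv \<noteq> 0\<^sub>v n" "Q0 *\<^sub>v zv = 0\<^sub>v n"
      using det_0_iff_vec_prod_zero_field by blast
    define z where "z j = zv $ j" for j
    define y where "y = (\<Sum>j<r. (\<lambda>i. z j * u j i))"
    define x where "x = (\<Sum>j<m. (\<lambda>i. z (r + j) * v j i))"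
    have yI: "y \<in> fs.span I"
      unfolding y_def using u_in by (intro fs.span_sum fs.span_scale fs.span_base) auto
    have In: "I \<subseteq> nvecs n" using IJ(1) g by blast
    have yn: "y \<in> nvecs n" using yI span_subset_nvecs[OF In] by blast
    have Jn: "J \<subseteq> nvecs n" using IJ(6) by blast
    have xJ: "x \<in> fs.span J"
      unfolding x_def using v_in by (intro fs.span_sum fs.span_scale fs.span_base) auto
    then have xn: "x \<in> nvecs n" using span_subset_nvecs[OF Jn] by blast
    have gx: "ip n (g a) x = 0" if "a \<in> K" for a
      using orthogonal_span[of J n "g a" x] xJ IJ(6) that by (auto simp: ip_commute)
    have Wy: "Wv y i = (\<Sum>j<r. z j * Wv (u j) i)" for i
    proof -
      have "Wv y i = (\<Sum>l<n. \<Sum>j<r. z j * (W i l * u j l))"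
        unfolding Wv_def y_def by (simp add: sum_fun_apply sum_distrib_left ac_simps)
      also have "\<dots> = (\<Sum>j<r. \<Sum>l<n. z j * (W i l * u j l))" by (rule sum.swap)
      finally show ?thesis by (simp add: Wv_def sum_distrib_left)
    qed
    have split: "(\<Sum>j<n. f j) = (\<Sum>j<r. f j) + (\<Sum>j<m. f (r + j))" for f :: "nat \<Rightarrow> real"
      unfolding rm[symmetric] by (induction m) (simp_all add: add.assoc)
    have sum0: "x i = Wv y i" if "i < n" for i
    proof -
      have "(Q0 *\<^sub>v zv) $ i = (\<Sum>j<n. (if j < r then - Wv (p j) i else p j i) * z j)"
        using that zv(1) by (auto simp: Q0_def Q_def scalar_prod_def z_def atLeast0LessThan
          intro!: sum.cong)
      also have "\<dots> = x i - Wv y i"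
        unfolding split Wy x_def by (simp add: p_def sum_fun_apply sum_negf mult.commute)
      finally show ?thesis using zv(3) that by simp
    qed
    have "ip n x x = ip n (Wv y) x" using sum0 by (simp add: ip_def)
    also have "\<dots> = 0" unfolding Wv ip_sum
      using gx by (auto simp: ip_scale intro!: sum.neutral)
    finally have x0: "x = 0" using ip_self_eq_0 xn by blast
    have "0 = ip n (Wv y) y" using sum0 x0 by (simp add: ip_def)
    also have "\<dots> = (\<Sum>a\<in>K. c a * (ip n (g a) y)\<^sup>2)"
      unfolding Wv ip_sum by (auto simp: ip_scale power2_eq_square intro!: sum.cong)
    finally have "\<forall>a\<in>K. c a * (ip n (g a) y)\<^sup>2 = 0"
      using c by (subst (asm) eq_commute) (auto simp: sum_nonneg_eq_0_iff[OF K] less_imp_le)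
    then have gy: "ip n (g a) y = 0" if "a \<in> K" for a using c[OF that] that by force
    then have "ip n y y = 0" using orthogonal_span[OF _ yI, of n y] IJ(1) by blast
    then have y0: "y = 0" using ip_self_eq_0 yn by blast
    have "z j = 0" if "j < n" for j
    proof (cases "j < r")
      case True
      show ?thesis
        by (rule independent_sum_reindex[OF fs.independent_mono[OF IJ(2) Un_upper1] u _ True])
          (use y0 in \<open>simp add: y_def\<close>)
    next
      case False
      have "z (r + (j - r)) = 0"
        by (rule independent_sum_reindex[OF fs.independent_mono[OF IJ(2) Un_upper2] v,
              where z = "\<lambda>j. z (r + j)"])
          (use x0 False that rm in \<open>simp_all add: x_def\<close>)
      then show ?thesis using False by simp
    qed
    then have "zv = 0\<^sub>v n" using zv(1) by (intro eq_vecI) (auto simp: z_def)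
    then show False using zv(2) by simp
  qed
  then have q0: "coeff (det Q) 0 \<noteq> 0" by (simp add: poly_0_coeff_0)
  \<comment> \<open>As \<open>det P\<close> is the constant \<open>d\<close> and the right-hand side
    is x^m times \<open>det Q\<close>, the lowest nonzero coefficient of \<open>\<chi>\<close> sits
    at \<open>m\<close>. The coefficient at \<open>m\<close> also shows
    \<open>d \<noteq> 0\<close>.\<close>
  have co: "coeff \<chi> j * d = coeff (monom 1 m * det Q) j" for j
    using arg_cong[OF *, of "\<lambda>q. coeff q j"] d
    by (simp add: monom_altdef mult.commute)
  have nm: "n - fs.dim (g ` K) = m" using rm IJ(5) by (simp add: r_def)
  have "coeff \<chi> m * d \<noteq> 0" unfolding co by (simp add: coeff_monom_mult q0)
  then show "coeff \<chi> (n - fs.dim (g ` K)) \<noteq> 0" unfolding nm by auto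
  have "d \<noteq> 0" using \<open>coeff \<chi> m * d \<noteq> 0\<close> by auto
  fix j assume "j < n - fs.dim (g ` K)"
  then have "coeff \<chi> j * d = 0" unfolding co nm by (simp add: coeff_monom_mult)
  then show "coeff \<chi> j = 0" using \<open>d \<noteq> 0\<close> by simp
qed

section \<open>The gain of a greedy step\<close>

text \<open>Extend a basis of the span for \<open>X\<close> by vectors from the sets indexed by
  \<open>T\<close> until it spans everything. At least \<open>n\<close> minus the rank of
  \<open>X\<close> vectors are added, each from some \<open>G i\<close> with \<open>i\<close> in
  \<open>T\<close>, so one \<open>i\<close> supplies at least a fraction \<open>1 / card T\<close>
  of them, and these are independent over the span for \<open>X\<close>.\<close>

lemma dim_gain:
  fixes G :: "nat \<Rightarrow> (nat \<Rightarrow> real) set"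
  assumes G: "\<And>i. G i \<subseteq> nvecs n" and T: "finite T" and full: "fs.dim (\<Union>(G ` T)) = n"
    and n: "0 < n"
  shows "\<exists>i\<in>T. n - fs.dim (\<Union>(G ` X)) \<le> card T * (fs.dim (\<Union>(G ` insert i X)) - fs.dim (\<Union>(G ` X)))"
proof -
  obtain I where I: "I \<subseteq> \<Union>(G ` X)" "fs.independent I" "\<Union>(G ` X) \<subseteq> fs.span I"
    "card I = fs.dim (\<Union>(G ` X))" by (rule fs.basis_exists)
  obtain C where C: "C \<subseteq> \<Union>(G ` T)" "fs.independent C" "\<Union>(G ` T) \<subseteq> fs.span C"
    "card C = fs.dim (\<Union>(G ` T))" by (rule fs.basis_exists)
  obtain B where B: "I \<subseteq> B" "B \<subseteq> I \<union> \<Union>(G ` T)" "fs.independent B"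
    "I \<union> \<Union>(G ` T) \<subseteq> fs.span B"
    by (rule fs.maximal_independent_subset_extend[OF Un_upper1 I(2)])
  have "I \<subseteq> nvecs n" using I(1) G by blast
  then have "B \<subseteq> nvecs n" using B(2) G by blast
  then have finB: "finite B" using independent_nvecs_bound[OF B(3)] by blast
  have "C \<subseteq> fs.span B" using C(1) B(4) by blast
  then have "n \<le> card B" using fs.independent_span_bound[OF finB C(2)] C(4) full by simp
  moreover have "card (B - I) = card B - card I"
    using B(1) finite_subset[OF B(1) finB] by (rule card_Diff_subset[rotated])
  ultimately have 1: "n - card I \<le> card (B - I)" by simp
  have "B - I = (\<Union>i\<in>T. (B - I) \<inter> G i)" using B(2) by blast
  then have 2: "card (B - I) \<le> (\<Sum>i\<in>T. card ((B - I) \<inter> G i))" using card_UN_le[OF T] by metis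
  have Tne: "T \<noteq> {}"
  proof
    assume "T = {}"
    then have "C = {}" using C(1) by simp
    then show False using C(4) full n by simp
  qed
  have "\<exists>i\<in>T. card (B - I) \<le> card T * card ((B - I) \<inter> G i)"
  proof (rule ccontr)
    assume *: "\<not> ?thesis"
    have "card T * card (B - I) \<le> (\<Sum>i\<in>T. card T * card ((B - I) \<inter> G i))"
      using 2 by (simp add: sum_distrib_left[symmetric])
    also have "\<dots> < (\<Sum>i\<in>T. card (B - I))"
      using * by (intro sum_strict_mono T Tne) (auto simp: not_le)
    also have "\<dots> = card T * card (B - I)" by simp
    finally show False by simp
  qed
  then obtain i where i: "i \<in> T" "card (B - I) \<le> card T * card ((B - I) \<inter> G i)" by blast
  define J where "J = I \<union> ((B - I) \<inter> G i)"
  have "card J = card I + card ((B - I) \<inter> G i)" unfolding J_def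
    by (rule card_Un_disjoint) (use finB finite_subset[OF B(1) finB] in auto)
  then have J: "J \<subseteq> B" "finite J" "card J = card I + card ((B - I) \<inter> G i)"
    using B(1) finB finite_subset[OF B(1) finB] by (auto simp: J_def)
  obtain D where D: "D \<subseteq> \<Union>(G ` insert i X)" "fs.independent D" "\<Union>(G ` insert i X) \<subseteq> fs.span D"
    "card D = fs.dim (\<Union>(G ` insert i X))" by (rule fs.basis_exists)
  have "D \<subseteq> nvecs n" using D(1) G by blast
  then have "finite D" using independent_nvecs_bound[OF D(2)] by blast
  moreover have "fs.independent J" using B(3) J(1) by (rule fs.independent_mono)
  moreover have "J \<subseteq> fs.span D" using D(3) I(1) by (auto simp: J_def)
  ultimately have "card J \<le> card D" using fs.independent_span_bound by blast
  then have "card ((B - I) \<inter> G i) \<le> fs.dim (\<Union>(G ` insert i X)) - card I" using J(3) D(4) by simp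
  then have "card T * card ((B - I) \<inter> G i) \<le> card T * (fs.dim (\<Union>(G ` insert i X)) - card I)"
    by (rule mult_le_mono2)
  then have "n - card I \<le> card T * (fs.dim (\<Union>(G ` insert i X)) - card I)"
    using 1 i(2) by linarith
  then show ?thesis using i(1) I(4) by auto
qed

section \<open>The Faddeev-LeVerrier recursion\<close>

text \<open>\<open>M k\<close> is the coefficient of \<open>x^(n-k)\<close> in the adjugate of \<open>x I - W\<close>; the recursion compares
  coefficients in \<open>(x I - W) adj (x I - W) = \<chi> I\<close>, and the trace of the adjugate is \<open>\<chi>'\<close>.\<close>

lemma adjugate_coefficients:
  fixes W :: "nat \<Rightarrow> nat \<Rightarrow> 'a::idom" and n :: nat
  defines "\<chi> \<equiv> char_poly (mat n n (\<lambda>(i,j). W i j))"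
  obtains M :: "nat \<Rightarrow> nat \<Rightarrow> nat \<Rightarrow> 'a" where
    "\<And>i j. i < n \<Longrightarrow> j < n \<Longrightarrow> M 0 i j = 0"
    "\<And>k i j. k \<le> n \<Longrightarrow> i < n \<Longrightarrow> j < n \<Longrightarrow>
       M (Suc k) i j = (\<Sum>l<n. W i l * M k l j) + (if i = j then coeff \<chi> (n - k) else 0)"
    "\<And>i j. M (Suc n) i j = 0"
    "\<And>k. k \<le> n \<Longrightarrow> (\<Sum>i<n. M (Suc k) i i) = of_nat (n - k) * coeff \<chi> (n - k)"
proof -
  define A where "A = mat n n (\<lambda>(i,j). W i j)"
  have A: "A \<in> carrier_mat n n" by (simp add: A_def)
  have \<chi>: "\<chi> = char_poly A" by (simp add: \<chi>_def A_def)
  define X where "X = char_poly_matrix A"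
  have X: "X \<in> carrier_mat n n" using A by (simp add: X_def)
  define R where "R = adj_mat X"
  have R: "R \<in> carrier_mat n n" using adj_mat(1)[OF X] by (simp add: R_def)
  have XR: "X * R = \<chi> \<cdot>\<^sub>m 1\<^sub>m n" using adj_mat(2)[OF X] by (simp add: R_def \<chi> X_def char_poly_def)
  have ent: "pCons 0 (R $$ (i,j)) = (\<Sum>l<n. Polynomial.smult (W i l) (R $$ (l,j))) + (if i = j then \<chi> else 0)"
    if ij: "i < n" "j < n" for i j
  proof -
    have "(X * R) $$ (i,j) = (\<Sum>l<n. ((if i = l then [:0,1:] else 0) + [:- W i l:]) * R $$ (l,j))"
      using ij R by (auto simp: X_def char_poly_matrix_def A_def scalar_prod_def atLeast0LessThan
          intro!: sum.cong)
    also have "\<dots> = (\<Sum>l<n. (if i = l then pCons 0 (R $$ (l,j)) else 0)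
        - Polynomial.smult (W i l) (R $$ (l,j)))"
      by (intro sum.cong) (auto simp: algebra_simps)
    also have "\<dots> = pCons 0 (R $$ (i,j)) - (\<Sum>l<n. Polynomial.smult (W i l) (R $$ (l,j)))"
      using ij by (simp add: sum_subtractf)
    finally show ?thesis using XR ij by (cases "i = j") (simp_all add: algebra_simps)
  qed
  have co: "(if k = 0 then 0 else coeff (R $$ (i,j)) (k - 1))
      = (\<Sum>l<n. W i l * coeff (R $$ (l,j)) k) + (if i = j then coeff \<chi> k else 0)"
    if ij: "i < n" "j < n" for i j k
    using arg_cong[OF ent[OF ij], of "\<lambda>q. coeff q k"]
    by (cases k) (auto simp: coeff_sum)
  have deg: "degree \<chi> = n" unfolding \<chi> using degree_monic_char_poly[OF A] by simp
  define N where "N = Suc n + (\<Sum>i<n. \<Sum>j<n. degree (R $$ (i,j)))"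
  have big: "coeff (R $$ (i,j)) k = 0" if "i < n" "j < n" "k \<ge> N" for i j k
  proof -
    have "degree (R $$ (i,j)) \<le> (\<Sum>j<n. degree (R $$ (i,j)))"
      using that by (intro member_le_sum) auto
    also have "\<dots> \<le> (\<Sum>i<n. \<Sum>j<n. degree (R $$ (i,j)))"
      using that by (intro member_le_sum[where f = "\<lambda>i. \<Sum>j<n. degree (R $$ (i,j))"]) auto
    finally show ?thesis using that by (intro coeff_eq_0) (simp add: N_def)
  qed
  \<comment> \<open>The adjugate has degree below \<open>n\<close>: its coefficients vanish from
    \<open>N\<close> on, and the comparison at an exponent above \<open>n\<close>, where
    \<open>\<chi>\<close> contributes nothing, pushes the vanishing down by one exponent.\<close>
  have down: "\<forall>i<n. \<forall>j<n. coeff (R $$ (i,j)) (N - d) = 0" if "d \<le> N - n" for d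
    using that
  proof (induction d)
    case (Suc d)
    have k: "N - d > n" "N - d - 1 = N - Suc d" "N - d \<noteq> 0" using Suc.prems by auto
    then have "coeff \<chi> (N - d) = 0" using deg by (intro coeff_eq_0) simp
    then show ?case using co[of _ _ "N - d"] Suc k by auto
  qed (simp add: big)
  have n0: "coeff (R $$ (i,j)) n = 0" if "i < n" "j < n" for i j
    using down[of "N - n"] that by (simp add: N_def)
  \<comment> \<open>\<open>M 0\<close> is the vanishing coefficient of x^n. The default 0 at
    \<open>Suc n\<close> turns the comparison of constant coefficients into the recursion at
    \<open>k = n\<close>, which is the content of Cayley-Hamilton.\<close>
  define M where "M k i j = (if k \<le> n then coeff (R $$ (i,j)) (n - k) else 0)" for k i j
  have "M (Suc k) i j = (\<Sum>l<n. W i l * M k l j) + (if i = j then coeff \<chi> (n - k) else 0)"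
    if "k \<le> n" "i < n" "j < n" for k i j
    using co[of i j "n - k"] that by (auto simp: M_def Suc_diff_Suc split: if_splits)
  moreover have "(\<Sum>i<n. M (Suc k) i i) = of_nat (n - k) * coeff \<chi> (n - k)" if k: "k \<le> n" for k
  proof (cases "k = n")
    case False
    \<comment> \<open>A diagonal entry of the adjugate is the characteristic polynomial of a
      principal submatrix, and these sum to the derivative of \<open>\<chi>\<close>.\<close>
    have "R $$ (i,i) = char_poly (mat_delete A i i)" if "i < n" for i
    proof -
      have "mat_delete X i i = char_poly_matrix (mat_delete A i i)"
        using that A by (intro eq_matI) (auto simp: X_def char_poly_matrix_def mat_delete_def A_def)
      then show ?thesis using that X by (simp add: R_def adj_mat_def cofactor_def char_poly_def)
    qed
    then have "(\<Sum>i<n. R $$ (i,i)) = (\<Sum>i<n. char_poly (mat_delete A i i))" by (intro sum.cong) auto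
    also have "\<dots> = pderiv \<chi>" unfolding \<chi> by (rule pderiv_char_poly[OF A, symmetric])
    finally have tr: "(\<Sum>i<n. R $$ (i,i)) = pderiv \<chi>" .
    have "(\<Sum>i<n. coeff (R $$ (i,i)) (n - Suc k)) = coeff (pderiv \<chi>) (n - Suc k)"
      unfolding tr[symmetric] by (rule coeff_sum[symmetric])
    also have "\<dots> = of_nat (Suc (n - Suc k)) * coeff \<chi> (Suc (n - Suc k))" by (simp add: coeff_pderiv)
    also have "Suc (n - Suc k) = n - k" using False k by simp
    finally show ?thesis using False k by (simp add: M_def)
  qed (simp add: M_def)
  ultimately show ?thesis using n0 by (intro that[of M]) (auto simp: M_def)
qed

text \<open>The second component after \<open>k\<close> steps is the coefficient of \<open>x^(n-k)\<close> in the characteristic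
  polynomial of \<open>W\<close>, so the division is exact.\<close>

fun fl :: "nat \<Rightarrow> (nat \<Rightarrow> nat \<Rightarrow> int) \<Rightarrow> nat \<Rightarrow> (nat \<Rightarrow> nat \<Rightarrow> int) \<times> int" where
  "fl n W 0 = (\<lambda>i j. 0, 1)"
| "fl n W (Suc k) = (let (P, c) = fl n W k;
     P' = (\<lambda>i j. \<Sum>l<n. W i l * (P l j + (if l = j then c else 0)))
   in (P', - (\<Sum>i<n. P' i i) div int (Suc k)))"

text \<open>The first component is \<open>W M_k\<close> rather than \<open>M_k\<close>; adding
  \<open>c\<close> on the diagonal recovers \<open>M_(k+1)\<close>. With c' the next coefficient,
  the trace of \<open>W M_(k+1)\<close> is (n - k - 1) c' - n c' = -(k + 1) c', so the division by
  \<open>Suc k\<close> leaves no remainder.\<close>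

lemma fl_correct:
  fixes W :: "nat \<Rightarrow> nat \<Rightarrow> int"
  assumes "k \<le> n"
  shows "snd (fl n W k) = coeff (char_poly (mat n n (\<lambda>(i,j). W i j))) (n - k)"
proof -
  define \<chi> where "\<chi> = char_poly (mat n n (\<lambda>(i,j). W i j))"
  obtain M :: "nat \<Rightarrow> nat \<Rightarrow> nat \<Rightarrow> int" where
    M: "\<And>i j. i < n \<Longrightarrow> j < n \<Longrightarrow> M 0 i j = 0"
    "\<And>k i j. k \<le> n \<Longrightarrow> i < n \<Longrightarrow> j < n \<Longrightarrow>
       M (Suc k) i j = (\<Sum>l<n. W i l * M k l j) + (if i = j then coeff \<chi> (n - k) else 0)"
    "\<And>i j. M (Suc n) i j = 0"
    "\<And>k. k \<le> n \<Longrightarrow> (\<Sum>i<n. M (Suc k) i i) = of_nat (n - k) * coeff \<chi> (n - k)"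
    by (rule adjugate_coefficients[of n W, folded \<chi>_def]) (rule that; assumption)
  have "snd (fl n W k) = coeff \<chi> (n - k) \<and>
    (\<forall>i<n. \<forall>j<n. fst (fl n W k) i j = (\<Sum>l<n. W i l * M k l j))"
    using assms
  proof (induction k)
    case 0
    have "coeff \<chi> n = 1" unfolding \<chi>_def using degree_monic_char_poly[of "mat n n (\<lambda>(i,j). W i j)" n] by simp
    then show ?case using M(1) by simp
  next
    case (Suc k)
    obtain P c where Pc: "fl n W k = (P, c)" by fastforce
    have c: "c = coeff \<chi> (n - k)" and P: "\<And>i j. i < n \<Longrightarrow> j < n \<Longrightarrow> P i j = (\<Sum>l<n. W i l * M k l j)"
      using Suc Pc by auto
    have P': "(\<Sum>l<n. W i l * (P l j + (if l = j then c else 0))) = (\<Sum>l<n. W i l * M (Suc k) l j)"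
      if "i < n" "j < n" for i j
      using that Suc.prems M(2)[of k] P c by (intro sum.cong) auto
    have "(\<Sum>i<n. \<Sum>l<n. W i l * M (Suc k) l i)
        = (\<Sum>i<n. M (Suc (Suc k)) i i - coeff \<chi> (n - Suc k))"
      using M(2)[OF Suc.prems] by (intro sum.cong) auto
    also have "\<dots> = (int (n - Suc k) - int n) * coeff \<chi> (n - Suc k)"
      using M(4)[OF Suc.prems] by (simp add: sum_subtractf left_diff_distrib)
    also have "\<dots> = - (int (Suc k) * coeff \<chi> (n - Suc k))"
      using Suc.prems by (simp add: of_nat_diff algebra_simps)
    finally have "- (\<Sum>i<n. \<Sum>l<n. W i l * M (Suc k) l i) = int (Suc k) * coeff \<chi> (n - Suc k)" by simp
    then show ?case using P' by (simp add: Pc Let_def del: of_nat_Suc)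
  qed
  then show ?thesis by (simp add: \<chi>_def)
qed

section \<open>Krylov vectors and controllability\<close>

definition mulv :: "nat \<Rightarrow> (nat \<Rightarrow> nat \<Rightarrow> 'a) \<Rightarrow> (nat \<Rightarrow> 'a) \<Rightarrow> nat \<Rightarrow> 'a::comm_ring_1" where
  "mulv n A v = (\<lambda>i. if i < n then \<Sum>j<n. A i j * v j else 0)"

abbreviation kry :: "nat \<Rightarrow> (nat \<Rightarrow> nat \<Rightarrow> 'a) \<Rightarrow> nat \<Rightarrow> (nat \<Rightarrow> 'a) \<Rightarrow> nat \<Rightarrow> 'a::comm_ring_1" where
  "kry n A k \<equiv> mulv n A ^^ k"

lemma mulv_nvecs: "mulv n A v \<in> nvecs n"
  by (simp add: mulv_def nvecs_def)

lemma kry_nvecs: "v \<in> nvecs n \<Longrightarrow> kry n A k v \<in> nvecs n"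
  by (cases k) (simp_all add: mulv_nvecs)

lemma mulv_sum: "mulv n A (\<lambda>i. \<Sum>a\<in>K. c a * f a i) = (\<lambda>i. \<Sum>a\<in>K. c a * mulv n A (f a) i)"
proof
  fix i
  have "(\<Sum>j<n. A i j * (\<Sum>a\<in>K. c a * f a j)) = (\<Sum>j<n. \<Sum>a\<in>K. c a * (A i j * f a j))"
    by (simp add: sum_distrib_left ac_simps)
  also have "\<dots> = (\<Sum>a\<in>K. \<Sum>j<n. c a * (A i j * f a j))" by (rule sum.swap)
  finally show "mulv n A (\<lambda>i. \<Sum>a\<in>K. c a * f a i) i = (\<Sum>a\<in>K. c a * mulv n A (f a) i)"
    by (simp add: mulv_def sum_distrib_left)
qed

lemma ip_mulv: "ip n (mulv n A v) w = ip n v (mulv n (\<lambda>i j. A j i) w)"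
proof -
  have "ip n (mulv n A v) w = (\<Sum>i<n. \<Sum>j<n. A i j * v j * w i)"
    by (simp add: ip_def mulv_def sum_distrib_right)
  also have "\<dots> = (\<Sum>j<n. \<Sum>i<n. A i j * v j * w i)" by (rule sum.swap)
  finally show ?thesis by (simp add: ip_def mulv_def sum_distrib_left ac_simps)
qed

lemma ip_kry: "ip n (kry n A k v) w = ip n v (kry n (\<lambda>i j. A j i) k w)"
proof (induction k arbitrary: w)
  case (Suc k)
  have "ip n (kry n A (Suc k) v) w = ip n v (kry n (\<lambda>i j. A j i) k (mulv n (\<lambda>i j. A j i) w))"
    by (simp add: ip_mulv Suc)
  then show ?case by (simp add: funpow_swap1)
qed simp

definition mmul :: "nat \<Rightarrow> (nat \<Rightarrow> nat \<Rightarrow> 'a) \<Rightarrow> (nat \<Rightarrow> nat \<Rightarrow> 'a) \<Rightarrow> nat \<Rightarrow> nat \<Rightarrow> 'a::comm_ring_1" where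
  "mmul n X Y = (\<lambda>i j. \<Sum>l<n. X i l * Y l j)"

text \<open>Horner scheme for the sum of \<open>A^k E (A^T)^k\<close> over \<open>k < t\<close>, the
  controllability Gramian of a discrete-time system.\<close>

fun gramian :: "nat \<Rightarrow> (nat \<Rightarrow> nat \<Rightarrow> 'a) \<Rightarrow> (nat \<Rightarrow> nat \<Rightarrow> 'a) \<Rightarrow> nat \<Rightarrow> nat \<Rightarrow> nat \<Rightarrow> 'a::comm_ring_1" where
  "gramian n A E 0 = (\<lambda>i j. 0)"
| "gramian n A E (Suc t) = (\<lambda>i j. mmul n (mmul n A (gramian n A E t)) (\<lambda>i j. A j i) i j + E i j)"

lemma sum_rank1:
  assumes "i < n" "j < n"
  shows "mmul n (mmul n A (\<lambda>i j. \<Sum>a\<in>K. c a * f a i * f a j)) (\<lambda>i j. A j i) i j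
    = (\<Sum>a\<in>K. c a * mulv n A (f a) i * mulv n A (f a) j)"
proof -
  have 1: "mmul n A (\<lambda>i j. \<Sum>a\<in>K. c a * f a i * f a j) i j = (\<Sum>a\<in>K. c a * mulv n A (f a) i * f a j)"
    if "i < n" for i j
  proof -
    have "mmul n A (\<lambda>i j. \<Sum>a\<in>K. c a * f a i * f a j) i j = (\<Sum>l<n. \<Sum>a\<in>K. c a * (A i l * f a l) * f a j)"
      by (simp add: mmul_def sum_distrib_left ac_simps)
    also have "\<dots> = (\<Sum>a\<in>K. \<Sum>l<n. c a * (A i l * f a l) * f a j)" by (rule sum.swap)
    finally show ?thesis using that by (simp add: mulv_def sum_distrib_left sum_distrib_right)
  qed
  have "mmul n (mmul n A (\<lambda>i j. \<Sum>a\<in>K. c a * f a i * f a j)) (\<lambda>i j. A j i) i j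
      = (\<Sum>l<n. (\<Sum>a\<in>K. c a * mulv n A (f a) i * f a l) * A j l)"
    unfolding mmul_def[of n "mmul n A (\<lambda>i j. \<Sum>a\<in>K. c a * f a i * f a j)"]
    using 1[OF assms(1)] by simp
  also have "\<dots> = (\<Sum>l<n. \<Sum>a\<in>K. c a * mulv n A (f a) i * (A j l * f a l))"
    by (simp add: sum_distrib_right sum_distrib_left ac_simps)
  also have "\<dots> = (\<Sum>a\<in>K. \<Sum>l<n. c a * mulv n A (f a) i * (A j l * f a l))" by (rule sum.swap)
  finally show ?thesis using assms(2) by (simp add: mulv_def sum_distrib_left)
qed

lemma mmul_cong:
  "(\<And>i j. i < n \<Longrightarrow> j < n \<Longrightarrow> X i j = X' i j) \<Longrightarrow> (\<And>i j. i < n \<Longrightarrow> j < n \<Longrightarrow> Y i j = Y' i j) \<Longrightarrow>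
   i < n \<Longrightarrow> j < n \<Longrightarrow> mmul n X Y i j = mmul n X' Y' i j"
  by (simp add: mmul_def)

text \<open>If \<open>E\<close> is a weighted sum of rank-one matrices \<open>b b^T\<close>, so is
  the Gramian, with the Krylov vectors of the \<open>b\<close> as generators; this is the shape that
  \<open>char_poly_gram\<close> expects.\<close>

lemma gramian_eq_sum:
  assumes E: "\<And>i j. i < n \<Longrightarrow> j < n \<Longrightarrow> E i j = (\<Sum>a\<in>K. c a * b a i * b a j)"
  shows "i < n \<Longrightarrow> j < n \<Longrightarrow> gramian n A E t i j
    = (\<Sum>(a,k)\<in>K \<times> {..<t}. c a * kry n A k (b a) i * kry n A k (b a) j)"
proof (induction t arbitrary: i j)
  case (Suc t)
  have "gramian n A E (Suc t) i j
      = mmul n (mmul n A (\<lambda>i j. \<Sum>x\<in>K \<times> {..<t}. c (fst x) * kry n A (snd x) (b (fst x)) i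
          * kry n A (snd x) (b (fst x)) j)) (\<lambda>i j. A j i) i j + E i j"
    using Suc by (auto intro!: mmul_cong simp: case_prod_unfold)
  also have "\<dots> = (\<Sum>x\<in>K \<times> {..<t}. c (fst x) * kry n A (Suc (snd x)) (b (fst x)) i
          * kry n A (Suc (snd x)) (b (fst x)) j) + E i j"
    by (subst sum_rank1[OF Suc.prems]) simp
  also have "\<dots> = (\<Sum>a\<in>K. \<Sum>k<t. c a * kry n A (Suc k) (b a) i * kry n A (Suc k) (b a) j)
      + (\<Sum>a\<in>K. c a * b a i * b a j)"
    using E Suc.prems by (simp add: sum.cartesian_product[symmetric] case_prod_unfold
        sum.cartesian_product)
  also have "\<dots> = (\<Sum>a\<in>K. \<Sum>k<Suc t. c a * kry n A k (b a) i * kry n A k (b a) j)"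
    unfolding sum.distrib[symmetric] sum.lessThan_Suc_shift by (simp add: add.commute)
  finally show ?case unfolding sum.cartesian_product .
qed simp

section \<open>Transfer between library matrices and coordinate functions\<close>

definition fvec :: "'a::zero vec \<Rightarrow> nat \<Rightarrow> 'a" where
  "fvec v = (\<lambda>i. if i < dim_vec v then v $ i else 0)"

definition fmat :: "'a mat \<Rightarrow> nat \<Rightarrow> nat \<Rightarrow> 'a" where
  "fmat A = (\<lambda>i j. A $$ (i, j))"

lemma fvec_nvecs: "v \<in> carrier_vec n \<Longrightarrow> fvec v \<in> nvecs n"
  by (auto simp: fvec_def nvecs_def)

lemma fvec_inj: "v \<in> carrier_vec n \<Longrightarrow> w \<in> carrier_vec n \<Longrightarrow> fvec v = fvec w \<Longrightarrow> v = w"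
proof (rule eq_vecI)
  fix i assume *: "v \<in> carrier_vec n" "w \<in> carrier_vec n" "fvec v = fvec w" "i < dim_vec w"
  show "v $ i = w $ i" using fun_cong[OF *(3), of i] *(1,2,4) by (simp add: fvec_def)
qed simp

text \<open>The library's rank is the size of a maximal independent set of columns, whereas here
  rank is decided by annihilators. Both directions pass through \<open>n\<close> chosen columns,
  which form a square matrix with nonzero determinant.\<close>

lemma rank_eq_dim_row_iff:
  fixes C :: "real mat"
  assumes C: "C \<in> carrier_mat n nc"
  shows "vec_space.rank n C = n \<longleftrightarrow>
    (\<forall>w\<in>nvecs n. (\<forall>c\<in>set (cols C). ip n (fvec c) w = 0) \<longrightarrow> w = 0)"
proof -
  interpret vec_space "TYPE(real)" n .
  have colsC: "set (cols C) \<subseteq> carrier_vec n" using cols_dim C by blast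
  have "lin_indpt {}" by (rule finite_lin_indpt2) auto
  then have ex: "\<exists>S. finite S \<and> maximal S (\<lambda>T. T \<subseteq> set (cols C) \<and> lin_indpt T) \<and> {} \<subseteq> S"
    by (intro maximal_exists_superset[of "set (cols C)"]) auto
  then obtain S where S: "finite S" "maximal S (\<lambda>T. T \<subseteq> set (cols C) \<and> lin_indpt T)" by blast
  have SC: "S \<subseteq> set (cols C)" and liS: "lin_indpt S" using S(2) by (auto simp: maximal_def)
  have rank: "rank C = card S" by (rule rank_card_indpt[OF C S(2)])
  show ?thesis
  proof
    assume "rank C = n"
    obtain vs where vs: "set vs = S" "distinct vs" using finite_distinct_list[OF S(1)] by blast
    have len: "length vs = n" using rank \<open>rank C = n\<close> distinct_card[OF vs(2)] vs(1) by simp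
    define M where "M = mat_of_cols n vs"
    have M: "M \<in> carrier_mat n n" using mat_of_cols_carrier(1)[of n vs] len by (simp add: M_def)
    have colsM: "cols M = vs" unfolding M_def using vs(1) SC colsC by (intro cols_mat_of_cols) auto
    have "rank M = n" by (rule lin_indpt_full_rank[OF M]) (use colsM vs liS in auto)
    then have "det M \<noteq> 0" using det_rank_iff[OF M] by simp
    then have detT: "det (transpose_mat M) \<noteq> 0" using det_transpose[OF M] by simp
    have MT: "transpose_mat M \<in> carrier_mat n n" using M by simp
    show "\<forall>w\<in>nvecs n. (\<forall>c\<in>set (cols C). ip n (fvec c) w = 0) \<longrightarrow> w = 0"
    proof (intro ballI impI)
      fix w :: "nat \<Rightarrow> real" assume w: "w \<in> nvecs n" "\<forall>c\<in>set (cols C). ip n (fvec c) w = 0"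
      have "transpose_mat M *\<^sub>v vec n w = 0\<^sub>v n"
      proof (rule eq_vecI)
        fix j assume "j < dim_vec (0\<^sub>v n :: real vec)"
        then have j: "j < n" by simp
        then have vj: "vs ! j \<in> set (cols C)" using vs(1) SC len by auto
        then have "dim_vec (vs ! j) = n" using colsC by auto
        then have "(transpose_mat M *\<^sub>v vec n w) $ j = ip n (fvec (vs ! j)) w"
          using j len colsM M by (auto simp: scalar_prod_def ip_def fvec_def atLeast0LessThan M_def
              mat_of_cols_def intro!: sum.cong)
        then show "(transpose_mat M *\<^sub>v vec n w) $ j = 0\<^sub>v n $ j" using w(2) vj j by simp
      qed (use M in simp)
      moreover have "vec n w \<in> carrier_vec n" by simp
      ultimately have wz: "vec n w = 0\<^sub>v n"
        using det_0_iff_vec_prod_zero_field[OF MT] detT by blast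
      have "w i = 0" if "i < n" for i
        using arg_cong[OF wz, of "\<lambda>v. v $ i"] that by simp
      moreover have "w i = 0" if "\<not> i < n" for i
        using w(1) that by (simp add: nvecs_def)
      ultimately show "w = 0" by (intro ext) (metis zero_fun_apply)
    qed
  next
    assume *: "\<forall>w\<in>nvecs n. (\<forall>c\<in>set (cols C). ip n (fvec c) w = 0) \<longrightarrow> w = 0"
    define F where "F = fvec ` set (cols C)"
    have F: "finite F" "F \<subseteq> nvecs n" using colsC fvec_nvecs by (auto simp: F_def)
    have "fs.dim F = n" using dim_eq_full_iff[OF F] * by (simp add: F_def)
    moreover obtain I where I: "I \<subseteq> F" "fs.independent I" "F \<subseteq> fs.span I" "card I = fs.dim F"
      by (rule fs.basis_exists)
    ultimately have cI: "card I = n" by simp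
    define U where "U = {v \<in> set (cols C). fvec v \<in> I}"
    have inj: "inj_on fvec U" using fvec_inj colsC by (auto simp: inj_on_def U_def)
    have img: "fvec ` U = I" using I(1) by (auto simp: U_def F_def)
    have cU: "card U = n" using card_image[OF inj] img cI by simp
    have "finite U" by (simp add: U_def)
    then obtain vs where vs: "set vs = U" "distinct vs" using finite_distinct_list by blast
    have len: "length vs = n" using distinct_card[OF vs(2)] vs(1) cU by simp
    define M where "M = mat_of_cols n vs"
    have M: "M \<in> carrier_mat n n" using mat_of_cols_carrier(1)[of n vs] len by (simp add: M_def)
    have UC: "U \<subseteq> set (cols C)" by (auto simp: U_def)
    have colsM: "cols M = vs" unfolding M_def using vs(1) UC colsC by (intro cols_mat_of_cols) auto
    have "bij_betw (\<lambda>j. vs ! j) {..<n} U" using vs len by (intro bij_betw_nth) auto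
    then have bij: "bij_betw (\<lambda>j. fvec (vs ! j)) {..<n} I"
      using bij_betw_trans[OF _ bij_betw_imageI[OF inj img]] by (simp add: comp_def)
    have "det M \<noteq> 0"
    proof
      assume "det M = 0"
      then obtain z where z: "z \<in> carrier_vec n" "z \<noteq> 0\<^sub>v n" "M *\<^sub>v z = 0\<^sub>v n"
        using det_0_iff_vec_prod_zero_field[OF M] by blast
      have dv: "dim_vec (vs ! j) = n" if "j < n" for j
      proof -
        have "vs ! j \<in> U" using that vs(1) len by auto
        then show ?thesis using UC colsC by auto
      qed
      have 0: "(\<Sum>j<n. (\<lambda>i. z $ j * fvec (vs ! j) i)) = 0"
      proof
        fix i
        show "(\<Sum>j<n. (\<lambda>i. z $ j * fvec (vs ! j) i)) i = 0 i"
        proof (cases "i < n")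
          case True
          then have "(M *\<^sub>v z) $ i = (\<Sum>j<n. z $ j * fvec (vs ! j) i)"
            using z(1) len dv by (auto simp: M_def mat_of_cols_def scalar_prod_def fvec_def
                atLeast0LessThan mult.commute intro!: sum.cong)
          then show ?thesis using z(3) True by (simp add: sum_fun_apply)
        next
          case False
          then show ?thesis using dv by (auto simp: sum_fun_apply fvec_def intro!: sum.neutral)
        qed
      qed
      have "z $ j = 0" if "j < n" for j
        by (rule independent_sum_reindex[OF I(2) bij 0 that])
      then have "z = 0\<^sub>v n" using z(1) by auto
      then show False using z(2) by simp
    qed
    then have "rank M = n" using det_rank_iff[OF M] by simp
    then have "lin_indpt (set (cols M))" using full_rank_lin_indpt[OF M] colsM vs(2) by simp
    then have "card U \<le> rank C" using rank_ge_card_indpt[OF C UC] colsM vs(1) by simp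
    moreover have "card S \<le> n" using li_le_dim(2)[OF _ _ liS] SC colsC dim_is_n fin_dim by auto
    ultimately show "rank C = n" using cU rank by simp
  qed
qed

text \<open>Kalman's rank condition in dual form. The inputs form a set, so that a single vector,
  the columns of a diagonal matrix and the unit vectors of a support are treated alike.\<close>

definition full :: "nat \<Rightarrow> (nat \<Rightarrow> nat \<Rightarrow> real) \<Rightarrow> (nat \<Rightarrow> real) set \<Rightarrow> bool" where
  "full n A Bs \<longleftrightarrow>
    (\<forall>w\<in>nvecs n. (\<forall>k<n. \<forall>b\<in>Bs. ip n (kry n A k b) w = 0) \<longrightarrow> w = 0)"

lemma fvec_mult:
  "A \<in> carrier_mat n n \<Longrightarrow> v \<in> carrier_vec n \<Longrightarrow> fvec (A *\<^sub>v v) = mulv n (fmat A) (fvec v)"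
  by (auto simp: fvec_def mulv_def fmat_def scalar_prod_def atLeast0LessThan fun_eq_iff
      intro!: sum.cong)

lemma fvec_pow_mult:
  fixes A :: "'a::comm_ring_1 mat"
  assumes A: "A \<in> carrier_mat n n" 
  shows "v \<in> carrier_vec n \<Longrightarrow> fvec (A ^\<^sub>m k *\<^sub>v v) = kry n (fmat A) k (fvec v)"
proof (induction k arbitrary: v)
  case (Suc k)
  have "A ^\<^sub>m Suc k *\<^sub>v v = A ^\<^sub>m k *\<^sub>v (A *\<^sub>v v)"
    using assoc_mult_mat_vec[OF pow_carrier_mat[OF A] A Suc.prems] by simp
  then show ?case using Suc.IH[of "A *\<^sub>v v"] A Suc.prems by (simp add: fvec_mult funpow_swap1)
qed (use A in simp)

lemma controllable_iff_full:
  assumes A: "A \<in> carrier_mat n n" and B: "B \<in> carrier_mat n m"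
  shows "controllable A B \<longleftrightarrow> full n (fmat A) ((\<lambda>j. fvec (col B j)) ` {..<m})"
proof -
  have dim: "dim_row A = n" using A by simp
  define L where "L = concat (map (\<lambda>k. cols (A ^\<^sub>m k * B)) [0..<n])"
  have P: "A ^\<^sub>m k \<in> carrier_mat n n" for k using A by simp
  have setL: "set L = {A ^\<^sub>m k *\<^sub>v col B j | k j. k < n \<and> j < m}"
  proof -
    have "set (cols (A ^\<^sub>m k * B)) = (\<lambda>j. A ^\<^sub>m k *\<^sub>v col B j) ` {..<m}" for k
    proof -
      have "set (cols (A ^\<^sub>m k * B)) = col (A ^\<^sub>m k * B) ` {..<m}"
        using B by (auto simp: cols_def)
      also have "\<dots> = (\<lambda>j. A ^\<^sub>m k *\<^sub>v col B j) ` {..<m}"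
        by (intro image_cong refl) (use col_mult2[OF P B] in auto)
      finally show ?thesis .
    qed
    then have "set L = (\<Union>k\<in>{..<n}. (\<lambda>j. A ^\<^sub>m k *\<^sub>v col B j) ` {..<m})"
      by (simp add: L_def atLeast0LessThan)
    then show ?thesis by blast
  qed
  have "cols (mat_of_cols n L) = L"
    using setL B P by (intro cols_mat_of_cols) (auto intro!: mult_mat_vec_carrier col_carrier_vec)
  then have cs: "set (cols (ctrb_mat A B)) = {A ^\<^sub>m k *\<^sub>v col B j | k j. k < n \<and> j < m}"
    using setL by (simp add: ctrb_mat_def dim L_def)
  have C: "ctrb_mat A B \<in> carrier_mat n (length L)" by (simp add: ctrb_mat_def dim L_def)
  have fv: "fvec (A ^\<^sub>m k *\<^sub>v col B j) = kry n (fmat A) k (fvec (col B j))" for k j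
    using B by (intro fvec_pow_mult[OF A]) auto
  have "(\<forall>c\<in>set (cols (ctrb_mat A B)). ip n (fvec c) w = 0) \<longleftrightarrow>
      (\<forall>k<n. \<forall>b\<in>(\<lambda>j. fvec (col B j)) ` {..<m}. ip n (kry n (fmat A) k b) w = 0)" for w
  proof -
    have "{A ^\<^sub>m k *\<^sub>v col B j | k j. k < n \<and> j < m}
        = (\<lambda>(k,j). A ^\<^sub>m k *\<^sub>v col B j) ` ({..<n} \<times> {..<m})" by auto
    then show ?thesis unfolding cs by (auto simp: fv)
  qed
  then show ?thesis unfolding controllable_def dim rank_eq_dim_row_iff[OF C] full_def by simp
qed

lemma kry_sum: "kry n A k (\<lambda>i. \<Sum>a\<in>K. c a * f a i) = (\<lambda>i. \<Sum>a\<in>K. c a * kry n A k (f a) i)"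
  by (induction k) (simp_all add: mulv_sum)

text \<open>An annihilator of the Krylov vectors of \<open>Bs'\<close> annihilates those of every
  linear combination. This is how a vector or a diagonal matrix is compared with the unit vectors on
  its support.\<close>

lemma full_mono:
  assumes "full n A Bs" and "\<And>b. b \<in> Bs \<Longrightarrow> \<exists>K c. b = (\<lambda>i. \<Sum>a\<in>K. c a * a i) \<and> K \<subseteq> Bs'"
  shows "full n A Bs'"
  unfolding full_def
proof (intro ballI impI)
  fix w assume w: "w \<in> nvecs n" "\<forall>k<n. \<forall>b\<in>Bs'. ip n (kry n A k b) w = 0"
  have "ip n (kry n A k b) w = 0" if kb: "k < n" "b \<in> Bs" for k b
  proof -
    obtain K c where K: "b = (\<lambda>i. \<Sum>a\<in>K. c a * a i)" "K \<subseteq> Bs'"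
      using assms(2)[OF kb(2)] by (elim exE conjE)
    have "ip n (kry n A k b) w = (\<Sum>a\<in>K. c a * ip n (kry n A k a) w)"
      unfolding K(1) kry_sum ip_sum by (simp add: ip_scale)
    then show ?thesis using w(2) kb(1) K(2) by (auto intro!: sum.neutral)
  qed
  then show "w = 0" using assms(1) w(1) by (simp add: full_def)
qed

lemma mulv_scale: "mulv n (\<lambda>i j. d * A i j) (\<lambda>i. c * v i) = (\<lambda>i. d * c * mulv n A v i)"
  by (simp add: mulv_def fun_eq_iff sum_distrib_left ac_simps)

lemma kry_scale: "kry n (\<lambda>i j. d * A i j) k b = (\<lambda>i. d ^ k * kry n A k b i)"
proof (induction k)
  case (Suc k)
  have "kry n (\<lambda>i j. d * A i j) (Suc k) b = mulv n (\<lambda>i j. d * A i j) (\<lambda>i. d ^ k * kry n A k b i)"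
    using Suc by simp
  then show ?case unfolding mulv_scale by simp
qed simp

text \<open>The \<open>k\<close>-th Krylov vector is multiplied by \<open>d^k\<close>, which changes
  no annihilator; hence clearing denominators preserves controllability.\<close>

lemma full_scale:
  assumes "d \<noteq> 0"
  shows "full n (\<lambda>i j. d * A i j) Bs \<longleftrightarrow> full n A Bs"
proof -
  have "ip n (kry n (\<lambda>i j. d * A i j) k b) w = 0 \<longleftrightarrow> ip n (kry n A k b) w = 0" for k b w
    unfolding kry_scale ip_scale using assms by simp
  then show ?thesis by (simp only: full_def)
qed

lemma full_iff_dim:
  assumes "finite Bs" "Bs \<subseteq> nvecs n"
  shows "full n A Bs \<longleftrightarrow> fs.dim ((\<lambda>(b,k). kry n A k b) ` (Bs \<times> {..<n})) = n"
proof -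
  have fin: "finite ((\<lambda>(b,k). kry n A k b) ` (Bs \<times> {..<n}))" using assms(1) by simp
  have "(\<lambda>(b,k). kry n A k b) ` (Bs \<times> {..<n}) \<subseteq> nvecs n" using assms(2) by (auto intro!: kry_nvecs)
  from dim_eq_full_iff[OF fin this] show ?thesis by (auto simp: full_def)
qed

section \<open>Controllable vectors with prescribed support\<close>

lemma kry_add: "kry n A (j + k) v = kry n A j (kry n A k v)"
  by (simp add: funpow_add)

text \<open>Unrolling the recursion for the adjugate coefficients writes \<open>M k w\<close> as a
  partial Horner sum of \<open>\<chi>(A) w\<close>; the last one is zero because
  \<open>M (Suc n) = 0\<close>.\<close>

lemma cayley_hamilton:
  fixes A :: "nat \<Rightarrow> nat \<Rightarrow> 'a::idom" and w :: "nat \<Rightarrow> 'a"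
  assumes w: "w \<in> nvecs n"
  shows "(\<Sum>j\<le>n. coeff (char_poly (mat n n (\<lambda>(i,j). A i j))) j * kry n A j w i) = 0"
proof -
  define \<chi> where "\<chi> = char_poly (mat n n (\<lambda>(i,j). A i j))"
  obtain M :: "nat \<Rightarrow> nat \<Rightarrow> nat \<Rightarrow> 'a" where
    M: "\<And>i j. i < n \<Longrightarrow> j < n \<Longrightarrow> M 0 i j = 0"
    "\<And>k i j. k \<le> n \<Longrightarrow> i < n \<Longrightarrow> j < n \<Longrightarrow>
       M (Suc k) i j = (\<Sum>l<n. A i l * M k l j) + (if i = j then coeff \<chi> (n - k) else 0)"
    "\<And>i j. M (Suc n) i j = 0"
    "\<And>k. k \<le> n \<Longrightarrow> (\<Sum>i<n. M (Suc k) i i) = of_nat (n - k) * coeff \<chi> (n - k)"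
    by (rule adjugate_coefficients[of n A, folded \<chi>_def]) (rule that; assumption)
  have rec: "mulv n (M (Suc k)) w i = mulv n A (mulv n (M k) w) i + coeff \<chi> (n - k) * w i"
    if k: "k \<le> n" for k i
  proof (cases "i < n")
    case True
    have "mulv n (M (Suc k)) w i = (\<Sum>j<n. M (Suc k) i j * w j)" using True by (simp add: mulv_def)
    also have "\<dots>
        = (\<Sum>j<n. (\<Sum>l<n. A i l * M k l j) * w j + (if i = j then coeff \<chi> (n - k) * w j else 0))"
      by (rule sum.cong[OF refl]) (simp add: M(2)[OF k True] distrib_right)
    also have "\<dots> = (\<Sum>j<n. \<Sum>l<n. A i l * (M k l j * w j)) + coeff \<chi> (n - k) * w i"
      using True by (simp add: sum.distrib sum_distrib_right mult.assoc)
    also have "(\<Sum>j<n. \<Sum>l<n. A i l * (M k l j * w j)) = (\<Sum>l<n. \<Sum>j<n. A i l * (M k l j * w j))"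
      by (rule sum.swap)
    also have "\<dots> = mulv n A (mulv n (M k) w) i" using True by (simp add: mulv_def sum_distrib_left)
    finally show ?thesis .
  next
    case False
    then show ?thesis using w by (simp add: mulv_def nvecs_def)
  qed
  have "mulv n (M k) w = (\<lambda>i. \<Sum>j<k. coeff \<chi> (n - j) * kry n A (k - 1 - j) w i)" if "k \<le> Suc n" for k
    using that
  proof (induction k)
    case 0
    show ?case using M(1) by (auto simp: mulv_def)
  next
    case (Suc k)
    have IH: "mulv n (M k) w = (\<lambda>i. \<Sum>j<k. coeff \<chi> (n - j) * kry n A (k - 1 - j) w i)"
      using Suc by simp
    show ?case
    proof
      fix i
      have "mulv n (M (Suc k)) w i
          = (\<Sum>j<k. coeff \<chi> (n - j) * kry n A (Suc (k - 1 - j)) w i) + coeff \<chi> (n - k) * w i"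
        using rec[of k i] Suc.prems unfolding IH mulv_sum by simp
      also have "(\<Sum>j<k. coeff \<chi> (n - j) * kry n A (Suc (k - 1 - j)) w i)
          = (\<Sum>j<k. coeff \<chi> (n - j) * kry n A (k - j) w i)"
      proof (rule sum.cong[OF refl])
        fix j assume "j \<in> {..<k}"
        then have "Suc (k - 1 - j) = k - j" by auto
        then show "coeff \<chi> (n - j) * kry n A (Suc (k - 1 - j)) w i
            = coeff \<chi> (n - j) * kry n A (k - j) w i" by metis
      qed
      finally show "mulv n (M (Suc k)) w i
          = (\<Sum>j<Suc k. coeff \<chi> (n - j) * kry n A (Suc k - 1 - j) w i)" by simp
    qed
  qed
  from fun_cong[OF this[of "Suc n"], of i]
  have "mulv n (M (Suc n)) w i = (\<Sum>j<Suc n. coeff \<chi> (n - j) * kry n A (n - j) w i)" by simp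
  moreover have "mulv n (M (Suc n)) w i = 0" using M(3) by (simp add: mulv_def)
  ultimately have "(\<Sum>j<Suc n. coeff \<chi> (n - j) * kry n A (n - j) w i) = 0" by simp
  also have "(\<Sum>j<Suc n. coeff \<chi> (n - j) * kry n A (n - j) w i)
      = (\<Sum>j<Suc n. coeff \<chi> j * kry n A j w i)"
    using sum.nat_diff_reindex[of "\<lambda>j. coeff \<chi> j * kry n A j w i" "Suc n"] by simp
  finally show ?thesis by (simp add: \<chi>_def lessThan_Suc_atMost)
qed

text \<open>By Cayley-Hamilton, applied to \<open>A^(k-n) w\<close>, the \<open>k\<close>-th inner
  product is a combination of the \<open>n\<close> preceding ones. All \<open>k\<close> are wanted
  because the eigenvector used later is a polynomial of arbitrary degree in the matrix, applied to
  \<open>w\<close>.\<close>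

lemma krylov_annihilator_extend:
  fixes A :: "nat \<Rightarrow> nat \<Rightarrow> 'a::idom"
  assumes w: "w \<in> nvecs n" and ann: "\<And>k. k < n \<Longrightarrow> ip n b (kry n A k w) = 0"
  shows "ip n b (kry n A k w) = 0"
proof (induction k rule: less_induct)
  case (less k)
  show ?case
  proof (cases "k < n")
    case False
    define v where "v = kry n A (k - n) w"
    define \<chi> where "\<chi> = char_poly (mat n n (\<lambda>(i,j). A i j))"
    have mon: "coeff \<chi> n = 1"
      unfolding \<chi>_def using degree_monic_char_poly[of "mat n n (\<lambda>(i,j). A i j)" n] by simp
    have kv: "kry n A j v = kry n A (j + (k - n)) w" for j by (simp add: v_def kry_add)
    have "ip n b (kry n A j v) = 0" if "j < n" for j
      using less.IH[of "j + (k - n)"] False that by (simp add: kv)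
    moreover have "(\<Sum>j\<le>n. coeff \<chi> j * ip n b (kry n A j v)) = 0"
    proof -
      have "(\<Sum>j\<le>n. coeff \<chi> j * ip n b (kry n A j v)) = ip n b (\<lambda>i. \<Sum>j\<le>n. coeff \<chi> j * kry n A j v i)"
        by (subst (2) ip_commute) (simp add: ip_sum ip_scale ip_commute[of n b])
      also have "\<dots> = 0"
        using cayley_hamilton[of v n A] kry_nvecs[OF w] by (simp add: \<chi>_def v_def ip_def)
      finally show ?thesis .
    qed
    ultimately have "ip n b (kry n A n v) = 0"
      using mon by (simp add: lessThan_Suc_atMost[symmetric])
    then show ?thesis using False by (simp add: kv)
  qed (rule ann)
qed

text \<open>The vector \<open>p(A) w\<close>.\<close>

definition act :: "nat \<Rightarrow> (nat \<Rightarrow> nat \<Rightarrow> 'a::comm_ring_1) \<Rightarrow> 'a poly \<Rightarrow> (nat \<Rightarrow> 'a) \<Rightarrow> nat \<Rightarrow> 'a" where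
  "act n A p w = (\<lambda>i. \<Sum>k\<le>degree p. coeff p k * kry n A k w i)"

lemma act_ge: "degree p \<le> N \<Longrightarrow> act n A p w = (\<lambda>i. \<Sum>k\<le>N. coeff p k * kry n A k w i)"
  unfolding act_def by (intro ext sum.mono_neutral_left) (auto simp: coeff_eq_0)

lemma act_linear_factor:
  "act n A ([:- a, 1:] * p) w = (\<lambda>i. mulv n A (act n A p w) i - a * act n A p w i)"
proof (cases "p = 0")
  case False
  define N where "N = degree p"
  have N: "degree ([:- a, 1:] * p) \<le> Suc N" "degree p \<le> N" "degree p \<le> Suc N"
    using degree_mult_le[of "[:-a,1:]" p] by (auto simp: N_def)
  have c: "coeff ([:- a, 1:] * p) k = coeff (pCons 0 p) k - a * coeff p k" for k by simp
  show ?thesis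
  proof
    fix i
    have "act n A ([:- a, 1:] * p) w i
        = (\<Sum>k\<le>Suc N. coeff (pCons 0 p) k * kry n A k w i) - a * (\<Sum>k\<le>Suc N. coeff p k * kry n A k w i)"
      unfolding act_ge[OF N(1)] c by (simp only: left_diff_distrib sum_subtractf sum_distrib_left mult.assoc)
    also have "(\<Sum>k\<le>Suc N. coeff p k * kry n A k w i) = act n A p w i"
      by (simp only: act_ge[OF N(3)])
    also have "(\<Sum>k\<le>Suc N. coeff (pCons 0 p) k * kry n A k w i) = (\<Sum>k\<le>N. coeff p k * kry n A (Suc k) w i)"
      by (subst sum.atMost_Suc_shift) simp
    also have "\<dots> = mulv n A (act n A p w) i"
      unfolding act_ge[OF N(2)] mulv_sum by simp
    finally show "act n A ([:- a, 1:] * p) w i = mulv n A (act n A p w) i - a * act n A p w i" .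
  qed
qed (simp add: act_def mulv_def fun_eq_iff)

text \<open>Take \<open>q\<close> of least degree among the nonzero polynomials with
  \<open>q(A) w = 0\<close>, which exist by Cayley-Hamilton, and split off a linear factor
  \<open>x - a\<close>. By minimality the cofactor \<open>p\<close> does not annihilate
  \<open>w\<close>, and \<open>A - a\<close> kills \<open>p(A) w\<close>. Hence an annihilator can
  be replaced by an eigenvector in its Krylov space, the substantial direction of the eigenvector
  test.\<close>

lemma exists_eigenvector_in_krylov:
  fixes A :: "nat \<Rightarrow> nat \<Rightarrow> complex"
  assumes w: "w \<in> nvecs n" "w \<noteq> 0"
  obtains a p where "act n A p w \<noteq> 0" "mulv n A (act n A p w) = (\<lambda>i. a * act n A p w i)"
proof -
  define P where "P q \<longleftrightarrow> q \<noteq> 0 \<and> act n A q w = 0" for q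
  define \<chi> where "\<chi> = char_poly (mat n n (\<lambda>(i,j). A i j))"
  have deg: "degree \<chi> = n" "coeff \<chi> n = 1"
    unfolding \<chi>_def using degree_monic_char_poly[of "mat n n (\<lambda>(i,j). A i j)" n] by simp_all
  have "P \<chi>" unfolding P_def
  proof
    show "\<chi> \<noteq> 0" using deg by auto
    show "act n A \<chi> w = 0"
      using cayley_hamilton[OF w(1), of A] by (simp add: act_def deg(1) fun_eq_iff \<chi>_def[symmetric])
  qed
  then obtain q where q: "P q" "\<And>r. P r \<Longrightarrow> degree q \<le> degree r"
    using ex_has_least_nat[of P \<chi> degree] by blast
  have "degree q \<noteq> 0"
  proof
    assume "degree q = 0"
    then obtain c where c: "q = [:c:]" by (metis degree_eq_zeroE)
    then have "act n A q w = (\<lambda>i. c * w i)" by (simp add: act_def)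
    then have "\<And>i. c * w i = 0" using q(1) by (metis P_def zero_fun_apply)
    moreover have "c \<noteq> 0" using q(1) c by (auto simp: P_def)
    ultimately have "w = 0" by (intro ext) simp
    then show False using w(2) by simp
  qed
  then have "\<not> constant (poly q)" by (simp add: constant_degree)
  then obtain a where "poly q a = 0" using fundamental_theorem_of_algebra by blast
  then obtain p where p: "q = [:- a, 1:] * p" by (metis poly_eq_0_iff_dvd dvdE)
  have "p \<noteq> 0" using q(1) p by (auto simp: P_def)
  then have "degree q = Suc (degree p)" unfolding p by (subst degree_mult_eq) auto
  then have "\<not> P p" using q(2)[of p] by auto
  then have 1: "act n A p w \<noteq> 0" using \<open>p \<noteq> 0\<close> by (simp add: P_def)
  have "act n A q w = 0" using q(1) by (simp add: P_def)
  then have "mulv n A (act n A p w) i - a * act n A p w i = 0" for i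
    unfolding p act_linear_factor by (metis zero_fun_apply)
  then have "mulv n A (act n A p w) = (\<lambda>i. a * act n A p w i)" by (intro ext) simp
  with 1 show ?thesis by (rule that)
qed

lemma act_nvecs: "w \<in> nvecs n \<Longrightarrow> act n A p w \<in> nvecs n"
  unfolding act_def nvecs_def using kry_nvecs[of w n] by (auto simp: nvecs_def intro!: sum.neutral)

section \<open>Controllability tested on eigenvectors of the transpose\<close>

lemma kry_eigenvector:
  "mulv n A z = (\<lambda>i. a * z i) \<Longrightarrow> kry n A k z = (\<lambda>i. a ^ k * z i)"
proof (induction k)
  case (Suc k)
  have "kry n A (Suc k) z = mulv n A (\<lambda>i. a ^ k * z i)" using Suc by simp
  also have "\<dots> = (\<lambda>i. a ^ k * mulv n A z i)" using mulv_scale[of n 1 A "a ^ k" z] by simp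
  finally show ?case using Suc.prems by (simp add: ac_simps)
qed simp

lemma of_real_kry:
  "complex_of_real (kry n A k b i) = kry n (\<lambda>i j. of_real (A i j)) k (\<lambda>i. of_real (b i)) i"
proof (induction k arbitrary: i)
  case (Suc k)
  then show ?case by (simp add: mulv_def)
qed simp

text \<open>The annihilation conditions have real coefficients, so they hold for the real and the
  imaginary part of \<open>w\<close> separately. They are phrased with the transpose because its
  eigenvectors are what gets tested.\<close>

lemma full_complex:
  fixes A :: "nat \<Rightarrow> nat \<Rightarrow> real" and w :: "nat \<Rightarrow> complex"
  defines "T \<equiv> \<lambda>i j. complex_of_real (A j i)"
  assumes full: "full n A Bs" and w: "w \<in> nvecs n"
    and ann: "\<And>k b. k < n \<Longrightarrow> b \<in> Bs \<Longrightarrow> ip n (\<lambda>i. of_real (b i)) (kry n T k w) = 0"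
  shows "w = 0"
proof -
  have 0: "(\<Sum>i<n. complex_of_real (kry n A k b i) * w i) = 0" if "k < n" "b \<in> Bs" for k b
    using ann[OF that] ip_kry[where n = n and A = "\<lambda>i j. complex_of_real (A i j)" and k = k
        and v = "\<lambda>i. of_real (b i)" and w = w]
    by (simp add: ip_def of_real_kry T_def)
  have re: "(\<Sum>i<n. kry n A k b i * Re (w i)) = 0" and im: "(\<Sum>i<n. kry n A k b i * Im (w i)) = 0"
    if "k < n" "b \<in> Bs" for k b
    using arg_cong[OF 0[OF that], of Re] arg_cong[OF 0[OF that], of Im]
    by (simp_all add: Re_sum Im_sum)
  have "(\<lambda>i. Re (w i)) \<in> nvecs n" "(\<lambda>i. Im (w i)) \<in> nvecs n" using w by (auto simp: nvecs_def)
  then have "(\<lambda>i. Re (w i)) = 0" "(\<lambda>i. Im (w i)) = 0"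
    using full re im by (auto simp: full_def ip_def)
  then have "Re (w i) = 0" "Im (w i) = 0" for i by (metis zero_fun_apply)+
  then show "w = 0" by (intro ext) (simp add: complex_eq_iff)
qed

lemma mulv_diff_scale: "mulv n A (\<lambda>i. u i - c * v i) = (\<lambda>i. mulv n A u i - c * mulv n A v i)"
  by (simp add: mulv_def fun_eq_iff right_diff_distrib sum_subtractf sum_distrib_left ac_simps)

lemma ip_diff_scale: "ip n x (\<lambda>i. u i - c * v i) = ip n x u - c * ip n x v"
  by (simp add: ip_def right_diff_distrib sum_subtractf sum_distrib_left ac_simps)

definition uvec :: "nat \<Rightarrow> nat \<Rightarrow> 'a::zero_neq_one" where
  "uvec j = (\<lambda>i. if i = j then 1 else 0)"

text \<open>For every eigenvalue of the transpose the eigenspace is one-dimensional, because \<open>b0\<close> is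
  controllable. Its eigenvector, normalised by \<open>b0\<close>, gives a polynomial of degree less than \<open>n\<close>
  whose roots are the values of \<open>t\<close> that are bad for this eigenvalue.\<close>

lemma exists_controllable_moment_vector:
  fixes A :: "nat \<Rightarrow> nat \<Rightarrow> real"
  assumes n: "0 < n" and X: "X \<subseteq> {..<n}"
    and b0: "full n A {b0}" and fX: "full n A (uvec ` X)"
  shows "\<exists>t<n * n. full n A {\<lambda>i. if i \<in> X then of_nat t ^ i else 0}"
proof (rule ccontr)
  assume "\<not> ?thesis"
  then have bad: "\<not> full n A {\<lambda>i. if i \<in> X then of_nat t ^ i else 0}" if "t < n * n" for t
    using that by blast
  define T where "T = (\<lambda>i j. complex_of_real (A j i))"
  define \<chi> where "\<chi> = char_poly (mat n n (\<lambda>(i,j). T i j))"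
  define cb where "cb = (\<lambda>i. complex_of_real (b0 i))"
  define eig where "eig a z \<longleftrightarrow> z \<in> nvecs n \<and> mulv n T z = (\<lambda>i. a * z i)" for a z
  \<comment> \<open>The easy direction of the eigenvector test: an eigenvector orthogonal to
    \<open>b0\<close> would annihilate all Krylov vectors of \<open>b0\<close>.\<close>
  have inj: "z = 0" if "eig a z" "ip n cb z = 0" for a z
  proof (rule full_complex[OF b0])
    show "z \<in> nvecs n" using that by (simp add: eig_def)
    fix k b assume "b \<in> {b0}"
    then show "ip n (\<lambda>i. of_real (b i)) (kry n (\<lambda>i j. complex_of_real (A j i)) k z) = 0"
      using kry_eigenvector[of n T z a k] that
      by (simp add: eig_def T_def[symmetric] cb_def[symmetric] ip_commute[of n cb] ip_scale)
  qed
  define zz where "zz a = (SOME z. eig a z \<and> ip n cb z = 1)" for a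
  have zz: "eig a (zz a) \<and> ip n cb (zz a) = 1 \<and> z = (\<lambda>i. ip n cb z * zz a i)"
    if z: "eig a z" "z \<noteq> 0" for a z
  proof -
    have c: "ip n cb z \<noteq> 0" using inj z by blast
    have "eig a (\<lambda>i. 1 / ip n cb z * z i)"
      using z(1) mulv_scale[of n 1 T "1 / ip n cb z" z] by (simp add: eig_def nvecs_def)
    moreover have "ip n cb (\<lambda>i. 1 / ip n cb z * z i) = 1"
      using c by (subst ip_commute) (simp only: ip_scale ip_commute[of n z], simp)
    ultimately have ez: "eig a (zz a) \<and> ip n cb (zz a) = 1" 
      unfolding zz_def using someI[of "\<lambda>z. eig a z \<and> ip n cb z = 1" "\<lambda>i. 1 / ip n cb z * z i"] by blast
    \<comment> \<open>One-dimensionality: subtracting the right multiple of the normalised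
      eigenvector leaves an element of the eigenspace orthogonal to \<open>b0\<close>.\<close>
    define d where "d = (\<lambda>i. z i - ip n cb z * zz a i)"
    have "eig a d"
    proof -
      have "mulv n T z = (\<lambda>i. a * z i)" "mulv n T (zz a) = (\<lambda>i. a * zz a i)"
        using z(1) ez by (auto simp: eig_def)
      then have "mulv n T d = (\<lambda>i. a * d i)"
        unfolding d_def mulv_diff_scale by (simp add: right_diff_distrib mult.left_commute)
      moreover have "d \<in> nvecs n" using z(1) ez by (simp add: eig_def d_def nvecs_def)
      ultimately show ?thesis by (simp add: eig_def)
    qed
    moreover have "ip n cb d = 0" unfolding d_def ip_diff_scale using ez by simp
    ultimately have "d = 0" by (rule inj)
    then have "z i - ip n cb z * zz a i = 0" for i unfolding d_def by (metis zero_fun_apply)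
    then have "z = (\<lambda>i. ip n cb z * zz a i)" by (intro ext) simp
    then show ?thesis using ez by simp
  qed
  define Q where "Q a = (\<Sum>i<n. monom (if i \<in> X then zz a i else 0) i)" for a
  have cQ: "coeff (Q a) i = (if i < n \<and> i \<in> X then zz a i else 0)" for a i
    by (simp add: Q_def coeff_sum)
  have pQ: "poly (Q a) (of_nat t) = ip n (\<lambda>i. complex_of_real (if i \<in> X then of_nat t ^ i else 0)) (zz a)"
    for a t
    by (auto simp: Q_def ip_def poly_sum poly_monom intro!: sum.cong)
  define \<Lambda> where "\<Lambda> = {a. \<exists>z. eig a z \<and> z \<noteq> 0}"
  \<comment> \<open>If all coefficients vanished, the eigenvector would be orthogonal to every unit
    vector of \<open>X\<close>, although \<open>X\<close> is full.\<close>
  have Q0: "Q a \<noteq> 0" if "a \<in> \<Lambda>" for a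
  proof
    assume "Q a = 0"
    then have zero: "zz a i = 0" if "i \<in> X" for i using cQ[of a i] that X by auto
    obtain z where "eig a z" "z \<noteq> 0" using \<open>a \<in> \<Lambda>\<close> by (auto simp: \<Lambda>_def)
    then have ez: "eig a (zz a)" "ip n cb (zz a) = 1" using zz by auto
    have "zz a = 0"
    proof (rule full_complex[OF fX])
      show "zz a \<in> nvecs n" using ez by (simp add: eig_def)
      fix k and b :: "nat \<Rightarrow> real" assume "b \<in> uvec ` X"
      then obtain j where j: "j \<in> X" "b = uvec j" by blast
      have "ip n (\<lambda>i. of_real (b i)) (\<lambda>i. a ^ k * zz a i) = 0"
        using zero[OF j(1)] by (auto simp: ip_def j(2) uvec_def intro!: sum.neutral)
      then show "ip n (\<lambda>i. of_real (b i)) (kry n (\<lambda>i j. complex_of_real (A j i)) k (zz a)) = 0"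
        using kry_eigenvector[of n T "zz a" a k] ez by (simp add: eig_def T_def[symmetric])
    qed
    then show False using ez(2) by (simp add: ip_def)
  qed
  have deg\<chi>: "degree \<chi> = n" "coeff \<chi> n = 1"
    unfolding \<chi>_def using degree_monic_char_poly[of "mat n n (\<lambda>(i,j). T i j)" n] by simp_all
  then have \<chi>0: "\<chi> \<noteq> 0" by auto
  have "\<Lambda> \<subseteq> {a. poly \<chi> a = 0}"
  proof
    fix a assume "a \<in> \<Lambda>"
    then obtain z where z: "eig a z" "z \<noteq> 0" by (auto simp: \<Lambda>_def)
    then obtain i where i: "z i \<noteq> 0" by (metis ext zero_fun_apply)
    have "(\<Sum>j\<le>n. coeff \<chi> j * kry n T j z i) = 0"
      unfolding \<chi>_def using z(1) by (intro cayley_hamilton) (simp add: eig_def)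
    then have "poly \<chi> a * z i = 0"
      using kry_eigenvector[of n T z a] z(1)
      by (simp add: eig_def poly_altdef deg\<chi> sum_distrib_right mult.assoc)
    then show "a \<in> {a. poly \<chi> a = 0}" using i by simp
  qed
  moreover have "finite {a. poly \<chi> a = 0}" "card {a. poly \<chi> a = 0} \<le> n"
    using poly_roots_finite[OF \<chi>0] poly_roots_degree[OF \<chi>0] deg\<chi> by auto
  ultimately have \<Lambda>: "finite \<Lambda>" "card \<Lambda> \<le> n"
    using finite_subset card_mono by (blast, metis order_trans card_mono)
  \<comment> \<open>A failing \<open>t\<close> leaves an annihilator \<open>w\<close>, its Krylov
    space contains an eigenvector \<open>z\<close>, and \<open>z\<close> is a nonzero multiple of
    \<open>zz a\<close>; so \<open>t\<close> is a root of \<open>Q a\<close>.\<close>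
  have "of_nat t \<in> (\<Union>a\<in>\<Lambda>. {x. poly (Q a) x = 0})" if t: "t < n * n" for t
  proof -
    define b where "b = (\<lambda>i. if i \<in> X then of_nat t ^ i else 0 :: real)"
    have "\<not> full n A {b}" using bad[OF t] by (simp add: b_def)
    then obtain w where w: "w \<in> nvecs n" "\<And>k. k < n \<Longrightarrow> ip n (kry n A k b) w = 0" "w \<noteq> 0"
      by (auto simp: full_def)
    define cw where "cw = (\<lambda>i. complex_of_real (w i))"
    have cw: "cw \<in> nvecs n" "cw \<noteq> 0"
    proof -
      show "cw \<in> nvecs n" using w(1) by (simp add: cw_def nvecs_def)
      obtain i where "w i \<noteq> 0" using w(3) by (metis ext zero_fun_apply)
      then have "cw i \<noteq> 0" by (simp add: cw_def)
      then show "cw \<noteq> 0" by (metis zero_fun_apply)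
    qed
    have "ip n (\<lambda>i. complex_of_real (b i)) (kry n T k cw) = 0" if "k < n" for k
    proof -
      have "ip n (\<lambda>i. complex_of_real (b i)) (kry n T k cw)
          = ip n (\<lambda>i. complex_of_real (kry n A k b i)) cw"
        by (simp add: T_def of_real_kry ip_kry)
      also have "\<dots> = complex_of_real (ip n (kry n A k b) w)" by (simp add: ip_def cw_def)
      finally show ?thesis using w(2)[OF that] by simp
    qed
    then have ann: "ip n (\<lambda>i. complex_of_real (b i)) (kry n T k cw) = 0" for k
      by (rule krylov_annihilator_extend[OF cw(1)])
    obtain a p where ap: "act n T p cw \<noteq> 0" "mulv n T (act n T p cw) = (\<lambda>i. a * act n T p cw i)"
      by (rule exists_eigenvector_in_krylov[OF cw, of T])
    define z where "z = act n T p cw"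
    have z: "eig a z" "z \<noteq> 0" using ap act_nvecs[OF cw(1)] by (auto simp: eig_def z_def)
    have "ip n (\<lambda>i. complex_of_real (b i)) z = 0"
      unfolding z_def act_def using ann
      by (subst ip_commute) (simp add: ip_sum ip_scale ip_commute[of n _ "\<lambda>i. complex_of_real (b i)"])
    moreover have "ip n (\<lambda>i. complex_of_real (b i)) z
        = ip n cb z * ip n (\<lambda>i. complex_of_real (b i)) (zz a)"
    proof -
      have "z = (\<lambda>i. ip n cb z * zz a i)" using zz[OF z] by blast
      then have "ip n (\<lambda>i. complex_of_real (b i)) z
          = ip n (\<lambda>i. complex_of_real (b i)) (\<lambda>i. ip n cb z * zz a i)" by metis
      also have "\<dots> = ip n cb z * ip n (\<lambda>i. complex_of_real (b i)) (zz a)"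
        by (simp add: ip_commute[of n "\<lambda>i. complex_of_real (b i)"] ip_scale)
      finally show ?thesis .
    qed
    moreover have "ip n cb z \<noteq> 0" using inj z by blast
    ultimately have "ip n (\<lambda>i. complex_of_real (b i)) (zz a) = 0" by simp
    then have "poly (Q a) (of_nat t) = 0" by (simp add: pQ b_def)
    moreover have "a \<in> \<Lambda>" using z by (auto simp: \<Lambda>_def)
    ultimately show ?thesis by blast
  qed
  then have sub: "(of_nat :: nat \<Rightarrow> complex) ` {..<n * n} \<subseteq> (\<Union>a\<in>\<Lambda>. {x. poly (Q a) x = 0})" by blast
  have finU: "finite (\<Union>a\<in>\<Lambda>. {x. poly (Q a) x = 0})" using \<Lambda>(1) Q0 poly_roots_finite by auto
  have rootsQ: "card {x. poly (Q a) x = 0} \<le> n - 1" if "a \<in> \<Lambda>" for a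
  proof -
    have "degree (Q a) \<le> n - 1" by (rule degree_le) (use cQ n in auto)
    then show ?thesis using poly_roots_degree[OF Q0[OF that]] by linarith
  qed
  \<comment> \<open>All \<open>n * n\<close> values would be roots of at most \<open>n\<close>
    polynomials with at most \<open>n - 1\<close> roots each.\<close>
  have "n * n = card ((of_nat :: nat \<Rightarrow> complex) ` {..<n * n})"
    by (subst card_image) (auto simp: inj_on_def)
  also have "\<dots> \<le> card (\<Union>a\<in>\<Lambda>. {x. poly (Q a) x = 0})" by (rule card_mono[OF finU sub])
  also have "\<dots> \<le> (\<Sum>a\<in>\<Lambda>. card {x. poly (Q a) x = 0})" by (rule card_UN_le[OF \<Lambda>(1)])
  also have "\<dots> \<le> card \<Lambda> * (n - 1)" using sum_bounded_above[of \<Lambda> "\<lambda>a. card {x. poly (Q a) x = 0}" "n - 1"] rootsQ by simp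
  also have "\<dots> \<le> n * (n - 1)" using \<Lambda>(2) by (rule mult_le_mono1)
  also have "\<dots> < n * n" using n by simp
  finally show False by simp
qed

section \<open>Bounded states and time budgets\<close>

definition sbound :: "nat \<Rightarrow> state \<Rightarrow> bool" where
  "sbound L s \<longleftrightarrow> (\<forall>x k. \<bar>s x k\<bar> \<le> 2 ^ L)"

text \<open>A multiplier of \<open>L\<close>: over cells bounded by \<open>2^L\<close>, an
  expression of width \<open>c\<close> is bounded by \<open>2^(c L)\<close>. A sum may use the width
  of a product because both summands have a bound of at least 2, and a quotient is no larger than
  its dividend.\<close>

fun width :: "aexp \<Rightarrow> nat" where
  "width (Num k) = int_bits k"
| "width (Read x e) = 1"
| "width (Add a b) = width a + width b"
| "width (Sub a b) = width a + width b"
| "width (Mul a b) = width a + width b"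
| "width (Quo a b) = width a"

lemma width_pos: "1 \<le> width e"
  by (induction e) (auto simp: int_bits_def)

text \<open>For \<open>X\<close> and \<open>Y\<close> at least 2,
  \<open>(X - 2) (Y - 2) >= 0\<close> gives \<open>2 (X + Y) <= X Y + 4\<close>, and
  \<open>4 <= X Y\<close>.\<close>

lemma sum_le_power_add: "2 ^ x + 2 ^ y \<le> (2::int) ^ (x + y)" if "1 \<le> x" "1 \<le> y"
proof -
  have "(2::int) ^ 1 \<le> 2 ^ x" "(2::int) ^ 1 \<le> 2 ^ y" using that by (intro power_increasing; simp)+
  then have "0 \<le> ((2::int) ^ x - 2) * (2 ^ y - 2)" by simp
  then have "2 * ((2::int) ^ x + 2 ^ y) \<le> 2 ^ x * 2 ^ y + 4" by (simp add: algebra_simps)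
  moreover have "2 * (2::int) \<le> 2 ^ x * 2 ^ y" using \<open>(2::int) ^ 1 \<le> 2 ^ x\<close> \<open>(2::int) ^ 1 \<le> 2 ^ y\<close>
    by (intro mult_mono) auto
  ultimately show ?thesis by (simp add: power_add)
qed

text \<open>Rounding towards minus infinity can enlarge a negative quotient in absolute value, but
  not beyond the dividend; division by 0 gives 0.\<close>

lemma abs_div_le: "\<bar>a div b\<bar> \<le> \<bar>a :: int\<bar>"
proof -
  consider "b = 0" | "b > 0" | "b < 0" by linarith
  then show ?thesis
  proof cases
    case 2
    show ?thesis
    proof (cases "a \<ge> 0")
      case True
      then have "a div b \<le> a" "0 \<le> a div b" using 2 by (auto simp: pos_imp_zdiv_nonneg_iff div_le_dividend int_div_less_self zdiv_mono2[of a 1 b, simplified])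
      then show ?thesis by simp
    next
      case False
      then have "a * 1 \<le> (a div b)" using zdiv_mono2_neg[of a 1 b] 2 by simp
      moreover have "a div b < 0" using False 2 by (simp add: div_neg_pos_less0)
      ultimately show ?thesis by simp
    qed
  next
    case 3
    have e: "a div b = (- a) div (- b)" by simp
    show ?thesis
    proof (cases "- a \<ge> 0")
      case True
      then have "(- a) div (- b) \<le> - a" "0 \<le> (- a) div (- b)"
        using 3 zdiv_mono2[of "- a" 1 "- b"] pos_imp_zdiv_nonneg_iff[of "- b" "- a"] by auto
      then show ?thesis using e by linarith
    next
      case False
      then have "- a \<le> ((- a) div (- b))" using zdiv_mono2_neg[of "- a" 1 "- b"] 3 by simp
      moreover have "(- a) div (- b) < 0" using False 3 by (intro div_neg_pos_less0) auto
      ultimately show ?thesis using e False by linarith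
    qed
  qed simp
qed

lemma int_bits_le:
  assumes "\<bar>v\<bar> \<le> 2 ^ m"
  shows "int_bits v \<le> m + 2"
proof -
  have "nat \<bar>v\<bar> \<le> 2 ^ m" using assms by (simp add: nat_le_iff)
  then have "nat \<bar>v\<bar> < 2 ^ (m + 1)" by (rule le_less_trans) simp
  then have "floorlog 2 (nat \<bar>v\<bar>) \<le> m + 1" by (intro floorlog_leI) auto
  then show ?thesis by (simp add: int_bits_def)
qed

lemma abs_le_int_bits: "\<bar>v\<bar> \<le> 2 ^ int_bits v"
proof (cases "v = 0")
  case False
  then have "nat \<bar>v\<bar> < 2 ^ floorlog 2 (nat \<bar>v\<bar>)" using floorlog_bounds[of "nat \<bar>v\<bar>" 2] by simp
  also have "\<dots> \<le> 2 ^ int_bits v" by (rule power_increasing) (auto simp: int_bits_def)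
  finally show ?thesis by (simp add: nat_less_iff)
qed simp

lemma aval_bound:
  assumes "sbound L s" "1 \<le> L"
  shows "\<bar>aval e s\<bar> \<le> 2 ^ (width e * L)"
proof (induction e)
  case (Num k)
  have "\<bar>k\<bar> \<le> 2 ^ int_bits k" by (rule abs_le_int_bits)
  also have "\<dots> \<le> 2 ^ (int_bits k * L)" using assms(2) by (intro power_increasing) auto
  finally show ?case by simp
next
  case (Read x e)
  then show ?case using assms(1) by (simp add: sbound_def)
next
  case (Add a b)
  have "\<bar>aval (Add a b) s\<bar> \<le> 2 ^ (width a * L) + 2 ^ (width b * L)" using Add by simp
  also have "\<dots> \<le> 2 ^ (width a * L + width b * L)"
    using width_pos[of a] width_pos[of b] assms(2) by (intro sum_le_power_add) (auto simp: Suc_le_eq)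
  finally show ?case by (simp add: add_mult_distrib)
next
  case (Sub a b)
  have "\<bar>aval (Sub a b) s\<bar> \<le> 2 ^ (width a * L) + 2 ^ (width b * L)" using Sub by simp
  also have "\<dots> \<le> 2 ^ (width a * L + width b * L)"
    using width_pos[of a] width_pos[of b] assms(2) by (intro sum_le_power_add) (auto simp: Suc_le_eq)
  finally show ?case by (simp add: add_mult_distrib)
next
  case (Mul a b)
  have "\<bar>aval a s\<bar> * \<bar>aval b s\<bar> \<le> 2 ^ (width a * L) * 2 ^ (width b * L)"
    using Mul by (intro mult_mono) auto
  then show ?case by (simp add: abs_mult add_mult_distrib power_add)
next
  case (Quo a b)
  then show ?case using abs_div_le[of "aval a s" "aval b s"] by simp
qed

text \<open>The additive constants pay for the two extra bits of \<open>int_bits_le\<close>; for a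
  cell, \<open>L + 2 <= 3 (L + 1)\<close>.\<close>

fun acost_coeff :: "aexp \<Rightarrow> nat" where
  "acost_coeff (Num k) = int_bits k"
| "acost_coeff (Read x e) = acost_coeff e + 3"
| "acost_coeff (Add a b) = acost_coeff a + acost_coeff b + width (Add a b) + 2"
| "acost_coeff (Sub a b) = acost_coeff a + acost_coeff b + width (Sub a b) + 2"
| "acost_coeff (Mul a b) = acost_coeff a + acost_coeff b + width (Mul a b) + 2"
| "acost_coeff (Quo a b) = acost_coeff a + acost_coeff b + width (Quo a b) + 2"

lemma acost_le:
  assumes "sbound L s" "1 \<le> L"
  shows "acost e s \<le> acost_coeff e * (L + 1)"
proof (induction e)
  case (Read x e)
  have "int_bits (aval (Read x e) s) \<le> L + 2"
    using aval_bound[OF assms, of "Read x e"] by (intro int_bits_le) simp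
  then show ?case using Read by (simp add: algebra_simps)
next
  case (Add a b)
  have "int_bits (aval (Add a b) s) \<le> width (Add a b) * L + 2"
    by (intro int_bits_le aval_bound assms)
  then show ?case using Add by (simp add: algebra_simps)
next
  case (Sub a b)
  have "int_bits (aval (Sub a b) s) \<le> width (Sub a b) * L + 2"
    by (intro int_bits_le aval_bound assms)
  then show ?case using Sub by (simp add: algebra_simps)
next
  case (Mul a b)
  have "int_bits (aval (Mul a b) s) \<le> width (Mul a b) * L + 2"
    by (intro int_bits_le aval_bound assms)
  then show ?case using Mul by (simp add: algebra_simps)
next
  case (Quo a b)
  have "int_bits (aval (Quo a b) s) \<le> width (Quo a b) * L + 2"
    by (intro int_bits_le aval_bound assms)
  then show ?case using Quo by (simp add: algebra_simps)
qed simp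

fun bcost_coeff :: "bexp \<Rightarrow> nat" where
  "bcost_coeff (Less a b) = acost_coeff a + acost_coeff b + 1"
| "bcost_coeff (Neg b) = bcost_coeff b + 1"
| "bcost_coeff (Conj b c) = bcost_coeff b + bcost_coeff c + 1"

lemma bcost_le:
  assumes "sbound L s" "1 \<le> L"
  shows "bcost b s \<le> bcost_coeff b * (L + 1)"
proof (induction b)
  case (Less a b)
  then show ?case using acost_le[OF assms, of a] acost_le[OF assms, of b] by (simp add: algebra_simps)
qed (simp_all add: algebra_simps)

text \<open>A syntactic time budget in units of \<open>L + 1\<close>, valid for programs none of whose loops is
  iterated more than \<open>N\<close> times.\<close>

fun budget :: "nat \<Rightarrow> com \<Rightarrow> nat" where
  "budget N Skip = 1"
| "budget N (Store x i e) = acost_coeff i + acost_coeff e + 1"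
| "budget N (Seq c d) = budget N c + budget N d"
| "budget N (Cond b c d) = bcost_coeff b + budget N c + budget N d + 1"
| "budget N (While b c) = (N + 1) * (bcost_coeff b + budget N c + 1)"

lemma budget_poly: "\<exists>p :: nat poly. \<forall>n. budget (n * n) c \<le> poly p n"
proof (induction c)
  case Skip
  show ?case by (rule exI[of _ "[:1:]"]) simp
next
  case (Store x i e)
  show ?case by (rule exI[of _ "[:acost_coeff i + acost_coeff e + 1:]"]) simp
next
  case (Seq c d)
  then obtain p q where "\<forall>n. budget (n * n) c \<le> poly p n" "\<forall>n. budget (n * n) d \<le> poly q n" by blast
  then show ?case by (intro exI[of _ "p + q"]) (simp add: add_mono)
next
  case (Cond b c d)
  then obtain p q where "\<forall>n. budget (n * n) c \<le> poly p n" "\<forall>n. budget (n * n) d \<le> poly q n" by blast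
  then show ?case by (intro exI[of _ "[:bcost_coeff b + 1:] + p + q"]) (simp add: add_mono)
next
  case (While b c)
  then obtain p where "\<forall>n. budget (n * n) c \<le> poly p n" by blast
  then show ?case
    by (intro exI[of _ "([:0, 1:] * [:0, 1:] + 1) * ([:bcost_coeff b + 1:] + p)"]) (simp add: add_mono)
qed

text \<open>From \<open>s\<close> the program halts within its budget in a state satisfying \<open>Q\<close>. Every cell keeps at most
  \<open>L\<close> bits, which is what makes a count of elementary steps bound the logarithmic cost.\<close>

definition ok :: "nat \<Rightarrow> nat \<Rightarrow> com \<Rightarrow> state \<Rightarrow> (state \<Rightarrow> bool) \<Rightarrow> bool" where
  "ok n L c s Q \<longleftrightarrow> (\<exists>t s'. run c s t s' \<and> t \<le> budget (n * n) c * (L + 1) \<and> sbound L s' \<and> Q s')"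

section \<open>Rules of a program logic with time and size bounds\<close>

lemma ok_conseq: "ok n L c s Q \<Longrightarrow> (\<And>s'. sbound L s' \<Longrightarrow> Q s' \<Longrightarrow> Q' s') \<Longrightarrow> ok n L c s Q'"
  unfolding ok_def by blast

lemma ok_Seq:
  assumes "ok n L c s Q1" "\<And>s1. sbound L s1 \<Longrightarrow> Q1 s1 \<Longrightarrow> ok n L d s1 Q"
  shows "ok n L (Seq c d) s Q"
proof -
  obtain t1 s1 where 1: "run c s t1 s1" "t1 \<le> budget (n * n) c * (L + 1)" "sbound L s1" "Q1 s1"
    using assms(1) unfolding ok_def by blast
  obtain t2 s2 where 2: "run d s1 t2 s2" "t2 \<le> budget (n * n) d * (L + 1)" "sbound L s2" "Q s2"
    using assms(2)[OF 1(3,4)] unfolding ok_def by blast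
  have "t1 + t2 \<le> budget (n * n) (Seq c d) * (L + 1)" using 1(2) 2(2) by (simp only: budget.simps add_mult_distrib)
  then show ?thesis using run.Seq[OF 1(1) 2(1)] 2 unfolding ok_def by blast
qed

definition assign :: "vname \<Rightarrow> aexp \<Rightarrow> com" where
  "assign x e = Store x (Num 0) e"

abbreviation V :: "vname \<Rightarrow> aexp" where
  "V x \<equiv> Read x (Num 0)"

definition For :: "vname \<Rightarrow> aexp \<Rightarrow> com \<Rightarrow> com" where
  "For v b c = Seq (assign v (Num 0)) (While (Less (V v) b) (Seq c (assign v (Add (V v) (Num 1)))))"

text \<open>\<open>L\<close> bounds the size of all cells and \<open>n * n\<close> the number of
  iterations of every loop; the last assumption makes the loop counters themselves fit.\<close>

locale bounded =
  fixes n L :: nat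
  assumes n1: "1 \<le> n" and L1: "1 \<le> L" and nn: "int (n * n) \<le> 2 ^ L"
begin

lemma ok_Skip: "sbound L s \<Longrightarrow> Q s \<Longrightarrow> ok n L Skip s Q"
  unfolding ok_def using run.Skip by (intro exI conjI) (auto intro: run.Skip)

lemma ok_Store:
  assumes "sbound L s" "\<bar>aval e s\<bar> \<le> 2 ^ L" "Q (s(x := (s x)(aval i s := aval e s)))"
  shows "ok n L (Store x i e) s Q"
proof -
  have "acost i s + acost e s + 1 \<le> budget (n * n) (Store x i e) * (L + 1)"
    using acost_le[OF assms(1) L1, of i] acost_le[OF assms(1) L1, of e] by (simp add: algebra_simps)
  moreover have "sbound L (s(x := (s x)(aval i s := aval e s)))" using assms(1,2) by (simp add: sbound_def)
  ultimately show ?thesis using assms(3) unfolding ok_def by (blast intro: run.Store)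
qed

lemma ok_assign:
  assumes "sbound L s" "\<bar>aval e s\<bar> \<le> 2 ^ L" "Q (s(x := (s x)(0 := aval e s)))"
  shows "ok n L (assign x e) s Q"
  unfolding assign_def using assms by (intro ok_Store) auto

lemma ok_Cond:
  assumes "sbound L s" "bval b s \<Longrightarrow> ok n L c s Q" "\<not> bval b s \<Longrightarrow> ok n L d s Q"
  shows "ok n L (Cond b c d) s Q"
proof (cases "bval b s")
  case True
  then obtain t s' where "run c s t s'" "t \<le> budget (n * n) c * (L + 1)" "sbound L s'" "Q s'"
    using assms(2) unfolding ok_def by blast
  moreover from this(2) have "bcost b s + t + 1 \<le> budget (n * n) (Cond b c d) * (L + 1)"
    using bcost_le[OF assms(1) L1, of b] by (simp add: algebra_simps)
  ultimately show ?thesis using run.CondT[OF True] unfolding ok_def by blast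
next
  case False
  then obtain t s' where "run d s t s'" "t \<le> budget (n * n) d * (L + 1)" "sbound L s'" "Q s'"
    using assms(3) unfolding ok_def by blast
  moreover from this(2) have "bcost b s + t + 1 \<le> budget (n * n) (Cond b c d) * (L + 1)"
    using bcost_le[OF assms(1) L1, of b] by (simp add: algebra_simps)
  ultimately show ?thesis using run.CondF[OF False] unfolding ok_def by blast
qed

lemma ok_While:
  assumes m: "m \<le> n * n" and s: "sbound L s" "I 0 s"
    and guard: "\<And>k s. k \<le> m \<Longrightarrow> sbound L s \<Longrightarrow> I k s \<Longrightarrow> bval b s \<longleftrightarrow> k < m"
    and body: "\<And>k s. k < m \<Longrightarrow> sbound L s \<Longrightarrow> I k s \<Longrightarrow> ok n L c s (I (Suc k))"
  shows "ok n L (While b c) s (I m)"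
proof -
  \<comment> \<open>Induction on the number \<open>d\<close> of remaining iterations;
    \<open>d + 1\<close> counts the guard evaluations still to come.\<close>
  have "\<exists>t s'. run (While b c) s t s' \<and> t \<le> (d + 1) * (bcost_coeff b + budget (n * n) c + 1) * (L + 1) \<and>
      sbound L s' \<and> I m s'" if "d \<le> m" "sbound L s" "I (m - d) s" for d s
    using that
  proof (induction d arbitrary: s)
    case 0
    then have nb: "\<not> bval b s" using guard[of m s] by simp
    have "bcost b s + 1 \<le> (0 + 1) * (bcost_coeff b + budget (n * n) c + 1) * (L + 1)"
      using bcost_le[OF 0(2) L1, of b] by (simp add: algebra_simps)
    then show ?case using run.WhileF[OF nb] 0 by (intro exI conjI) auto
  next
    case (Suc d)
    then have bb: "bval b s" using guard[of "m - Suc d" s] by simp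
    obtain t1 s1 where 1: "run c s t1 s1" "t1 \<le> budget (n * n) c * (L + 1)" "sbound L s1" "I (m - d) s1"
      using body[of "m - Suc d" s] Suc.prems unfolding ok_def by (auto simp: Suc_diff_Suc)
    obtain t2 s2 where 2: "run (While b c) s1 t2 s2"
      "t2 \<le> (d + 1) * (bcost_coeff b + budget (n * n) c + 1) * (L + 1)" "sbound L s2" "I m s2"
      using Suc.IH[OF _ 1(3,4)] Suc.prems by auto
    have "bcost b s + t1 + t2 + 1 \<le> (Suc d + 1) * (bcost_coeff b + budget (n * n) c + 1) * (L + 1)"
      using bcost_le[OF Suc.prems(2) L1, of b] 1(2) 2(2) by (simp add: algebra_simps)
    then show ?case using run.WhileT[OF bb 1(1) 2(1)] 2(3,4) by blast
  qed
  from this[of m s] s obtain t s' where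
    t: "run (While b c) s t s'" "t \<le> (m + 1) * (bcost_coeff b + budget (n * n) c + 1) * (L + 1)" "sbound L s'" "I m s'"
    by auto
  have "(m + 1) * (bcost_coeff b + budget (n * n) c + 1) \<le> (n * n + 1) * (bcost_coeff b + budget (n * n) c + 1)"
    using m by (intro mult_le_mono1) simp
  then have "(m + 1) * (bcost_coeff b + budget (n * n) c + 1) * (L + 1) \<le> budget (n * n) (While b c) * (L + 1)"
    by (simp only: budget.simps) (rule mult_le_mono1)
  then show ?thesis using t unfolding ok_def by (meson le_trans)
qed

text \<open>The invariant may not depend on the counter \<open>v\<close>, so it survives the
  increment; the counter's value is carried beside it. Since the bound is evaluated afresh at every
  test, \<open>guard\<close> makes the invariant determine its value.\<close>

lemma ok_For:
  assumes m: "m \<le> n * n" and s: "sbound L s" "I 0 s"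
    and insens: "\<And>k s z. I k (s(v := z)) \<longleftrightarrow> I k s"
    and guard: "\<And>k s. k \<le> m \<Longrightarrow> I k s \<Longrightarrow> s v 0 = int k \<Longrightarrow> aval b s = int m"
    and body: "\<And>k s. k < m \<Longrightarrow> sbound L s \<Longrightarrow> I k s \<Longrightarrow> s v 0 = int k \<Longrightarrow>
      ok n L c s (\<lambda>s'. s' v 0 = int k \<and> I (Suc k) s')"
  shows "ok n L (For v b c) s (\<lambda>s'. I m s' \<and> s' v 0 = int m)"
  unfolding For_def
proof (rule ok_Seq)
  show "ok n L (assign v (Num 0)) s (\<lambda>s'. I 0 s' \<and> s' v 0 = 0)"
    using s by (intro ok_assign) (auto simp: insens)
  fix s1 assume s1: "sbound L s1" "I 0 s1 \<and> s1 v 0 = 0"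
  show "ok n L (While (Less (V v) b) (Seq c (assign v (Add (V v) (Num 1))))) s1 (\<lambda>s'. I m s' \<and> s' v 0 = int m)"
  proof (rule ok_While[where I = "\<lambda>k s. I k s \<and> s v 0 = int k", OF m s1(1)])
    show "I 0 s1 \<and> s1 v 0 = int 0" using s1 by simp
    show "bval (Less (V v) b) s = (k < m)" if "k \<le> m" "sbound L s" "I k s \<and> s v 0 = int k" for k s
      using guard[of k s] that by simp
    show "ok n L (Seq c (assign v (Add (V v) (Num 1)))) s (\<lambda>s. I (Suc k) s \<and> s v 0 = int (Suc k))"
      if k: "k < m" "sbound L s" "I k s \<and> s v 0 = int k" for k s
    proof (rule ok_Seq)
      show "ok n L c s (\<lambda>s'. s' v 0 = int k \<and> I (Suc k) s')" using body k by blast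
      fix s2 assume s2: "sbound L s2" "s2 v 0 = int k \<and> I (Suc k) s2"
      have "int k + 1 \<le> int (n * n)" using k(1) m by linarith
      then have "int k + 1 \<le> 2 ^ L" using nn by linarith
      then show "ok n L (assign v (Add (V v) (Num 1))) s2 (\<lambda>s. I (Suc k) s \<and> s v 0 = int (Suc k))"
        using s2 by (intro ok_assign) (auto simp: insens)
    qed
  qed
qed

end

section \<open>Matrix programs\<close>

definition frame :: "vname set \<Rightarrow> state \<Rightarrow> state \<Rightarrow> bool" where
  "frame X s s' \<longleftrightarrow> (\<forall>y. y \<notin> X \<longrightarrow> s' y = s y)"

lemma frameD: "frame X s s' \<Longrightarrow> y \<notin> X \<Longrightarrow> s' y = s y"
  by (simp add: frame_def)

lemma frame_refl: "frame X s s"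
  by (simp add: frame_def)

lemma frame_trans: "frame X s s1 \<Longrightarrow> frame Y s1 s2 \<Longrightarrow> X \<subseteq> Z \<Longrightarrow> Y \<subseteq> Z \<Longrightarrow> frame Z s s2"
  by (auto simp: frame_def subset_iff) metis

lemma frame_upd: "x \<in> X \<Longrightarrow> frame X s (s'(x := z)) \<longleftrightarrow> frame X s s'"
  by (auto simp: frame_def)

definition arr :: "nat \<Rightarrow> state \<Rightarrow> vname \<Rightarrow> (nat \<Rightarrow> nat \<Rightarrow> int) \<Rightarrow> bool" where
  "arr n s x F \<longleftrightarrow> (\<forall>i<n. \<forall>j<n. s x (int (i * n + j)) = F i j)"

lemma arrD: "arr n s x F \<Longrightarrow> i < n \<Longrightarrow> j < n \<Longrightarrow> s x (int (i * n + j)) = F i j"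
  by (simp add: arr_def)

lemma arr_upd: "y \<noteq> x \<Longrightarrow> arr n (s(y := z)) x F \<longleftrightarrow> arr n s x F"
  by (simp add: arr_def)

lemma arr_frame: "arr n s x F \<Longrightarrow> frame X s s' \<Longrightarrow> x \<notin> X \<Longrightarrow> arr n s' x F"
  by (simp add: arr_def frame_def)

text \<open>\<open>fill x c e\<close> sets the entry \<open>(i, j)\<close> of the matrix \<open>x\<close> to the value of \<open>e\<close> after running \<open>c\<close>,
  where \<open>p = i n + j\<close>.\<close>

definition fill :: "vname \<Rightarrow> com \<Rightarrow> aexp \<Rightarrow> com" where
  "fill x c e = For ''p'' (Mul (V ''n'') (V ''n''))
     (Seq (assign ''i'' (Quo (V ''p'') (V ''n'')))
     (Seq (assign ''j'' (Sub (V ''p'') (Mul (V ''i'') (V ''n''))))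
     (Seq c (Store x (V ''p'') e))))"

abbreviation scratch :: "vname set" where
  "scratch \<equiv> {''p'', ''i'', ''j'', ''a'', ''l''}"

definition mul :: "vname \<Rightarrow> vname \<Rightarrow> vname \<Rightarrow> com" where
  "mul z x y = fill z (Seq (assign ''a'' (Num 0)) (For ''l'' (V ''n'')
     (assign ''a'' (Add (V ''a'')
        (Mul (Read x (Add (Mul (V ''i'') (V ''n'')) (V ''l''))) (Read y (Add (Mul (V ''l'') (V ''n'')) (V ''j''))))))))
     (V ''a'')"

text \<open>Expressions have no case distinction, so Kronecker's delta is obtained from integer
  division, the divisor being at least 2 off the diagonal.\<close>

definition delta :: aexp where
  "delta = Quo (Num 1) (Add (Num 1) (Mul (Sub (V ''i'') (V ''j'')) (Sub (V ''i'') (V ''j''))))"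

lemma aval_delta:
  assumes "s ''i'' 0 = int i" "s ''j'' 0 = int j"
  shows "aval delta s = (if i = j then 1 else 0)"
proof -
  have "(1::int) div (1 + d * d) = 0" if "d \<noteq> 0" for d :: int
  proof -
    have "0 < d * d" using that not_real_square_gt_zero by (metis mult_pos_pos mult_neg_neg linorder_neqE_linordered_idom)
    then show ?thesis by (intro div_pos_pos_trivial) auto
  qed
  then show ?thesis using assms by (auto simp: delta_def)
qed

text \<open>\<open>B\<close> holds the transpose of \<open>A\<close>. After \<open>k\<close> rounds \<open>W\<close> is \<open>gramian n A E k\<close>.\<close>

definition gram_prog :: com where
  "gram_prog = Seq (fill ''W'' Skip (Num 0)) (For ''k'' (V ''n'')
     (Seq (mul ''T'' ''A'' ''W'') (Seq (mul ''U'' ''T'' ''B'')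
       (fill ''W'' Skip (Add (Read ''U'' (V ''p'')) (Read ''E'' (V ''p'')))))))"

definition trace_prog :: com where
  "trace_prog = Seq (assign ''a'' (Num 0)) (For ''l'' (V ''n'')
     (assign ''a'' (Add (V ''a'') (Read ''P'' (Add (Mul (V ''l'') (V ''n'')) (V ''l''))))))"

text \<open>\<open>r\<close> is overwritten at each nonzero coefficient and so ends as the last such
  index; \<open>c * c\<close> serves to detect a nonzero \<open>c\<close> because comparison is only
  by \<open>Less\<close>.\<close>

definition fl_prog :: com where
  "fl_prog = Seq (fill ''P'' Skip (Num 0)) (Seq (assign ''c'' (Num 1)) (Seq (assign ''r'' (Num 0))
     (For ''k'' (V ''n'')
       (Seq (fill ''M'' Skip (Add (Read ''P'' (V ''p'')) (Mul delta (V ''c''))))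
       (Seq (mul ''P'' ''W'' ''M'')
       (Seq trace_prog
       (Seq (assign ''c'' (Quo (Sub (Num 0) (V ''a'')) (Add (V ''k'') (Num 1))))
         (Cond (Less (Num 0) (Mul (V ''c'') (V ''c''))) (assign ''r'' (Add (V ''k'') (Num 1))) Skip))))))))"

definition rank_prog :: com where
  "rank_prog = Seq gram_prog fl_prog"

text \<open>At \<open>k = n\<close> this is \<open>n\<close> minus the multiplicity of 0 as a root
  of the characteristic polynomial. The initial value 0 is a legitimate index, as the leading
  coefficient is 1.\<close>

fun flrank :: "nat \<Rightarrow> (nat \<Rightarrow> nat \<Rightarrow> int) \<Rightarrow> nat \<Rightarrow> nat" where
  "flrank n W 0 = 0"
| "flrank n W (Suc k) = (if snd (fl n W (Suc k)) \<noteq> 0 then Suc k else flrank n W k)"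

declare fl.simps(2) [simp del]

lemma flrank_spec:
  "flrank n W k \<le> k \<and> snd (fl n W (flrank n W k)) \<noteq> 0 \<and>
   (\<forall>j. flrank n W k < j \<and> j \<le> k \<longrightarrow> snd (fl n W j) = 0)"
  by (induction k) (auto simp: le_Suc_eq)

lemma abs_sum_mult_le:
  fixes f g :: "nat \<Rightarrow> int"
  assumes "\<And>l. l < m \<Longrightarrow> \<bar>f l\<bar> \<le> a" "\<And>l. l < m \<Longrightarrow> \<bar>g l\<bar> \<le> b" "m \<le> n" "0 \<le> a" "0 \<le> b"
  shows "\<bar>\<Sum>l<m. f l * g l\<bar> \<le> int n * a * b"
proof -
  have "\<bar>\<Sum>l<m. f l * g l\<bar> \<le> (\<Sum>l<m. \<bar>f l * g l\<bar>)" by (rule sum_abs)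
  also have "\<dots> \<le> (\<Sum>l<m. a * b)"
    using assms by (intro sum_mono) (auto simp: abs_mult intro!: mult_mono)
  also have "\<dots> = int m * (a * b)" by simp
  also have "\<dots> \<le> int n * (a * b)" using assms by (intro mult_right_mono) auto
  finally show ?thesis by (simp add: mult.assoc)
qed

section \<open>Correctness of the matrix programs\<close>

context bounded
begin

lemma n_le: "int n \<le> 2 ^ L"
proof -
  have "int n * 1 \<le> int n * int n" using n1 by (intro mult_left_mono) auto
  then have "int n \<le> int (n * n)" by simp
  then show ?thesis using nn by (rule order_trans)
qed

text \<open>The program \<open>c\<close> may change only the two working arrays of a matrix product,
  so that the current position and the cells filled before survive it.\<close>

lemma ok_fill:
  assumes s0: "sbound L s0" "s0 ''n'' 0 = int n" and x: "x \<notin> insert ''n'' scratch"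
    and pre: "\<And>i j s. i < n \<Longrightarrow> j < n \<Longrightarrow> sbound L s \<Longrightarrow> frame (insert x scratch) s0 s \<Longrightarrow>
      s ''i'' 0 = int i \<Longrightarrow> s ''j'' 0 = int j \<Longrightarrow> s ''p'' 0 = int (i * n + j) \<Longrightarrow>
      ok n L c s (\<lambda>s'. frame {''a'', ''l''} s s' \<and> aval e s' = F i j)"
    and bound: "\<And>i j. i < n \<Longrightarrow> j < n \<Longrightarrow> \<bar>F i j\<bar> \<le> 2 ^ L"
  shows "ok n L (fill x c e) s0 (\<lambda>s'. arr n s' x F \<and> frame (insert x scratch) s0 s')"
proof -
  define I where "I P s \<longleftrightarrow> (\<forall>q<P. s x (int q) = F (q div n) (q mod n)) \<and> frame (insert x scratch) s0 s"
    for P s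
  have npos: "0 < n" using n1 by simp
  have In: "s ''n'' 0 = int n" if "I k s" for k s
    using that x s0(2) frameD[of "insert x scratch" s0 s "''n''"] by (auto simp: I_def)
  have "ok n L (fill x c e) s0 (\<lambda>s'. I (n * n) s' \<and> s' ''p'' 0 = int (n * n))"
    unfolding fill_def
  proof (rule ok_For)
    show "I 0 s0" by (simp add: I_def frame_refl)
    show "I k (s(''p'' := z)) \<longleftrightarrow> I k s" for k s z
      using x by (auto simp: I_def frame_upd)
    show "aval (Mul (V ''n'') (V ''n'')) s = int (n * n)" if "I k s" for k s
      using In[OF that] by simp
    fix k s assume k: "k < n * n" and s: "sbound L s" "I k s" "s ''p'' 0 = int k"
    define i where "i = k div n"
    define j where "j = k mod n"
    have ij: "i < n" "j < n" "i * n + j = k"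
      using k npos by (auto simp: i_def j_def less_mult_imp_div_less)
    have "int k \<le> int (n * n)" using k by (simp only: of_nat_le_iff)
    then have kL: "int k \<le> 2 ^ L" using nn by linarith
    have "int i \<le> int k" "int j \<le> int k" by (auto simp: i_def j_def)
    then have ijL: "int i \<le> 2 ^ L" "int j \<le> 2 ^ L" using kL by linarith+
    have kij: "int k = int i * int n + int j" unfolding ij(3)[symmetric] by simp
    let ?Q = "\<lambda>s'. s' ''p'' 0 = int k \<and> I (Suc k) s'"
    let ?J = "\<lambda>s'. frame scratch s s' \<and> s' ''p'' 0 = int k \<and> s' ''i'' 0 = int i"
    let ?j = "assign ''j'' (Sub (V ''p'') (Mul (V ''i'') (V ''n'')))"
    show "ok n L (Seq (assign ''i'' (Quo (V ''p'') (V ''n''))) (Seq ?j (Seq c (Store x (V ''p'') e)))) s ?Q"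
    proof (rule ok_Seq[where ?Q1.0 = ?J])
      have "aval (Quo (V ''p'') (V ''n'')) s = int i"
        using s(3) In[OF s(2)] by (simp add: i_def zdiv_int)
      then show "ok n L (assign ''i'' (Quo (V ''p'') (V ''n''))) s ?J"
        using s ijL by (intro ok_assign) (auto simp: frame_upd frame_refl)
      fix s1 assume s1: "sbound L s1" "?J s1"
      have f1: "frame (insert x scratch) s0 s1"
        using frame_trans[of "insert x scratch" s0 s scratch s1 "insert x scratch"] s1 s by (auto simp: I_def)
      have n1: "s1 ''n'' 0 = int n" using frameD[OF f1, of "''n''"] x s0(2) by auto
      have x1: "s1 x = s x" using frameD[of scratch s s1 x] s1 x by auto
      let ?K = "\<lambda>s'. ?J s' \<and> s' ''j'' 0 = int j"
      show "ok n L (Seq ?j (Seq c (Store x (V ''p'') e))) s1 ?Q"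
      proof (rule ok_Seq[where ?Q1.0 = ?K])
        have "aval (Sub (V ''p'') (Mul (V ''i'') (V ''n''))) s1 = int j"
          using s1 n1 kij by simp
        then show "ok n L ?j s1 ?K"
          using s1 ijL by (intro ok_assign) (auto simp: frame_upd)
        fix s2 assume s2: "sbound L s2" "?K s2"
        have f2: "frame (insert x scratch) s0 s2"
          using frame_trans[of "insert x scratch" s0 s scratch s2 "insert x scratch"] s2 s by (auto simp: I_def)
        show "ok n L (Seq c (Store x (V ''p'') e)) s2 ?Q"
        proof (rule ok_Seq)
          show "ok n L c s2 (\<lambda>s'. frame {''a'', ''l''} s2 s' \<and> aval e s' = F i j)"
            using s2 f2 ij by (intro pre) auto
          fix s3 assume s3: "sbound L s3" "frame {''a'', ''l''} s2 s3 \<and> aval e s3 = F i j"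
          have p3: "s3 ''p'' 0 = int k" using s2 s3 frameD[of "{''a'',''l''}" s2 s3 "''p''"] by simp
          have x3: "s3 x = s x" using frameD[of "{''a'',''l''}" s2 s3 x] frameD[of scratch s s2 x] s2 s3 x by auto
          have f3: "frame (insert x scratch) s0 s3"
            using frame_trans[of "insert x scratch" s0 s2 "{''a'',''l''}" s3 "insert x scratch"] f2 s3 by auto
          show "ok n L (Store x (V ''p'') e) s3 ?Q"
          proof (rule ok_Store[OF s3(1)])
            show "\<bar>aval e s3\<bar> \<le> 2 ^ L" using s3 bound[OF ij(1,2)] by simp
            have "\<forall>q<Suc k. ((s3 x)(int k := F i j)) (int q) = F (q div n) (q mod n)"
              using s(2) unfolding x3 by (auto simp: I_def less_Suc_eq i_def j_def)
            then show "?Q (s3(x := (s3 x)(aval (V ''p'') s3 := aval e s3)))"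
              using p3 s3 x f3 by (auto simp: I_def frame_upd)
          qed
        qed
      qed
    qed
  qed (use s0 in auto)
  then show ?thesis
  proof (rule ok_conseq)
    fix s' assume "I (n * n) s' \<and> s' ''p'' 0 = int (n * n)"
    moreover have "i * n + j < n * n \<and> (i * n + j) div n = i \<and> (i * n + j) mod n = j"
      if "i < n" "j < n" for i j
    proof -
      have "i * n + j < Suc i * n" using that by simp
      also have "\<dots> \<le> n * n" using that by (intro mult_le_mono1) simp
      finally show ?thesis using that by simp
    qed
    ultimately show "arr n s' x F \<and> frame (insert x scratch) s0 s'"
      by (simp add: I_def arr_def del: of_nat_add of_nat_mult)
  qed
qed

lemma ok_fill_Skip:
  assumes s0: "sbound L s0" "s0 ''n'' 0 = int n" and x: "x \<notin> insert ''n'' scratch"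
    and e: "\<And>i j s. i < n \<Longrightarrow> j < n \<Longrightarrow> frame (insert x scratch) s0 s \<Longrightarrow>
      s ''i'' 0 = int i \<Longrightarrow> s ''j'' 0 = int j \<Longrightarrow> s ''p'' 0 = int (i * n + j) \<Longrightarrow> aval e s = F i j"
    and bound: "\<And>i j. i < n \<Longrightarrow> j < n \<Longrightarrow> \<bar>F i j\<bar> \<le> 2 ^ L"
  shows "ok n L (fill x Skip e) s0 (\<lambda>s'. arr n s' x F \<and> frame (insert x scratch) s0 s')"
proof (rule ok_fill[OF s0 x _ bound])
  fix i j s assume *: "i < n" "j < n" "sbound L s" "frame (insert x scratch) s0 s"
    "s ''i'' 0 = int i" "s ''j'' 0 = int j" "s ''p'' 0 = int (i * n + j)"
  then show "ok n L Skip s (\<lambda>s'. frame {''a'', ''l''} s s' \<and> aval e s' = F i j)"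
    using e[OF *(1,2,4-7)] by (intro ok_Skip) (auto simp: frame_refl)
qed

lemma ok_mul:
  assumes s0: "sbound L s0" "s0 ''n'' 0 = int n" and z: "z \<notin> insert ''n'' scratch"
    and x: "arr n s0 x X" "x \<notin> insert z scratch" and y: "arr n s0 y Y" "y \<notin> insert z scratch"
    and X: "\<And>i j. i < n \<Longrightarrow> j < n \<Longrightarrow> \<bar>X i j\<bar> \<le> bx" and Y: "\<And>i j. i < n \<Longrightarrow> j < n \<Longrightarrow> \<bar>Y i j\<bar> \<le> b'"
    and b: "0 \<le> bx" "0 \<le> b'" "int n * bx * b' \<le> 2 ^ L"
  shows "ok n L (mul z x y) s0 (\<lambda>s'. arr n s' z (mmul n X Y) \<and> frame (insert z scratch) s0 s')"
  unfolding mul_def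
proof (rule ok_fill[OF s0 z])
  \<comment> \<open>The bound covers partial sums as well, since the accumulator is stored after
    every term.\<close>
  have bnd: "\<bar>\<Sum>l<m. X i l * Y l j\<bar> \<le> 2 ^ L" if "i < n" "j < n" "m \<le> n" for i j m
    by (rule order_trans[OF abs_sum_mult_le[of m _ bx _ b' n] b(3)]) (use that X Y b in auto)
  then show "\<bar>mmul n X Y i j\<bar> \<le> 2 ^ L" if "i < n" "j < n" for i j
    using that by (simp add: mmul_def)
  fix i j s assume ij: "i < n" "j < n" and s: "sbound L s" "frame (insert z scratch) s0 s"
    "s ''i'' 0 = int i" "s ''j'' 0 = int j" "s ''p'' 0 = int (i * n + j)"
  define I where "I k s' \<longleftrightarrow> frame {''a'', ''l''} s s' \<and> s' ''a'' 0 = (\<Sum>l<k. X i l * Y l j)" for k s'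
  have Is: "s' ''n'' 0 = int n" "s' ''i'' 0 = int i" "s' ''j'' 0 = int j"
    "arr n s' x X" "arr n s' y Y" if "frame {''a'', ''l''} s s'" for s'
  proof -
    have f: "frame (insert z scratch) s0 s'"
      using frame_trans[OF s(2) that, of "insert z scratch"] by auto
    show "s' ''n'' 0 = int n" using frameD[OF f, of "''n''"] s0(2) z by auto
    show "s' ''i'' 0 = int i" "s' ''j'' 0 = int j"
      using frameD[OF that, of "''i''"] frameD[OF that, of "''j''"] s by auto
    show "arr n s' x X" "arr n s' y Y" using arr_frame[OF x(1) f x(2)] arr_frame[OF y(1) f y(2)] by auto
  qed
  let ?b = "assign ''a'' (Add (V ''a'') (Mul (Read x (Add (Mul (V ''i'') (V ''n'')) (V ''l'')))
     (Read y (Add (Mul (V ''l'') (V ''n'')) (V ''j'')))))"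
  show "ok n L (Seq (assign ''a'' (Num 0)) (For ''l'' (V ''n'') ?b)) s
     (\<lambda>s'. frame {''a'', ''l''} s s' \<and> aval (V ''a'') s' = mmul n X Y i j)"
  proof (rule ok_Seq[where ?Q1.0 = "I 0"])
    show "ok n L (assign ''a'' (Num 0)) s (I 0)"
      using s by (intro ok_assign) (auto simp: I_def frame_upd frame_refl)
    fix s1 assume s1: "sbound L s1" "I 0 s1"
    have "ok n L (For ''l'' (V ''n'') ?b) s1 (\<lambda>s'. I n s' \<and> s' ''l'' 0 = int n)"
    proof (rule ok_For)
      show "I k (s(''l'' := z)) \<longleftrightarrow> I k s" for k s z by (auto simp: I_def frame_upd)
      show "aval (V ''n'') s = int n" if "I k s" for k s using Is that by (simp add: I_def)
      fix k s' assume k: "k < n" and s': "sbound L s'" "I k s'" "s' ''l'' 0 = int k"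
      have f: "frame {''a'', ''l''} s s'" using s' by (simp add: I_def)
      have "aval (Add (V ''a'') (Mul (Read x (Add (Mul (V ''i'') (V ''n'')) (V ''l'')))
         (Read y (Add (Mul (V ''l'') (V ''n'')) (V ''j''))))) s' = (\<Sum>l<Suc k. X i l * Y l j)"
        using s' Is[OF f] arrD[OF Is(4)[OF f] ij(1) k] arrD[OF Is(5)[OF f] k ij(2)]
        by (simp add: I_def)
      then show "ok n L ?b s' (\<lambda>s'. s' ''l'' 0 = int k \<and> I (Suc k) s')"
        using s' bnd[OF ij, of "Suc k"] k by (intro ok_assign) (auto simp: I_def frame_upd)
    qed (use s1 in auto)
    then show "ok n L (For ''l'' (V ''n'') ?b) s1 (\<lambda>s'. frame {''a'', ''l''} s s' \<and> aval (V ''a'') s' = mmul n X Y i j)"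
      by (rule ok_conseq) (auto simp: I_def mmul_def)
  qed
qed

section \<open>Size of the Gramian and correctness of its program\<close>

lemma abs_mmul_le:
  fixes X Y :: "nat \<Rightarrow> nat \<Rightarrow> int"
  assumes "\<And>i j. i < n \<Longrightarrow> j < n \<Longrightarrow> \<bar>X i j\<bar> \<le> a" "\<And>i j. i < n \<Longrightarrow> j < n \<Longrightarrow> \<bar>Y i j\<bar> \<le> b"
    "0 \<le> a" "0 \<le> b" "i < n" "j < n"
  shows "\<bar>mmul n X Y i j\<bar> \<le> int n * a * b"
  unfolding mmul_def using assms by (intro abs_sum_mult_le) auto

context
  fixes A E :: "nat \<Rightarrow> nat \<Rightarrow> int" and a e q :: int
  assumes A: "\<And>i j. i < n \<Longrightarrow> j < n \<Longrightarrow> \<bar>A i j\<bar> \<le> a" and E: "\<And>i j. i < n \<Longrightarrow> j < n \<Longrightarrow> \<bar>E i j\<bar> \<le> e"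
    and a0: "0 \<le> a" and e0: "0 \<le> e" and q: "q = (int n * a) * (int n * a) + 1"
begin

text \<open>A round multiplies the entries by at most \<open>(n a)^2\<close> and adds at most
  \<open>e <= q^k e\<close>; this is the origin of the 1 in \<open>q\<close>. The inequality for a
  single product bounds the intermediate matrix, which is stored too.\<close>

lemma gram_step: "int n * a * (q ^ k * e) \<le> q ^ Suc k * e"
    "int n * (int n * a * (q ^ k * e)) * a + e \<le> q ^ Suc k * e"
proof -
  have q1: "1 \<le> q" by (simp add: q)
  then have g: "e \<le> q ^ k * e" using e0 by (simp add: mult_le_cancel_right1)
  then have g0: "0 \<le> q ^ k * e" using e0 by linarith
  have "int n * a \<le> q"
  proof (cases "int n * a = 0")
    case False
    then have "1 \<le> int n * a" using a0 by (metis int_one_le_iff_zero_less mult_nonneg_nonneg of_nat_0_le_iff order_le_less)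
    then have "int n * a * 1 \<le> int n * a * (int n * a)" by (intro mult_left_mono) auto
    then show ?thesis by (simp add: q)
  next
    case True
    show ?thesis unfolding q True by simp
  qed
  then show "int n * a * (q ^ k * e) \<le> q ^ Suc k * e"
    using g0 mult_right_mono[of "int n * a" q "q ^ k * e"] by (simp add: mult.assoc)
  have "int n * (int n * a * (q ^ k * e)) * a + e \<le> (int n * a) * (int n * a) * (q ^ k * e) + q ^ k * e"
    using g by (simp add: ac_simps)
  also have "\<dots> = q ^ Suc k * e" by (simp add: q algebra_simps)
  finally show "int n * (int n * a * (q ^ k * e)) * a + e \<le> q ^ Suc k * e" .
qed

lemma gram_nonneg: "0 \<le> q ^ k * e"
  using e0 by (simp add: q)

lemma gram_mono: "k \<le> m \<Longrightarrow> q ^ k * e \<le> q ^ m * e"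
  using e0 by (intro mult_right_mono power_increasing) (simp_all add: q)

lemma gramian_bound: "i < n \<Longrightarrow> j < n \<Longrightarrow> \<bar>gramian n A E k i j\<bar> \<le> q ^ k * e"
proof (induction k arbitrary: i j)
  case 0
  then show ?case using e0 by simp
next
  case (Suc k)
  have 1: "\<bar>mmul n A (gramian n A E k) i j\<bar> \<le> int n * a * (q ^ k * e)" if "i < n" "j < n" for i j
    using A Suc.IH that a0 gram_nonneg by (intro abs_mmul_le) auto
  have "\<bar>mmul n (mmul n A (gramian n A E k)) (\<lambda>i j. A j i) i j\<bar> \<le> int n * (int n * a * (q ^ k * e)) * a"
    by (rule abs_mmul_le) (use 1 A Suc.prems a0 gram_nonneg in auto)
  then show ?case using E[OF Suc.prems] gram_step(2)[of k] by (simp add: gramian.simps del: power_Suc)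
qed

lemma ok_gram:
  assumes s0: "sbound L s0" "s0 ''n'' 0 = int n"
    and AB: "arr n s0 ''A'' A" "arr n s0 ''B'' (\<lambda>i j. A j i)" "arr n s0 ''E'' E"
    and qL: "q ^ n * e \<le> 2 ^ L"
  shows "ok n L gram_prog s0
    (\<lambda>s'. arr n s' ''W'' (gramian n A E n) \<and> frame ({''k'', ''T'', ''U'', ''W''} \<union> scratch) s0 s')"
proof -
  define X where "X = {''k'', ''T'', ''U'', ''W''} \<union> scratch"
  define I where "I k s \<longleftrightarrow> arr n s ''W'' (gramian n A E k) \<and> frame X s0 s" for k s
  have pres: "s ''n'' 0 = int n" "arr n s ''A'' A" "arr n s ''B'' (\<lambda>i j. A j i)" "arr n s ''E'' E"
    if f: "frame X s0 s" for s
  proof -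
    show "s ''n'' 0 = int n" using frameD[OF f, of "''n''"] s0(2) by (simp add: X_def)
    show "arr n s ''A'' A" "arr n s ''B'' (\<lambda>i j. A j i)" "arr n s ''E'' E"
      by (rule arr_frame[OF AB(1) f] arr_frame[OF AB(2) f] arr_frame[OF AB(3) f], simp add: X_def)+
  qed
  have gL: "q ^ k * e \<le> 2 ^ L" if "k \<le> n" for k using gram_mono[OF that] qL by linarith
  show ?thesis unfolding gram_prog_def
  proof (rule ok_Seq)
    show "ok n L (fill ''W'' Skip (Num 0)) s0 (\<lambda>s'. arr n s' ''W'' (\<lambda>i j. 0) \<and> frame (insert ''W'' scratch) s0 s')"
      using s0 by (intro ok_fill_Skip) auto
    fix s1 assume s1: "sbound L s1" "arr n s1 ''W'' (\<lambda>i j. 0) \<and> frame (insert ''W'' scratch) s0 s1"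
    let ?f = "fill ''W'' Skip (Add (Read ''U'' (V ''p'')) (Read ''E'' (V ''p'')))"
    let ?b = "Seq (mul ''T'' ''A'' ''W'') (Seq (mul ''U'' ''T'' ''B'') ?f)"
    have "ok n L (For ''k'' (V ''n'') ?b) s1 (\<lambda>s'. I n s' \<and> s' ''k'' 0 = int n)"
    proof (rule ok_For)
      show "n \<le> n * n" using n1 by simp
      show "I 0 s1" using s1 by (auto simp: I_def frame_def X_def)
      show "I k (s(''k'' := z)) \<longleftrightarrow> I k s" for k s z by (simp add: I_def frame_upd arr_upd X_def)
      show "aval (V ''n'') s = int n" if "I k s" for k s using pres(1) that by (simp add: I_def)
      fix k s assume k: "k < n" and s: "sbound L s" "I k s" "s ''k'' 0 = int k"
      have f: "frame X s0 s" and W: "arr n s ''W'' (gramian n A E k)" using s by (auto simp: I_def)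
      let ?R = "\<lambda>s'. s' ''k'' 0 = int k \<and> I (Suc k) s'"
      show "ok n L ?b s ?R"
      proof (rule ok_Seq)
        show "ok n L (mul ''T'' ''A'' ''W'') s (\<lambda>s'. arr n s' ''T'' (mmul n A (gramian n A E k)) \<and>
            frame (insert ''T'' scratch) s s')"
        proof (rule ok_mul)
          show "int n * a * (q ^ k * e) \<le> 2 ^ L" using gram_step(1)[of k] gL[of "Suc k"] k by simp
        qed (use s pres[OF f] W A gramian_bound a0 gram_nonneg in auto)
        fix s1 assume s1: "sbound L s1" "arr n s1 ''T'' (mmul n A (gramian n A E k)) \<and> frame (insert ''T'' scratch) s s1"
        have f1: "frame X s0 s1" using frame_trans[OF f, of "insert ''T'' scratch" s1 X] s1 by (auto simp: X_def)
        show "ok n L (Seq (mul ''U'' ''T'' ''B'') ?f) s1 ?R"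
        proof (rule ok_Seq)
          have 1: "\<bar>mmul n A (gramian n A E k) i j\<bar> \<le> int n * a * (q ^ k * e)" if "i < n" "j < n" for i j
            using A gramian_bound that a0 gram_nonneg by (intro abs_mmul_le) auto
          show "ok n L (mul ''U'' ''T'' ''B'') s1
            (\<lambda>s'. arr n s' ''U'' (mmul n (mmul n A (gramian n A E k)) (\<lambda>i j. A j i)) \<and> frame (insert ''U'' scratch) s1 s')"
          proof (rule ok_mul)
            show "int n * (int n * a * (q ^ k * e)) * a \<le> 2 ^ L"
              using gram_step(2)[of k] gL[of "Suc k"] k e0 by linarith
            show "0 \<le> int n * a * (q ^ k * e)" using a0 gram_nonneg by simp
          qed (use s1 pres[OF f1] 1 A a0 in auto)
          fix s2 assume s2: "sbound L s2" "arr n s2 ''U'' (mmul n (mmul n A (gramian n A E k)) (\<lambda>i j. A j i)) \<and>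
            frame (insert ''U'' scratch) s1 s2"
          have f2: "frame X s0 s2" using frame_trans[OF f1, of "insert ''U'' scratch" s2 X] s2 by (auto simp: X_def)
          have k2: "s2 ''k'' 0 = int k"
            using s(3) frameD[of "insert ''T'' scratch" s s1 "''k''"] frameD[of "insert ''U'' scratch" s1 s2 "''k''"] s1 s2 by simp
          have "ok n L ?f s2
            (\<lambda>s'. arr n s' ''W'' (gramian n A E (Suc k)) \<and> frame (insert ''W'' scratch) s2 s')"
          proof (rule ok_fill_Skip)
            fix i j s3 assume ij: "i < n" "j < n" and s3: "frame (insert ''W'' scratch) s2 s3" "s3 ''p'' 0 = int (i * n + j)"
            have "s3 ''U'' = s2 ''U''" "s3 ''E'' = s2 ''E''"
              using frameD[OF s3(1), of "''U''"] frameD[OF s3(1), of "''E''"] by auto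
            then show "aval (Add (Read ''U'' (V ''p'')) (Read ''E'' (V ''p''))) s3 = gramian n A E (Suc k) i j"
              using arrD[OF pres(4)[OF f2] ij] arrD[OF conjunct1[OF s2(2)] ij] s3(2) by simp
          next
            fix i j assume "i < n" "j < n"
            then show "\<bar>gramian n A E (Suc k) i j\<bar> \<le> 2 ^ L"
              using gramian_bound[of i j "Suc k"] gL[of "Suc k"] k by linarith
          qed (use s2 pres[OF f2] in auto)
          then show "ok n L ?f s2 ?R"
          proof (rule ok_conseq)
            fix s' assume s': "arr n s' ''W'' (gramian n A E (Suc k)) \<and> frame (insert ''W'' scratch) s2 s'"
            then have "frame X s0 s'" using frame_trans[OF f2, of "insert ''W'' scratch" s' X] by (auto simp: X_def)
            then show "s' ''k'' 0 = int k \<and> I (Suc k) s'"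
              using s' k2 frameD[of "insert ''W'' scratch" s2 s' "''k''"] by (simp add: I_def)
          qed
        qed
      qed
    qed (use s1 in auto)
    then show "ok n L (For ''k'' (V ''n'') ?b) s1
      (\<lambda>s'. arr n s' ''W'' (gramian n A E n) \<and> frame ({''k'', ''T'', ''U'', ''W''} \<union> scratch) s0 s')"
      by (rule ok_conseq) (simp add: I_def X_def)
  qed
qed

end

lemma ok_trace:
  assumes s0: "sbound L s0" "s0 ''n'' 0 = int n" and P: "arr n s0 ''P'' P"
    and b: "\<And>i j. i < n \<Longrightarrow> j < n \<Longrightarrow> \<bar>P i j\<bar> \<le> b" "0 \<le> b" "int n * b \<le> 2 ^ L"
  shows "ok n L trace_prog s0 (\<lambda>s'. s' ''a'' 0 = (\<Sum>i<n. P i i) \<and> frame {''a'', ''l''} s0 s')"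
  unfolding trace_prog_def
proof -
  define I where "I k s \<longleftrightarrow> s ''a'' 0 = (\<Sum>i<k. P i i) \<and> frame {''a'', ''l''} s0 s" for k s
  let ?b = "assign ''a'' (Add (V ''a'') (Read ''P'' (Add (Mul (V ''l'') (V ''n'')) (V ''l''))))"
  have bnd: "\<bar>\<Sum>i<k. P i i\<bar> \<le> 2 ^ L" if "k \<le> n" for k
    using abs_sum_mult_le[of k "\<lambda>i. P i i" b "\<lambda>i. 1" 1 n] b that by simp
  have pres: "s ''n'' 0 = int n" "arr n s ''P'' P" if "frame {''a'', ''l''} s0 s" for s
    using frameD[OF that, of "''n''"] s0(2) arr_frame[OF P that] by auto
  show "ok n L (Seq (assign ''a'' (Num 0)) (For ''l'' (V ''n'') ?b)) s0
    (\<lambda>s'. s' ''a'' 0 = (\<Sum>i<n. P i i) \<and> frame {''a'', ''l''} s0 s')"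
  proof (rule ok_Seq[where ?Q1.0 = "I 0"])
    show "ok n L (assign ''a'' (Num 0)) s0 (I 0)"
      using s0 by (intro ok_assign) (auto simp: I_def frame_upd frame_refl)
    fix s1 assume s1: "sbound L s1" "I 0 s1"
    have "ok n L (For ''l'' (V ''n'') ?b) s1 (\<lambda>s'. I n s' \<and> s' ''l'' 0 = int n)"
    proof (rule ok_For)
      show "n \<le> n * n" using n1 by simp
      show "I k (s(''l'' := z)) \<longleftrightarrow> I k s" for k s z by (auto simp: I_def frame_upd)
      show "aval (V ''n'') s = int n" if "I k s" for k s using pres that by (simp add: I_def)
      fix k s' assume k: "k < n" and s': "sbound L s'" "I k s'" "s' ''l'' 0 = int k"
      have f: "frame {''a'', ''l''} s0 s'" using s' by (simp add: I_def)
      have "aval (Add (V ''a'') (Read ''P'' (Add (Mul (V ''l'') (V ''n'')) (V ''l'')))) s' = (\<Sum>i<Suc k. P i i)"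
        using s' pres(1)[OF f] arrD[OF pres(2)[OF f] k k] by (simp add: I_def)
      then show "ok n L ?b s' (\<lambda>s'. s' ''l'' 0 = int k \<and> I (Suc k) s')"
        using s' bnd[of "Suc k"] k by (intro ok_assign) (auto simp: I_def frame_upd)
    qed (use s1 in auto)
    then show "ok n L (For ''l'' (V ''n'') ?b) s1
      (\<lambda>s'. s' ''a'' 0 = (\<Sum>i<n. P i i) \<and> frame {''a'', ''l''} s0 s')"
      by (rule ok_conseq) (simp add: I_def)
  qed
qed

section \<open>Size of the coefficient recursion and correctness of its program\<close>

context
  fixes W :: "nat \<Rightarrow> nat \<Rightarrow> int" and w Y :: int
  assumes W: "\<And>i j. i < n \<Longrightarrow> j < n \<Longrightarrow> \<bar>W i j\<bar> \<le> w" and w1: "1 \<le> w"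
    and Y: "Y = 2 * int n * int n * w"
begin

lemma fl_Y2: "2 \<le> Y" "2 * int n * w \<le> Y"
proof -
  have n': "1 \<le> int n" using n1 by simp
  have 1: "1 * 1 \<le> int n * w" using n' w1 by (intro mult_mono) auto
  then have "1 * (int n * w) \<le> int n * (int n * w)" using n' by (intro mult_right_mono) auto
  then show "2 * int n * w \<le> Y" by (simp add: Y mult.assoc)
  then show "2 \<le> Y" using 1 by (simp add: mult.assoc)
qed

text \<open>A step adds a multiple of the identity, which at most doubles the bound
  \<open>Y^k\<close>, multiplies by \<open>W\<close> at the cost of a factor \<open>n w\<close>, and
  takes a trace at the cost of a factor \<open>n\<close>. The product of these factors is
  \<open>Y\<close>.\<close>

lemma fl_Y_step: "2 * Y ^ k \<le> Y ^ Suc k" "int n * w * (2 * Y ^ k) \<le> Y ^ Suc k"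
    "int n * (int n * w * (2 * Y ^ k)) = Y ^ Suc k"
proof -
  have p: "0 \<le> Y ^ k" using fl_Y2 by simp
  show "2 * Y ^ k \<le> Y ^ Suc k" using mult_right_mono[OF fl_Y2(1) p] by simp
  show "int n * w * (2 * Y ^ k) \<le> Y ^ Suc k" using mult_right_mono[OF fl_Y2(2) p] by (simp add: ac_simps)
  show "int n * (int n * w * (2 * Y ^ k)) = Y ^ Suc k" by (simp add: Y ac_simps)
qed

lemma fl_bound:
  "(\<forall>i<n. \<forall>j<n. \<bar>fst (fl n W k) i j\<bar> \<le> Y ^ k) \<and> \<bar>snd (fl n W k)\<bar> \<le> Y ^ k"
proof (induction k)
  case (Suc k)
  obtain P c where Pc: "fl n W k = (P, c)" by fastforce
  define F where "F = (\<lambda>l j. P l j + (if l = j then c else 0))"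
  have F: "\<bar>F i j\<bar> \<le> 2 * Y ^ k" if "i < n" "j < n" for i j
  proof -
    have "\<bar>P i j\<bar> \<le> Y ^ k" "\<bar>c\<bar> \<le> Y ^ k" using Suc Pc that by auto
    then show ?thesis by (auto simp: F_def)
  qed
  have P': "\<bar>mmul n W F i j\<bar> \<le> int n * w * (2 * Y ^ k)" if "i < n" "j < n" for i j
    using W F that w1 fl_Y2 by (intro abs_mmul_le) auto
  have "\<bar>\<Sum>i<n. mmul n W F i i * 1\<bar> \<le> int n * (int n * w * (2 * Y ^ k)) * 1"
    using P' w1 fl_Y2 by (intro abs_sum_mult_le) auto
  then have "\<bar>- (\<Sum>i<n. mmul n W F i i) div int (Suc k)\<bar> \<le> Y ^ Suc k"
    using fl_Y_step(3)[of k] abs_div_le[of "- (\<Sum>i<n. mmul n W F i i)" "int (Suc k)"] by (simp del: power_Suc)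
  moreover have "\<bar>mmul n W F i j\<bar> \<le> Y ^ Suc k" if "i < n" "j < n" for i j
    using P'[OF that] fl_Y_step(2)[of k] by linarith
  ultimately show ?case
    by (simp add: fl.simps(2) Pc Let_def F_def mmul_def del: power_Suc)
qed simp

lemma ok_fl:
  assumes s0: "sbound L s0" "s0 ''n'' 0 = int n" and Ws: "arr n s0 ''W'' W" and YL: "Y ^ n \<le> 2 ^ L"
  shows "ok n L fl_prog s0 (\<lambda>s'. s' ''r'' 0 = int (flrank n W n) \<and>
    frame ({''k'', ''P'', ''M'', ''c'', ''r''} \<union> scratch) s0 s')" (is "ok _ _ _ _ ?Q")
proof -
  define X where "X = {''k'', ''P'', ''M'', ''c'', ''r''} \<union> scratch"
  define I where "I k s \<longleftrightarrow> arr n s ''P'' (fst (fl n W k)) \<and> s ''c'' 0 = snd (fl n W k) \<and>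
    s ''r'' 0 = int (flrank n W k) \<and> frame X s0 s" for k s
  have pres: "s ''n'' 0 = int n" "arr n s ''W'' W" if f: "frame X s0 s" for s
  proof -
    show "s ''n'' 0 = int n" using frameD[OF f, of "''n''"] s0(2) by (simp add: X_def)
    show "arr n s ''W'' W" by (rule arr_frame[OF Ws f]) (simp add: X_def)
  qed
  have YLk: "Y ^ k \<le> 2 ^ L" if "k \<le> n" for k
    using power_increasing[OF that, of Y] fl_Y2 YL by linarith
  let ?fillM = "fill ''M'' Skip (Add (Read ''P'' (V ''p'')) (Mul delta (V ''c'')))"
  let ?upd = "Cond (Less (Num 0) (Mul (V ''c'') (V ''c''))) (assign ''r'' (Add (V ''k'') (Num 1))) Skip"
  let ?c = "assign ''c'' (Quo (Sub (Num 0) (V ''a'')) (Add (V ''k'') (Num 1)))"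
  let ?b = "Seq ?fillM (Seq (mul ''P'' ''W'' ''M'') (Seq trace_prog (Seq ?c ?upd)))"
  have body: "ok n L ?b s (\<lambda>s'. s' ''k'' 0 = int k \<and> I (Suc k) s')"
    if k: "k < n" and s: "sbound L s" "I k s" "s ''k'' 0 = int k" for k s
  proof -
    let ?R = "\<lambda>s'. s' ''k'' 0 = int k \<and> I (Suc k) s'"
    obtain P c where Pc: "fl n W k = (P, c)" by fastforce
    define F where "F = (\<lambda>l j. P l j + (if l = j then c else 0))"
    have f: "frame X s0 s" and P: "arr n s ''P'' P" and c: "s ''c'' 0 = c" and r: "s ''r'' 0 = int (flrank n W k)"
      using s(2) Pc by (auto simp: I_def)
    have next_fl: "fl n W (Suc k) = (mmul n W F, - (\<Sum>i<n. mmul n W F i i) div int (Suc k))"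
      by (simp add: fl.simps(2) Pc Let_def F_def mmul_def)
    have F: "\<bar>F i j\<bar> \<le> 2 * Y ^ k" if "i < n" "j < n" for i j
    proof -
      have "\<bar>P i j\<bar> \<le> Y ^ k" "\<bar>c\<bar> \<le> Y ^ k" using fl_bound[of k] Pc that by auto
      then show ?thesis by (auto simp: F_def)
    qed
    have P': "\<bar>mmul n W F i j\<bar> \<le> int n * w * (2 * Y ^ k)" if "i < n" "j < n" for i j
      using W F that w1 fl_Y2 by (intro abs_mmul_le) auto
    have SkL: "Y ^ Suc k \<le> 2 ^ L" using YLk[of "Suc k"] k by simp
    show ?thesis
    proof (rule ok_Seq)
      show "ok n L ?fillM s (\<lambda>s'. arr n s' ''M'' F \<and> frame (insert ''M'' scratch) s s')"
      proof (rule ok_fill_Skip)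
        fix i j s3 assume ij: "i < n" "j < n" and s3: "frame (insert ''M'' scratch) s s3"
          "s3 ''i'' 0 = int i" "s3 ''j'' 0 = int j" "s3 ''p'' 0 = int (i * n + j)"
        have "s3 ''P'' = s ''P''" "s3 ''c'' = s ''c''"
          using frameD[OF s3(1), of "''P''"] frameD[OF s3(1), of "''c''"] by auto
        then show "aval (Add (Read ''P'' (V ''p'')) (Mul delta (V ''c''))) s3 = F i j"
          using arrD[OF P ij] s3(4) c aval_delta[of s3 i j, OF s3(2,3)] by (simp add: F_def)
      next
        fix i j assume "i < n" "j < n"
        then show "\<bar>F i j\<bar> \<le> 2 ^ L" using F[of i j] fl_Y_step(1)[of k] SkL by linarith
      qed (use s pres[OF f] in auto)
      fix s1 assume s1: "sbound L s1" "arr n s1 ''M'' F \<and> frame (insert ''M'' scratch) s s1"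
      have f1: "frame X s0 s1" using frame_trans[OF f, of "insert ''M'' scratch" s1 X] s1 by (auto simp: X_def)
      show "ok n L (Seq (mul ''P'' ''W'' ''M'') (Seq trace_prog (Seq ?c ?upd))) s1
        ?R"
      proof (rule ok_Seq)
        show "ok n L (mul ''P'' ''W'' ''M'') s1 (\<lambda>s'. arr n s' ''P'' (mmul n W F) \<and> frame (insert ''P'' scratch) s1 s')"
        proof (rule ok_mul)
          show "int n * w * (2 * Y ^ k) \<le> 2 ^ L" using fl_Y_step(2)[of k] SkL by linarith
        qed (use s1 pres[OF f1] W F w1 fl_Y2 in auto)
        fix s2 assume s2: "sbound L s2" "arr n s2 ''P'' (mmul n W F) \<and> frame (insert ''P'' scratch) s1 s2"
        have f2: "frame X s0 s2" using frame_trans[OF f1, of "insert ''P'' scratch" s2 X] s2 by (auto simp: X_def)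
        have kr2: "s2 ''k'' 0 = int k" "s2 ''r'' 0 = int (flrank n W k)"
          using s(3) r frameD[of "insert ''M'' scratch" s s1] frameD[of "insert ''P'' scratch" s1 s2] s1 s2 by auto
        show "ok n L (Seq trace_prog (Seq ?c ?upd)) s2 ?R"
        proof (rule ok_Seq)
          show "ok n L trace_prog s2 (\<lambda>s'. s' ''a'' 0 = (\<Sum>i<n. mmul n W F i i) \<and> frame {''a'', ''l''} s2 s')"
          proof (rule ok_trace[where P = "mmul n W F"])
            show "int n * (int n * w * (2 * Y ^ k)) \<le> 2 ^ L" using SkL unfolding fl_Y_step(3) .
            show "0 \<le> int n * w * (2 * Y ^ k)" using w1 fl_Y2 by simp
          qed (use s2 pres[OF f2] P' in auto)
          fix s3 assume s3: "sbound L s3" "s3 ''a'' 0 = (\<Sum>i<n. mmul n W F i i) \<and> frame {''a'', ''l''} s2 s3"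
          have f3: "frame X s0 s3" using frame_trans[OF f2, of "{''a'', ''l''}" s3 X] s3 by (auto simp: X_def)
          have g3: "s3 ''k'' 0 = int k" "s3 ''r'' 0 = int (flrank n W k)" "arr n s3 ''P'' (mmul n W F)"
            using kr2 s3 frameD[of "{''a'', ''l''}" s2 s3] arr_frame[of n s2 "''P''" "mmul n W F" "{''a'', ''l''}" s3] s2 by auto
          let ?K = "\<lambda>s'. frame X s0 s' \<and> s' ''k'' 0 = int k \<and> s' ''r'' 0 = int (flrank n W k) \<and>
            arr n s' ''P'' (mmul n W F) \<and> s' ''c'' 0 = snd (fl n W (Suc k))"
          show "ok n L (Seq ?c ?upd) s3 ?R"
          proof (rule ok_Seq[where ?Q1.0 = ?K])
            have av: "aval (Quo (Sub (Num 0) (V ''a'')) (Add (V ''k'') (Num 1))) s3 = snd (fl n W (Suc k))"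
              using s3 g3(1) unfolding next_fl by (simp add: add.commute)
            have "\<bar>snd (fl n W (Suc k))\<bar> \<le> 2 ^ L" using fl_bound[of "Suc k"] SkL by linarith
            then show "ok n L ?c s3 ?K"
              using s3 f3 g3 av by (intro ok_assign) (simp_all only: av, simp_all add: X_def frame_upd arr_upd)
            fix s4 assume s4: "sbound L s4" "?K s4"
            have PI: "arr n s4 ''P'' (fst (fl n W (Suc k)))" using s4 by (simp add: next_fl)
            have rI: "flrank n W (Suc k) = (if snd (fl n W (Suc k)) \<noteq> 0 then Suc k else flrank n W k)" by simp
            show "ok n L ?upd s4 ?R"
            proof (rule ok_Cond[OF s4(1)])
              assume "bval (Less (Num 0) (Mul (V ''c'') (V ''c''))) s4"
              then have nz: "snd (fl n W (Suc k)) \<noteq> 0" using s4(2) by auto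
              have "int k + 1 \<le> 2 ^ L" using n_le k by linarith
              then show "ok n L (assign ''r'' (Add (V ''k'') (Num 1))) s4 ?R"
                using s4 nz PI rI
                by (intro ok_assign) (auto simp: I_def frame_upd arr_upd X_def simp del: flrank.simps)
            next
              assume "\<not> bval (Less (Num 0) (Mul (V ''c'') (V ''c''))) s4"
              then have z: "snd (fl n W (Suc k)) = 0" using s4(2) not_real_square_gt_zero
                by (auto simp: not_less mult_le_0_iff)
              show "ok n L Skip s4 ?R"
                using s4 z PI rI by (intro ok_Skip) (auto simp: I_def simp del: flrank.simps)
            qed
          qed
        qed
      qed
    qed
  qed
  show ?thesis unfolding fl_prog_def
  proof (rule ok_Seq)
    show "ok n L (fill ''P'' Skip (Num 0)) s0 (\<lambda>s'. arr n s' ''P'' (\<lambda>i j. 0) \<and> frame (insert ''P'' scratch) s0 s')"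
      using s0 by (intro ok_fill_Skip) auto
    fix s1 assume s1: "sbound L s1" "arr n s1 ''P'' (\<lambda>i j. 0) \<and> frame (insert ''P'' scratch) s0 s1"
    have f1: "frame X s0 s1" using s1 by (auto simp: frame_def X_def)
    show "ok n L (Seq (assign ''c'' (Num 1)) (Seq (assign ''r'' (Num 0)) (For ''k'' (V ''n'') ?b))) s1 ?Q"
    proof (rule ok_Seq[where ?Q1.0 = "\<lambda>s'. arr n s' ''P'' (\<lambda>i j. 0) \<and> frame X s0 s' \<and> s' ''c'' 0 = 1"])
      show "ok n L (assign ''c'' (Num 1)) s1 (\<lambda>s'. arr n s' ''P'' (\<lambda>i j. 0) \<and> frame X s0 s' \<and> s' ''c'' 0 = 1)"
        using s1 f1 by (intro ok_assign) (auto simp: frame_upd arr_upd X_def)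
      fix s2 assume s2: "sbound L s2" "arr n s2 ''P'' (\<lambda>i j. 0) \<and> frame X s0 s2 \<and> s2 ''c'' 0 = 1"
      show "ok n L (Seq (assign ''r'' (Num 0)) (For ''k'' (V ''n'') ?b)) s2 ?Q"
      proof (rule ok_Seq[where ?Q1.0 = "I 0"])
        show "ok n L (assign ''r'' (Num 0)) s2 (I 0)"
          using s2 by (intro ok_assign) (auto simp: I_def frame_upd arr_upd X_def)
        fix s3 assume s3: "sbound L s3" "I 0 s3"
        have "ok n L (For ''k'' (V ''n'') ?b) s3 (\<lambda>s'. I n s' \<and> s' ''k'' 0 = int n)"
        proof (rule ok_For)
          show "n \<le> n * n" using n1 by simp
          show "I k (s(''k'' := z)) \<longleftrightarrow> I k s" for k s z by (simp add: I_def frame_upd arr_upd X_def)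
          show "aval (V ''n'') s = int n" if "I k s" for k s using pres(1) that by (simp add: I_def)
        qed (use s3 body in auto)
        then show "ok n L (For ''k'' (V ''n'') ?b) s3 ?Q"
          by (rule ok_conseq) (simp add: I_def X_def)
      qed
    qed
  qed
qed

end

abbreviation rank_vars :: "vname set" where
  "rank_vars \<equiv> {''k'', ''T'', ''U'', ''W'', ''P'', ''M'', ''c'', ''r''} \<union> scratch"

lemma ok_rank:
  fixes A E :: "nat \<Rightarrow> nat \<Rightarrow> int" and a e w :: int
  assumes A: "\<And>i j. i < n \<Longrightarrow> j < n \<Longrightarrow> \<bar>A i j\<bar> \<le> a" and E: "\<And>i j. i < n \<Longrightarrow> j < n \<Longrightarrow> \<bar>E i j\<bar> \<le> e"
    and a0: "0 \<le> a" and e1: "1 \<le> e"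
    and w: "w = ((int n * a) * (int n * a) + 1) ^ n * e"
    and wL: "(2 * int n * int n * w) ^ n \<le> 2 ^ L"
    and s0: "sbound L s0" "s0 ''n'' 0 = int n"
    and AB: "arr n s0 ''A'' A" "arr n s0 ''B'' (\<lambda>i j. A j i)" "arr n s0 ''E'' E"
  shows "ok n L rank_prog s0 (\<lambda>s'. s' ''r'' 0 = int (flrank n (gramian n A E n) n) \<and> frame rank_vars s0 s')"
proof -
  have q1: "1 \<le> (int n * a) * (int n * a) + 1" by simp
  have e0: "0 \<le> e" using e1 by simp
  have w1: "1 \<le> w" using mult_mono[OF one_le_power[OF q1] e1] e1 q1 by (simp add: w)
  have n': "1 \<le> int n" using n1 by simp
  have "1 \<le> int n * int n" using mult_mono[OF n' n'] by simp
  then have "1 * w \<le> 2 * (int n * int n) * w" using w1 by (intro mult_right_mono) auto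
  \<comment> \<open>The power dominates its base, so the entries of the Gramian fit as well.\<close>
  then have wY: "w \<le> 2 * int n * int n * w" by (simp add: mult.assoc)
  also have "\<dots> = (2 * int n * int n * w) ^ 1" by simp
  also have "\<dots> \<le> (2 * int n * int n * w) ^ n"
    using n1 order_trans[OF w1 wY] by (intro power_increasing)
  finally have wL': "w \<le> 2 ^ L" using wL by linarith
  show ?thesis unfolding rank_prog_def
  proof (rule ok_Seq)
    show "ok n L gram_prog s0 (\<lambda>s'. arr n s' ''W'' (gramian n A E n) \<and>
        frame ({''k'', ''T'', ''U'', ''W''} \<union> scratch) s0 s')"
      using wL' by (intro ok_gram[OF A E a0 e0 refl s0 AB]) (simp_all add: w)
    fix s1 assume s1: "sbound L s1" "arr n s1 ''W'' (gramian n A E n) \<and> frame ({''k'', ''T'', ''U'', ''W''} \<union> scratch) s0 s1"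
    have n1: "s1 ''n'' 0 = int n" using s1 s0 frameD[of _ s0 s1 "''n''"] by fastforce
    have "ok n L fl_prog s1 (\<lambda>s'. s' ''r'' 0 = int (flrank n (gramian n A E n) n) \<and>
        frame ({''k'', ''P'', ''M'', ''c'', ''r''} \<union> scratch) s1 s')"
    proof (rule ok_fl[OF _ w1 refl s1(1) n1 conjunct1[OF s1(2)] wL])
      fix i j assume ij: "i < n" "j < n"
      show "\<bar>gramian n A E n i j\<bar> \<le> w"
        unfolding w by (rule gramian_bound[where a = a, OF _ _ a0 e0 refl]) (use A E ij in auto)
    qed
    then show "ok n L fl_prog s1 (\<lambda>s'. s' ''r'' 0 = int (flrank n (gramian n A E n) n) \<and> frame rank_vars s0 s')"
      using s1 by (elim ok_conseq) (auto simp: frame_def)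
  qed
qed

end

section \<open>The greedy invariant\<close>

lemma of_int_kry:
  "real_of_int (kry n A k b i) = kry n (\<lambda>i j. real_of_int (A i j)) k (\<lambda>i. real_of_int (b i)) i"
proof (induction k arbitrary: i)
  case (Suc k)
  then show ?case by (simp add: mulv_def)
qed simp

text \<open>The characteristic polynomial of the real Gramian is the image of the integer one, and
  its lowest nonzero coefficient is at \<open>n - d\<close> for the dimension \<open>d\<close> of
  the span of the generators; so the last nonzero coefficient met by the recursion is the one of
  step \<open>d\<close>.\<close>

lemma flrank_gramian_eq_dim:
  fixes A E :: "nat \<Rightarrow> nat \<Rightarrow> int" and b :: "'b \<Rightarrow> nat \<Rightarrow> int"
  assumes K: "finite K" and c: "\<And>a. a \<in> K \<Longrightarrow> 0 < c a" and b: "\<And>a. a \<in> K \<Longrightarrow> b a \<in> nvecs n"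
    and E: "\<And>i j. i < n \<Longrightarrow> j < n \<Longrightarrow> E i j = (\<Sum>a\<in>K. c a * b a i * b a j)"
  shows "flrank n (gramian n A E n) n =
    fs.dim ((\<lambda>(a,k). kry n (\<lambda>i j. real_of_int (A i j)) k (\<lambda>i. real_of_int (b a i))) ` (K \<times> {..<n}))"
proof -
  define g where "g = (\<lambda>(a,k). kry n (\<lambda>i j. real_of_int (A i j)) k (\<lambda>i. real_of_int (b a i)))"
  define W where "W i j = (\<Sum>x\<in>K \<times> {..<n}. real_of_int (c (fst x)) * g x i * g x j)" for i j
  define \<chi> where "\<chi> = char_poly (mat n n (\<lambda>(i,j). gramian n A E n i j))"
  define r where "r = flrank n (gramian n A E n) n"
  define d where "d = fs.dim (g ` (K \<times> {..<n}))"
  have g: "g ` (K \<times> {..<n}) \<subseteq> nvecs n"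
  proof
    fix y assume "y \<in> g ` (K \<times> {..<n})"
    then obtain a k where ak: "a \<in> K" "y = kry n (\<lambda>i j. real_of_int (A i j)) k (\<lambda>i. real_of_int (b a i))"
      by (auto simp: g_def)
    have "(\<lambda>i. real_of_int (b a i)) \<in> nvecs n" using b[OF ak(1)] by (simp add: nvecs_def)
    then show "y \<in> nvecs n" unfolding ak(2) by (rule kry_nvecs)
  qed
  have "real_of_int (gramian n A E n i j) = W i j" if "i < n" "j < n" for i j
    using that by (simp add: gramian_eq_sum[OF E] W_def g_def of_int_kry case_prod_unfold)
  then have "mat n n (\<lambda>(i,j). W i j) = map_mat real_of_int (mat n n (\<lambda>(i,j). gramian n A E n i j))"
    by (intro eq_matI) auto
  then have \<chi>W: "map_poly real_of_int \<chi> = char_poly (mat n n (\<lambda>(i,j). W i j))"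
    by (simp add: \<chi>_def of_int_hom.char_poly_hom[of _ n])
  have co: "coeff (map_poly real_of_int \<chi>) j = real_of_int (coeff \<chi> j)" for j
    by (simp add: coeff_map_poly)
  have fin: "finite (K \<times> {..<n})" using K by simp
  have cpos: "\<And>x. x \<in> K \<times> {..<n} \<Longrightarrow> 0 < real_of_int (c (fst x))" using c by auto
  note gram = char_poly_gram[OF fin cpos g W_def \<chi>W, folded d_def, unfolded co]
  have dn: "d \<le> n" unfolding d_def by (rule dim_le_n[OF g])
  have fl: "snd (fl n (gramian n A E n) k) = coeff \<chi> (n - k)" if "k \<le> n" for k
    using fl_correct[OF that] by (simp add: \<chi>_def)
  have r: "r \<le> n" "coeff \<chi> (n - r) \<noteq> 0" "\<And>j. r < j \<Longrightarrow> j \<le> n \<Longrightarrow> coeff \<chi> (n - j) = 0"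
    using flrank_spec[of n "gramian n A E n" n] fl by (auto simp: r_def)
  have "\<not> n - r < n - d" using gram(1)[of "n - r"] r(2) by auto
  moreover have "\<not> r < d" using gram(2) r(3)[OF _ dn] by auto
  ultimately have "r = d" using r(1) dn by linarith
  then show ?thesis by (simp add: r_def d_def g_def)
qed

section \<open>Krylov rank as a function of the index set\<close>

definition krylov_rank :: "nat \<Rightarrow> (nat \<Rightarrow> nat \<Rightarrow> int) \<Rightarrow> nat set \<Rightarrow> nat" where
  "krylov_rank n A X = fs.dim (\<Union>i\<in>X. (\<lambda>k. kry n (\<lambda>i j. real_of_int (A i j)) k (uvec i)) ` {..<n})"

lemma uvec_nvecs: "i < n \<Longrightarrow> uvec i \<in> nvecs n"
  by (simp add: uvec_def nvecs_def)

text \<open>Positive weights do not affect the rank, only the support matters. The greedy program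
  relies on this: a trial insertion adds 1 to the indicator, so an index chosen before has weight
  2.\<close>

lemma flrank_diag:
  fixes v :: "nat \<Rightarrow> int"
  assumes v: "\<And>i. i < n \<Longrightarrow> 0 \<le> v i"
    and F: "\<And>i j. i < n \<Longrightarrow> j < n \<Longrightarrow> F i j = (if i = j then v i else 0)"
  shows "flrank n (gramian n A F n) n = krylov_rank n A {i. i < n \<and> 0 < v i}"
proof -
  define K where "K = {i. i < n \<and> 0 < v i}"
  have "F i j = (\<Sum>a\<in>K. v a * uvec a i * uvec a j)" if "i < n" "j < n" for i j
  proof -
    have "(\<Sum>a\<in>K. v a * uvec a i * uvec a j) = (\<Sum>a\<in>K. if a = i then (if i = j then v i else 0) else 0)"
      by (intro sum.cong refl) (auto simp: uvec_def)
    also have "\<dots> = (if i \<in> K then (if i = j then v i else 0) else 0)"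
      by (rule sum.delta) (simp add: K_def)
    also have "\<dots> = F i j" using F[OF that] v[OF that(1)] that by (auto simp: K_def)
    finally show ?thesis by simp
  qed
  then have "flrank n (gramian n A F n) n = fs.dim ((\<lambda>(a,k). kry n (\<lambda>i j. real_of_int (A i j)) k
      (\<lambda>i. real_of_int (uvec a i))) ` (K \<times> {..<n}))"
    by (intro flrank_gramian_eq_dim[where c = v]) (auto simp: K_def uvec_nvecs)
  moreover have "(\<lambda>i. real_of_int (uvec a i)) = uvec a" for a by (auto simp: uvec_def)
  moreover have "(\<lambda>(a,k). kry n (\<lambda>i j. real_of_int (A i j)) k (uvec a)) ` (K \<times> {..<n})
     = (\<Union>i\<in>K. (\<lambda>k. kry n (\<lambda>i j. real_of_int (A i j)) k (uvec i)) ` {..<n})" by auto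
  ultimately show ?thesis by (simp add: krylov_rank_def K_def)
qed

lemma flrank_vec:
  assumes b: "b \<in> nvecs n" and F: "\<And>i j. i < n \<Longrightarrow> j < n \<Longrightarrow> F i j = b i * b j"
  shows "flrank n (gramian n A F n) n = n \<longleftrightarrow>
    full n (\<lambda>i j. real_of_int (A i j)) {\<lambda>i. real_of_int (b i)}"
proof -
  have "flrank n (gramian n A F n) n = fs.dim ((\<lambda>(a,k). kry n (\<lambda>i j. real_of_int (A i j)) k
      (\<lambda>i. real_of_int (b i))) ` ({()} \<times> {..<n}))"
    using F b by (intro flrank_gramian_eq_dim[where c = "\<lambda>_. 1" and b = "\<lambda>_. b"]) auto
  moreover have "(\<lambda>(a,k). kry n (\<lambda>i j. real_of_int (A i j)) k (\<lambda>i. real_of_int (b i))) ` ({()} \<times> {..<n})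
    = (\<lambda>(b,k). kry n (\<lambda>i j. real_of_int (A i j)) k b) ` ({\<lambda>i. real_of_int (b i)} \<times> {..<n})"
    by auto
  moreover have "(\<lambda>i. real_of_int (b i)) \<in> nvecs n" using b by (simp add: nvecs_def)
  ultimately show ?thesis by (subst full_iff_dim) auto
qed

lemma krylov_rank_eq_iff:
  assumes "X \<subseteq> {..<n}"
  shows "krylov_rank n A X = n \<longleftrightarrow> full n (\<lambda>i j. real_of_int (A i j)) (uvec ` X)"
proof -
  have "(\<lambda>(b,k). kry n (\<lambda>i j. real_of_int (A i j)) k b) ` (uvec ` X \<times> {..<n})
     = (\<Union>i\<in>X. (\<lambda>k. kry n (\<lambda>i j. real_of_int (A i j)) k (uvec i)) ` {..<n})" by auto
  moreover have "finite X" using assms finite_subset by blast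
  moreover have "uvec ` X \<subseteq> nvecs n" using assms uvec_nvecs by auto
  ultimately show ?thesis by (subst full_iff_dim) (auto simp: krylov_rank_def)
qed

lemma krylov_vectors_nvecs:
  "X \<subseteq> {..<n} \<Longrightarrow> (\<Union>i\<in>X. (\<lambda>k. kry n B k (uvec i :: nat \<Rightarrow> real)) ` {..<n}) \<subseteq> nvecs n"
  by (auto intro!: kry_nvecs uvec_nvecs)

lemma krylov_rank_le: "X \<subseteq> {..<n} \<Longrightarrow> krylov_rank n A X \<le> n"
  unfolding krylov_rank_def by (intro dim_le_n krylov_vectors_nvecs)

lemma krylov_rank_all:
  assumes "0 < n"
  shows "krylov_rank n A {..<n} = n"
proof (subst krylov_rank_eq_iff)
  show "full n (\<lambda>i j. real_of_int (A i j)) (uvec ` {..<n})"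
    unfolding full_def
  proof (intro ballI impI)
    fix w :: "nat \<Rightarrow> real" assume w: "w \<in> nvecs n"
      "\<forall>k<n. \<forall>b\<in>uvec ` {..<n}. ip n (kry n (\<lambda>i j. real_of_int (A i j)) k b) w = 0"
    have "w i = 0" if "i < n" for i
    proof -
      have "ip n (kry n (\<lambda>i j. real_of_int (A i j)) 0 (uvec i)) w = 0" using w(2) assms that by blast
      moreover have "(\<Sum>j<n. uvec i j * w j) = (\<Sum>j<n. if j = i then w j else 0)"
        by (intro sum.cong) (auto simp: uvec_def)
      ultimately show ?thesis using that by (simp add: ip_def)
    qed
    then have "w i = 0" for i using w(1) by (cases "i < n") (simp_all add: nvecs_def)
    then show "w = 0" by (intro ext) simp
  qed
qed simp

lemma krylov_rank_gain:
  assumes n: "0 < n" and X: "X \<subseteq> {..<n}" and T: "T \<subseteq> {..<n}" "krylov_rank n A T = n"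
  obtains i where "i \<in> T"
    "n - krylov_rank n A X \<le> card T * (krylov_rank n A (insert i X) - krylov_rank n A X)"
proof -
  \<comment> \<open>Empty outside the index range, as \<open>dim_gain\<close> wants
    \<open>G i\<close> inside \<open>nvecs n\<close> for every \<open>i\<close>.\<close>
  define G where "G i = (if i < n then (\<lambda>k. kry n (\<lambda>i j. real_of_int (A i j)) k (uvec i)) ` {..<n} else {})" for i
  have eq: "krylov_rank n A Y = fs.dim (\<Union>(G ` Y))" if "Y \<subseteq> {..<n}" for Y
    unfolding krylov_rank_def G_def using that by (intro arg_cong[of _ _ fs.dim]) auto
  have "G i \<subseteq> nvecs n" for i using krylov_vectors_nvecs[of "{i}" n] by (auto simp: G_def)
  moreover have "finite T" using T(1) finite_subset by blast
  ultimately obtain i where i: "i \<in> T"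
    "n - fs.dim (\<Union>(G ` X)) \<le> card T * (fs.dim (\<Union>(G ` insert i X)) - fs.dim (\<Union>(G ` X)))"
    using dim_gain[of G n T X] T n by (auto simp: eq)
  moreover have "insert i X \<subseteq> {..<n}" using i X T by auto
  ultimately show ?thesis using that[of i] X by (simp add: eq)
qed

text \<open>The state after \<open>g\<close> rounds. The competitor \<open>T\<close> is quantified
  because the program does not know it. The bound on \<open>card X\<close> is carried beside the
  decay since it is obtained at the moment of an insertion, while the rank is still below
  \<open>n\<close>. The term \<open>min g n\<close> records that every round gains at least 1 until
  the rank is full.\<close>

definition greedy_inv :: "nat \<Rightarrow> (nat \<Rightarrow> nat \<Rightarrow> int) \<Rightarrow> nat \<Rightarrow> nat set \<Rightarrow> bool" where
  "greedy_inv n A g X \<longleftrightarrow> X \<subseteq> {..<n} \<and> min g n \<le> krylov_rank n A X \<and>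
    (\<forall>T. T \<subseteq> {..<n} \<longrightarrow> krylov_rank n A T = n \<longrightarrow>
      real n - real (krylov_rank n A X) \<le> real n * (1 - 1 / real (card T)) ^ card X \<and>
      real (card X) \<le> 1 + real (card T) * ln (real n))"

lemma greedy_inv_0: "0 < n \<Longrightarrow> greedy_inv n A 0 {}"
  by (simp add: greedy_inv_def)

text \<open>\<open>m\<close> bounds what one further index achieves. If \<open>m\<close> does not
  exceed the current rank, the gain lemma with all indices as competitor forces full rank, so an
  idle round occurs only at the end.\<close>

lemma greedy_inv_step:
  assumes n: "0 < n" and inv: "greedy_inv n A g X"
    and m: "\<And>i. i < n \<Longrightarrow> krylov_rank n A (insert i X) \<le> m"
  shows "m \<le> krylov_rank n A X \<Longrightarrow> greedy_inv n A (Suc g) X"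
    and "krylov_rank n A X < m \<Longrightarrow> i < n \<Longrightarrow> m = krylov_rank n A (insert i X) \<Longrightarrow>
      greedy_inv n A (Suc g) (insert i X)"
proof -
  have X: "X \<subseteq> {..<n}" and g: "min g n \<le> krylov_rank n A X" using inv by (auto simp: greedy_inv_def)
  have gain: "real n - real m \<le> (real n - real (krylov_rank n A X)) * (1 - 1 / real (card T)) \<and> 0 < card T"
    if T: "T \<subseteq> {..<n}" "krylov_rank n A T = n" for T
  proof -
    obtain i where i: "i \<in> T"
      "n - krylov_rank n A X \<le> card T * (krylov_rank n A (insert i X) - krylov_rank n A X)"
      by (rule krylov_rank_gain[OF n X T])
    have finT: "finite T" using T(1) finite_subset by blast
    then have cT: "0 < card T" using i(1) by (auto simp: card_gt_0_iff)
    have "krylov_rank n A (insert i X) \<le> m" using m i T by auto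
    then have "n - krylov_rank n A X \<le> card T * (m - krylov_rank n A X)"
      using i(2) by (meson diff_le_mono le_trans mult_le_mono2)
    then have "real (n - krylov_rank n A X) \<le> real (card T) * real (m - krylov_rank n A X)"
      by (metis of_nat_le_iff of_nat_mult)
    moreover have "real (n - krylov_rank n A X) = real n - real (krylov_rank n A X)"
      using krylov_rank_le[OF X, of A] by (simp add: of_nat_diff)
    \<comment> \<open>Truncated subtraction agrees with the real one unless the deficit is already
      zero, and in that case \<open>m\<close> is at least \<open>n\<close> by monotonicity of the
      rank.\<close>
    moreover have "real (m - krylov_rank n A X) = real m - real (krylov_rank n A X) \<or> n = krylov_rank n A X"
    proof (cases "krylov_rank n A X \<le> m")
      case False
      then show ?thesis using \<open>n - krylov_rank n A X \<le> card T * (m - krylov_rank n A X)\<close>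
          krylov_rank_le[OF X, of A] by simp
    qed (simp add: of_nat_diff)
    moreover have "krylov_rank n A X \<le> m" if "n = krylov_rank n A X"
    proof -
      have "krylov_rank n A (insert i X) \<le> m" by fact
      have "i < n" using i T by auto
      have iX: "insert i X \<subseteq> {..<n}" using X \<open>i < n\<close> by auto
      have "full n (\<lambda>i j. real_of_int (A i j)) (uvec ` X)"
        using krylov_rank_eq_iff[OF X, of A] that by simp
      then have "full n (\<lambda>i j. real_of_int (A i j)) (uvec ` insert i X)" by (simp add: full_def)
      then have "krylov_rank n A (insert i X) = n" using krylov_rank_eq_iff[OF iX, of A] by blast
      then show ?thesis using \<open>krylov_rank n A (insert i X) \<le> m\<close> that by simp
    qed
    ultimately have "(real n - real (krylov_rank n A X)) \<le> real (card T) * (real m - real (krylov_rank n A X))"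
      by (auto simp: of_nat_diff)
    then have "(real n - real (krylov_rank n A X)) / real (card T) \<le> real m - real (krylov_rank n A X)"
      using cT by (simp add: field_simps)
    then show ?thesis using cT by (simp add: algebra_simps diff_divide_distrib)
  qed
  {
    assume le: "m \<le> krylov_rank n A X"
    have "krylov_rank n A {..<n} = n" by (rule krylov_rank_all[OF n])
    from gain[OF subset_refl this]
    have "real n - real (krylov_rank n A X) \<le> (real n - real (krylov_rank n A X)) * (1 - 1 / real n)"
      using le by simp
    then have "(real n - real (krylov_rank n A X)) * (1 / real n) \<le> 0" by (simp add: algebra_simps)
    then have "real n - real (krylov_rank n A X) \<le> 0" using n by (simp add: mult_le_0_iff divide_le_0_iff)
    then have "n \<le> krylov_rank n A X" by simp
    then show "greedy_inv n A (Suc g) X" using inv by (auto simp: greedy_inv_def)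
  }
  {
    assume lt: "krylov_rank n A X < m" and i: "i < n" and mi: "m = krylov_rank n A (insert i X)"
    have iX: "insert i X \<subseteq> {..<n}" using X i by auto
    have "finite X" using X finite_subset by blast
    moreover have "i \<notin> X" using lt mi by (auto simp: insert_absorb)
    ultimately have card: "card (insert i X) = Suc (card X)" by simp
    have "m \<le> n" using krylov_rank_le[OF iX, of A] mi by simp
    have "min (Suc g) n \<le> krylov_rank n A (insert i X)" using g lt mi by simp
    moreover have "real n - real (krylov_rank n A (insert i X))
        \<le> real n * (1 - 1 / real (card T)) ^ card (insert i X) \<and>
        real (card (insert i X)) \<le> 1 + real (card T) * ln (real n)"
      if T: "T \<subseteq> {..<n}" "krylov_rank n A T = n" for T
    proof
      have cT: "0 < card T" using gain[OF T] by simp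
      define t where "t = 1 - 1 / real (card T)"
      have t0: "0 \<le> t" using cT by (simp add: t_def)
      have I: "real n - real (krylov_rank n A X) \<le> real n * t ^ card X"
        using inv T by (simp add: greedy_inv_def t_def)
      have "real n - real m \<le> (real n - real (krylov_rank n A X)) * t" using gain[OF T] by (simp add: t_def)
      also have "\<dots> \<le> real n * t ^ card X * t" using I t0 by (rule mult_right_mono)
      finally show "real n - real (krylov_rank n A (insert i X))
        \<le> real n * (1 - 1 / real (card T)) ^ card (insert i X)"
        unfolding card mi t_def[symmetric] by (simp add: ac_simps)
      \<comment> \<open>Before the insertion the deficit is at least 1, so
        \<open>1 <= n exp (- card X / card T)\<close> and \<open>card X <= card T ln n\<close>. The
        new index accounts for the additional 1.\<close>
      have "t \<le> exp (- 1 / real (card T))" using exp_ge_add_one_self[of "- 1 / real (card T)"] by (simp add: t_def)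
      then have "t ^ card X \<le> exp (- 1 / real (card T)) ^ card X" using t0 by (rule power_mono)
      also have "\<dots> = exp (- (real (card X) / real (card T)))"
        by (simp add: exp_of_nat_mult[symmetric])
      finally have "real n * t ^ card X \<le> real n * exp (- (real (card X) / real (card T)))"
        by (intro mult_left_mono) auto
      moreover have "1 \<le> real n - real (krylov_rank n A X)" using lt \<open>m \<le> n\<close> by linarith
      ultimately have "1 \<le> real n * exp (- (real (card X) / real (card T)))" using I by linarith
      then have "exp (real (card X) / real (card T)) \<le> real n" by (simp add: exp_minus field_simps)
      then have "real (card X) / real (card T) \<le> ln (real n)" using n by (simp add: ln_ge_iff)
      then show "real (card (insert i X)) \<le> 1 + real (card T) * ln (real n)"
        using cT card by (simp add: field_simps)
    qed
    ultimately show "greedy_inv n A (Suc g) (insert i X)" using iX by (simp add: greedy_inv_def)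
  }
qed

definition diag_expr :: aexp where
  "diag_expr = Mul delta (Read ''S'' (V ''i''))"

section \<open>The algorithms\<close>

text \<open>\<open>S\<close> is the indicator of the chosen set and \<open>u\<close> its Krylov rank; \<open>m\<close> is the best rank found in
  the current round, attained by adding \<open>q\<close>.\<close>

definition cand_prog :: com where
  "cand_prog = Seq (Store ''S'' (V ''h'') (Add (Read ''S'' (V ''h'')) (Num 1)))
    (Seq (fill ''E'' Skip diag_expr) (Seq rank_prog
    (Seq (Store ''S'' (V ''h'') (Sub (Read ''S'' (V ''h'')) (Num 1)))
      (Cond (Less (V ''m'') (V ''r'')) (Seq (assign ''m'' (V ''r'')) (assign ''q'' (V ''h''))) Skip))))"

definition greedy_prog :: com where
  "greedy_prog = For ''g'' (V ''n'') (Seq (assign ''m'' (Num 0)) (Seq (For ''h'' (V ''n'') cand_prog)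
    (Cond (Less (V ''u'') (V ''m'')) (Seq (Store ''S'' (V ''q'') (Num 1)) (assign ''u'' (V ''m''))) Skip)))"

definition powers_prog :: com where
  "powers_prog = Seq (assign ''w'' (Num 1)) (For ''h'' (V ''n'')
     (Seq (Store ''b'' (V ''h'') (Mul (Read ''S'' (V ''h'')) (V ''w''))) (assign ''w'' (Mul (V ''w'') (V ''t'')))))"

definition copy_prog :: com where
  "copy_prog = For ''h'' (V ''n'')
     (Seq (Store ''outnum'' (V ''h'') (Read ''b'' (V ''h''))) (Store ''outden'' (V ''h'') (Num 1)))"

definition try_prog :: com where
  "try_prog = Seq powers_prog (Seq (fill ''E'' Skip (Mul (Read ''b'' (V ''i'')) (Read ''b'' (V ''j''))))
     (Seq rank_prog (Cond (Less (V ''r'') (V ''n'')) Skip copy_prog)))"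

text \<open>The loop runs through all candidates: a success overwrites the output and a failure
  leaves it alone, so the last success remains.\<close>

definition vec_prog :: com where
  "vec_prog = For ''t'' (Mul (V ''n'') (V ''n'')) try_prog"

definition prep_prog :: com where
  "prep_prog = Seq (assign ''d'' (Num 1))
    (Seq (For ''p'' (Mul (V ''n'') (V ''n'')) (assign ''d'' (Mul (V ''d'') (Read ''den'' (V ''p'')))))
    (Seq (fill ''A'' Skip (Mul (Read ''num'' (V ''p'')) (Quo (V ''d'') (Read ''den'' (V ''p'')))))
      (fill ''B'' Skip (Read ''A'' (Add (Mul (V ''j'') (V ''n'')) (V ''i''))))))"

section \<open>Correctness of the greedy search\<close>

definition setrep :: "nat \<Rightarrow> state \<Rightarrow> nat set \<Rightarrow> bool" where
  "setrep n s X \<longleftrightarrow> (\<forall>i<n. s ''S'' (int i) = (if i \<in> X then 1 else 0))"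

lemma setrep_frame: "setrep n s X \<Longrightarrow> frame Y s s' \<Longrightarrow> ''S'' \<notin> Y \<Longrightarrow> setrep n s' X"
  by (simp add: setrep_def frame_def)

lemma index_less: "i < n \<Longrightarrow> j < n \<Longrightarrow> i * n + j < n * (n::nat)"
proof -
  assume "i < n" "j < n"
  then have "i * n + j < Suc i * n" by simp
  also have "\<dots> \<le> n * n" using \<open>i < n\<close> by (intro mult_le_mono1) simp
  finally show ?thesis .
qed

text \<open>\<open>a\<close> bounds the cleared matrix and \<open>e\<close> every matrix
  \<open>E\<close> in use: 2 for the indicator during a trial insertion, and twice the power
  \<open>(n^2)^n\<close> as factors for the product of two entries \<open>t^i\<close>.
  \<open>wL\<close> is the size reached by the coefficient recursion on the Gramian.\<close>

locale alg = bounded +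
  fixes A :: "nat \<Rightarrow> nat \<Rightarrow> int" and a e :: int
  assumes A_bound: "\<And>i j. i < n \<Longrightarrow> j < n \<Longrightarrow> \<bar>A i j\<bar> \<le> a" and a0: "0 \<le> a" and e2: "2 \<le> e"
    and wL: "(2 * int n * int n * (((int n * a) * (int n * a) + 1) ^ n * e)) ^ n \<le> 2 ^ L"
    and powers_e: "int (n * n) ^ n * int (n * n) ^ n \<le> e"
begin

abbreviation \<rho> :: "nat set \<Rightarrow> nat" where
  "\<rho> \<equiv> krylov_rank n A"

definition env :: "state \<Rightarrow> bool" where
  "env s \<longleftrightarrow> s ''n'' 0 = int n \<and> arr n s ''A'' A \<and> arr n s ''B'' (\<lambda>i j. A j i)"

lemma env_frame: "env s \<Longrightarrow> frame X s s' \<Longrightarrow> ''n'' \<notin> X \<Longrightarrow> ''A'' \<notin> X \<Longrightarrow> ''B'' \<notin> X \<Longrightarrow> env s'"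
  by (simp add: env_def frame_def arr_def)

lemma env_n: "env s \<Longrightarrow> s ''n'' 0 = int n"
  by (simp add: env_def)

lemma e_le: "e \<le> 2 ^ L"
proof -
  have n': "1 \<le> int n" using n1 by simp
  define q where "q = (int n * a) * (int n * a) + 1"
  have q: "1 \<le> q ^ n" by (intro one_le_power) (simp add: q_def)
  have "1 * e \<le> q ^ n * e" using q e2 by (intro mult_right_mono) auto
  moreover have "1 * 1 \<le> int n * int n" using n' by (intro mult_mono) auto
  then have "1 * (q ^ n * e) \<le> 2 * (int n * int n) * (q ^ n * e)"
    using q e2 by (intro mult_right_mono) auto
  ultimately have Y: "e \<le> 2 * int n * int n * (q ^ n * e)" by (simp add: mult.assoc)
  also have "\<dots> = (2 * int n * int n * (q ^ n * e)) ^ 1" by simp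
  also have "\<dots> \<le> (2 * int n * int n * (q ^ n * e)) ^ n"
    using n1 Y e2 by (intro power_increasing) linarith+
  finally show ?thesis using wL by (simp add: q_def)
qed

lemma ok_fill_rank:
  assumes s: "sbound L s0" "env s0"
    and ex: "\<And>i j s. i < n \<Longrightarrow> j < n \<Longrightarrow> frame (insert ''E'' scratch) s0 s \<Longrightarrow>
      s ''i'' 0 = int i \<Longrightarrow> s ''j'' 0 = int j \<Longrightarrow> aval ex s = F i j"
    and F: "\<And>i j. i < n \<Longrightarrow> j < n \<Longrightarrow> \<bar>F i j\<bar> \<le> e"
    and c: "\<And>s'. sbound L s' \<Longrightarrow> s' ''r'' 0 = int (flrank n (gramian n A F n) n) \<Longrightarrow>
      frame (insert ''E'' rank_vars) s0 s' \<Longrightarrow> ok n L c s' Q"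
  shows "ok n L (Seq (fill ''E'' Skip ex) (Seq rank_prog c)) s0 Q"
proof (rule ok_Seq)
  show "ok n L (fill ''E'' Skip ex) s0 (\<lambda>s'. arr n s' ''E'' F \<and> frame (insert ''E'' scratch) s0 s')"
    by (rule ok_fill_Skip) (use s ex env_n order_trans[OF F e_le] in auto)
  fix s1 assume s1: "sbound L s1" "arr n s1 ''E'' F \<and> frame (insert ''E'' scratch) s0 s1"
  have env1: "env s1" by (rule env_frame[OF s(2) conjunct2[OF s1(2)]]) auto
  show "ok n L (Seq rank_prog c) s1 Q"
  proof (rule ok_Seq)
    show "ok n L rank_prog s1 (\<lambda>s'. s' ''r'' 0 = int (flrank n (gramian n A F n) n) \<and> frame rank_vars s1 s')"
      by (rule ok_rank[where a = a and e = e, OF _ _ a0 _ refl wL]) (use A_bound F e2 s1 env1 in \<open>auto simp: env_def\<close>)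
    fix s2 assume s2: "sbound L s2" "s2 ''r'' 0 = int (flrank n (gramian n A F n) n) \<and> frame rank_vars s1 s2"
    show "ok n L c s2 Q"
      using s2 s1 by (intro c) (auto simp: frame_def)
  qed
qed

lemma ok_cand:
  assumes s: "sbound L s" "env s" "setrep n s X" "s ''h'' 0 = int h" "s ''m'' 0 = int mm"
    and h: "h < n" and X: "X \<subseteq> {..<n}"
  shows "ok n L cand_prog s (\<lambda>s'. frame ({''E'', ''S'', ''m'', ''q''} \<union> rank_vars) s s' \<and> setrep n s' X \<and>
    (if mm < \<rho> (insert h X) then s' ''m'' 0 = int (\<rho> (insert h X)) \<and> s' ''q'' 0 = int h
     else s' ''m'' 0 = int mm \<and> s' ''q'' 0 = s ''q'' 0))"
    (is "ok n L cand_prog s ?Q")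
  unfolding cand_prog_def
proof (rule ok_Seq)
  define v where "v i = (if i \<in> X then 1 else 0) + (if i = h then 1 else 0 :: int)" for i
  have vX: "{i. i < n \<and> 0 < v i} = insert h X" using h X by (auto simp: v_def split: if_splits)
  have L2: "(2::int) \<le> 2 ^ L" using e2 e_le by linarith
  let ?Q1 = "\<lambda>s'. frame {''S''} s s' \<and> (\<forall>i<n. s' ''S'' (int i) = v i)"
  show "ok n L (Store ''S'' (V ''h'') (Add (Read ''S'' (V ''h'')) (Num 1))) s ?Q1"
    using s h L2 by (intro ok_Store) (auto simp: frame_upd frame_refl setrep_def v_def)
  fix s1 assume s1: "sbound L s1" "?Q1 s1"
  have env1: "env s1" by (rule env_frame[OF s(2) conjunct1[OF s1(2)]]) auto
  show "ok n L (Seq (fill ''E'' Skip diag_expr) (Seq rank_prog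
    (Seq (Store ''S'' (V ''h'') (Sub (Read ''S'' (V ''h'')) (Num 1)))
      (Cond (Less (V ''m'') (V ''r'')) (Seq (assign ''m'' (V ''r'')) (assign ''q'' (V ''h''))) Skip)))) s1 ?Q"
  proof (rule ok_fill_rank[OF s1(1) env1, where F = "\<lambda>i j. if i = j then v i else 0"])
    fix i j s' assume *: "i < n" "j < n" "frame (insert ''E'' scratch) s1 s'"
      "s' ''i'' 0 = int i" "s' ''j'' 0 = int j"
    have "s' ''S'' = s1 ''S''" using frameD[OF *(3), of "''S''"] by simp
    then show "aval diag_expr s' = (if i = j then v i else 0)"
      using aval_delta[of s' i j, OF *(4,5)] *(1,4) s1(2) by (simp add: diag_expr_def)
  next
    fix i j show "\<bar>if i = j then v i else 0\<bar> \<le> e" using e2 by (simp add: v_def)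
  next
    fix s2 assume s2: "sbound L s2" "s2 ''r'' 0 = int (flrank n (gramian n A (\<lambda>i j. if i = j then v i else 0) n) n)"
      "frame (insert ''E'' rank_vars) s1 s2"
    have "flrank n (gramian n A (\<lambda>i j. if i = j then v i else 0) n) n = \<rho> {i. i < n \<and> 0 < v i}"
      by (rule flrank_diag) (auto simp: v_def)
    then have r2: "s2 ''r'' 0 = int (\<rho> (insert h X))" using s2(2) by (simp add: vX)
    have f2: "frame ({''E'', ''S'', ''m'', ''q''} \<union> rank_vars) s s2"
      using s1(2) s2(3) by (auto simp: frame_def)
    have S2: "\<forall>i<n. s2 ''S'' (int i) = v i" using frameD[OF s2(3), of "''S''"] s1(2) by simp
    have v2: "s2 ''h'' 0 = int h" "s2 ''m'' 0 = int mm" "s2 ''q'' = s ''q''"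
      using frameD[OF s2(3)] s1(2) s by (auto simp: frame_def)
    let ?Q3 = "\<lambda>s'. frame ({''E'', ''S'', ''m'', ''q''} \<union> rank_vars) s s' \<and> setrep n s' X \<and>
      s' ''r'' 0 = int (\<rho> (insert h X)) \<and> s' ''h'' 0 = int h \<and> s' ''m'' 0 = int mm \<and> s' ''q'' = s ''q''"
    show "ok n L (Seq (Store ''S'' (V ''h'') (Sub (Read ''S'' (V ''h'')) (Num 1)))
      (Cond (Less (V ''m'') (V ''r'')) (Seq (assign ''m'' (V ''r'')) (assign ''q'' (V ''h''))) Skip)) s2 ?Q"
    proof (rule ok_Seq)
      show "ok n L (Store ''S'' (V ''h'') (Sub (Read ''S'' (V ''h'')) (Num 1))) s2 ?Q3"
        using s2(1) f2 r2 v2 S2 h L2 by (intro ok_Store) (auto simp: frame_upd setrep_def v_def)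
      fix s3 assume s3: "sbound L s3" "?Q3 s3"
      have insX: "insert h X \<subseteq> {..<n}" using h X by auto
      have rL: "int (\<rho> (insert h X)) \<le> 2 ^ L" using krylov_rank_le[OF insX, of A] n_le by linarith
      show "ok n L (Cond (Less (V ''m'') (V ''r'')) (Seq (assign ''m'' (V ''r'')) (assign ''q'' (V ''h''))) Skip) s3 ?Q"
      proof (rule ok_Cond[OF s3(1)])
        assume "bval (Less (V ''m'') (V ''r'')) s3"
        then have lt: "mm < \<rho> (insert h X)" using s3(2) by simp
        let ?Q4 = "\<lambda>s'. frame ({''E'', ''S'', ''m'', ''q''} \<union> rank_vars) s s' \<and> setrep n s' X \<and>
          s' ''h'' 0 = int h \<and> s' ''m'' 0 = int (\<rho> (insert h X))"
        show "ok n L (Seq (assign ''m'' (V ''r'')) (assign ''q'' (V ''h''))) s3 ?Q"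
        proof (rule ok_Seq)
          show "ok n L (assign ''m'' (V ''r'')) s3 ?Q4"
            using s3 rL by (intro ok_assign) (auto simp: frame_upd setrep_def)
          fix s4 assume s4: "sbound L s4" "?Q4 s4"
          have "int h \<le> 2 ^ L" using n_le h by linarith
          then show "ok n L (assign ''q'' (V ''h'')) s4 ?Q"
            using s4 lt by (intro ok_assign) (auto simp: frame_upd setrep_def)
        qed
      next
        assume "\<not> bval (Less (V ''m'') (V ''r'')) s3"
        then have "\<not> mm < \<rho> (insert h X)" using s3(2) by simp
        then show "ok n L Skip s3 ?Q" using s3 by (intro ok_Skip) auto
      qed
    qed
  qed
qed

abbreviation greedy_vars :: "vname set" where
  "greedy_vars \<equiv> {''E'', ''S'', ''m'', ''q'', ''h'', ''g'', ''u''} \<union> rank_vars"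

lemma ok_greedy:
  assumes s0: "sbound L s0" "env s0" "setrep n s0 {}" "s0 ''u'' 0 = 0"
  shows "ok n L greedy_prog s0 (\<lambda>s'. frame greedy_vars s0 s' \<and> (\<exists>X. setrep n s' X \<and> greedy_inv n A n X))"
proof -
  define I where "I g s \<longleftrightarrow> frame greedy_vars s0 s \<and>
    (\<exists>X. setrep n s X \<and> s ''u'' 0 = int (\<rho> X) \<and> greedy_inv n A g X)" for g s
  have envI: "env s" if "frame greedy_vars s0 s" for s by (rule env_frame[OF s0(2) that]) auto
  have npos: "0 < n" using n1 by simp
  let ?sel = "Cond (Less (V ''u'') (V ''m'')) (Seq (Store ''S'' (V ''q'') (Num 1)) (assign ''u'' (V ''m''))) Skip"
  have "ok n L greedy_prog s0 (\<lambda>s'. I n s' \<and> s' ''g'' 0 = int n)"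
    unfolding greedy_prog_def
  proof (rule ok_For)
    show "n \<le> n * n" using n1 by simp
    have "fs.dim {} = 0" using fs.dim_le_card'[of "{}"] by simp
    then have "\<rho> {} = 0" by (simp add: krylov_rank_def)
    then show "I 0 s0" using s0 greedy_inv_0[OF npos, of A] by (auto simp: I_def frame_refl)
    show "I k (s(''g'' := z)) \<longleftrightarrow> I k s" for k s z by (simp add: I_def frame_upd setrep_def)
    show "aval (V ''n'') s = int n" if "I k s" for k s
      using env_n[OF envI] that by (simp add: I_def)
    fix g s assume g: "g < n" and s: "sbound L s" "I g s" "s ''g'' 0 = int g"
    obtain X where X: "setrep n s X" "s ''u'' 0 = int (\<rho> X)" "greedy_inv n A g X" and f: "frame greedy_vars s0 s"
      using s(2) by (auto simp: I_def)
    have Xn: "X \<subseteq> {..<n}" using X(3) by (simp add: greedy_inv_def)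
    \<comment> \<open>Maximum search: \<open>mm\<close> dominates all ranks tried and is attained at
      \<open>q\<close>. At \<open>mm = 0\<close> the cell \<open>q\<close> may be stale, which is
      harmless because an insertion happens only for \<open>mm\<close> above the current
      rank.\<close>
    define J where "J k s' \<longleftrightarrow> frame ({''E'', ''S'', ''m'', ''q'', ''h''} \<union> rank_vars) s s' \<and> setrep n s' X \<and>
      (\<exists>mm. s' ''m'' 0 = int mm \<and> (\<forall>i<k. \<rho> (insert i X) \<le> mm) \<and>
        (0 < mm \<longrightarrow> (\<exists>i<n. s' ''q'' 0 = int i \<and> mm = \<rho> (insert i X))))" for k s'
    have envJ: "env s'" if "J k s'" for k s'
      by (rule env_frame[OF envI[OF f], of "{''E'', ''S'', ''m'', ''q'', ''h''} \<union> rank_vars"])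
        (use that in \<open>auto simp: J_def\<close>)
    let ?R = "\<lambda>s'. s' ''g'' 0 = int g \<and> I (Suc g) s'"
    show "ok n L (Seq (assign ''m'' (Num 0)) (Seq (For ''h'' (V ''n'') cand_prog) ?sel)) s ?R"
    proof (rule ok_Seq[where ?Q1.0 = "J 0"])
      show "ok n L (assign ''m'' (Num 0)) s (J 0)"
        using s X by (intro ok_assign) (auto simp: J_def frame_upd frame_refl setrep_def)
      fix s1 assume s1: "sbound L s1" "J 0 s1"
      show "ok n L (Seq (For ''h'' (V ''n'') cand_prog) ?sel) s1 ?R"
      proof (rule ok_Seq)
        show "ok n L (For ''h'' (V ''n'') cand_prog) s1 (\<lambda>s'. J n s' \<and> s' ''h'' 0 = int n)"
        proof (rule ok_For)
          show "n \<le> n * n" using n1 by simp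
          show "J k (s(''h'' := z)) \<longleftrightarrow> J k s" for k s z by (simp add: J_def frame_upd setrep_def)
          show "aval (V ''n'') s = int n" if "J k s" for k s using env_n[OF envJ] that by simp
          fix h s2 assume h: "h < n" and s2: "sbound L s2" "J h s2" "s2 ''h'' 0 = int h"
          obtain mm where mm: "s2 ''m'' 0 = int mm" "\<forall>i<h. \<rho> (insert i X) \<le> mm"
            "0 < mm \<longrightarrow> (\<exists>i<n. s2 ''q'' 0 = int i \<and> mm = \<rho> (insert i X))" and S2: "setrep n s2 X"
            and f2: "frame ({''E'', ''S'', ''m'', ''q'', ''h''} \<union> rank_vars) s s2"
            using s2(2) by (auto simp: J_def)
          from ok_cand[OF s2(1) envJ[OF s2(2)] S2 s2(3) mm(1) h Xn]
          show "ok n L cand_prog s2 (\<lambda>s'. s' ''h'' 0 = int h \<and> J (Suc h) s')"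
          proof (rule ok_conseq)
            fix s' assume s': "frame ({''E'', ''S'', ''m'', ''q''} \<union> rank_vars) s2 s' \<and> setrep n s' X \<and>
              (if mm < \<rho> (insert h X) then s' ''m'' 0 = int (\<rho> (insert h X)) \<and> s' ''q'' 0 = int h
               else s' ''m'' 0 = int mm \<and> s' ''q'' 0 = s2 ''q'' 0)"
            have "frame ({''E'', ''S'', ''m'', ''q'', ''h''} \<union> rank_vars) s s'"
              using f2 conjunct1[OF s'] by (auto simp: frame_def)
            moreover have "s' ''h'' 0 = int h" using s2(3) frameD[OF conjunct1[OF s'], of "''h''"] by simp
            moreover have "\<exists>m'. s' ''m'' 0 = int m' \<and> (\<forall>i<Suc h. \<rho> (insert i X) \<le> m') \<and>
                (0 < m' \<longrightarrow> (\<exists>i<n. s' ''q'' 0 = int i \<and> m' = \<rho> (insert i X)))"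
            proof (cases "mm < \<rho> (insert h X)")
              case True
              then show ?thesis using s' mm h by (intro exI[of _ "\<rho> (insert h X)"]) (auto simp: less_Suc_eq)
            next
              case False
              then show ?thesis using s' mm h by (intro exI[of _ mm]) (auto simp: less_Suc_eq)
            qed
            ultimately show "s' ''h'' 0 = int h \<and> J (Suc h) s'" using s' by (simp add: J_def)
          qed
        qed (use s1 in auto)
        fix s2 assume s2: "sbound L s2" "J n s2 \<and> s2 ''h'' 0 = int n"
        obtain mm where mm: "s2 ''m'' 0 = int mm" "\<forall>i<n. \<rho> (insert i X) \<le> mm"
          "0 < mm \<longrightarrow> (\<exists>i<n. s2 ''q'' 0 = int i \<and> mm = \<rho> (insert i X))" and S2: "setrep n s2 X"
          and f2: "frame ({''E'', ''S'', ''m'', ''q'', ''h''} \<union> rank_vars) s s2"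
          using s2(2) by (auto simp: J_def)
        have u2: "s2 ''u'' 0 = int (\<rho> X)" and g2: "s2 ''g'' 0 = int g"
          using frameD[OF f2, of "''u''"] frameD[OF f2, of "''g''"] X(2) s(3) by auto
        have f02: "frame greedy_vars s0 s2" using f f2 by (auto simp: frame_def)
        have mm': "\<And>i. i < n \<Longrightarrow> \<rho> (insert i X) \<le> mm" using mm(2) by blast
        show "ok n L ?sel s2 ?R"
        proof (rule ok_Cond[OF s2(1)])
          assume "bval (Less (V ''u'') (V ''m'')) s2"
          then have lt: "\<rho> X < mm" using u2 mm(1) by simp
          then obtain i where i: "i < n" "s2 ''q'' 0 = int i" "mm = \<rho> (insert i X)" using mm(3) by auto
          have inv: "greedy_inv n A (Suc g) (insert i X)"
            by (rule greedy_inv_step(2)[OF npos X(3) mm' lt i(1,3)])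
          have iX: "insert i X \<subseteq> {..<n}" using i Xn by auto
          have mL: "int mm \<le> 2 ^ L" using krylov_rank_le[OF iX, of A] i(3) n_le by linarith
          let ?Q = "\<lambda>s'. frame greedy_vars s0 s' \<and> setrep n s' (insert i X) \<and> s' ''m'' 0 = int mm \<and> s' ''g'' 0 = int g"
          show "ok n L (Seq (Store ''S'' (V ''q'') (Num 1)) (assign ''u'' (V ''m''))) s2 ?R"
          proof (rule ok_Seq)
            show "ok n L (Store ''S'' (V ''q'') (Num 1)) s2 ?Q"
              using s2(1) f02 S2 i g2 mm(1) by (intro ok_Store) (auto simp: frame_upd setrep_def)
            fix s3 assume s3: "sbound L s3" "?Q s3"
            show "ok n L (assign ''u'' (V ''m'')) s3 ?R"
            proof (rule ok_assign[OF s3(1)])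
              show "\<bar>aval (V ''m'') s3\<bar> \<le> 2 ^ L" using s3 mL by simp
              have "setrep n (s3(''u'' := (s3 ''u'')(0 := int mm))) (insert i X)"
                using s3(2) by (simp add: setrep_def)
              then show "(s3(''u'' := (s3 ''u'')(0 := aval (V ''m'') s3))) ''g'' 0 = int g \<and>
                I (Suc g) (s3(''u'' := (s3 ''u'')(0 := aval (V ''m'') s3)))"
                using s3(2) inv i(3) by (auto simp: I_def frame_upd)
            qed
          qed
        next
          assume "\<not> bval (Less (V ''u'') (V ''m'')) s2"
          then have le: "mm \<le> \<rho> X" using u2 mm(1) by simp
          have "greedy_inv n A (Suc g) X" by (rule greedy_inv_step(1)[OF npos X(3) mm' le])
          then show "ok n L Skip s2 ?R"
            using s2(1) f02 S2 u2 g2 by (intro ok_Skip) (auto simp: I_def)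
        qed
      qed
    qed
  qed (use s0 in auto)
  then show ?thesis by (rule ok_conseq) (auto simp: I_def)
qed

end

section \<open>Correctness of the search for a controllable vector\<close>

definition moment :: "nat set \<Rightarrow> nat \<Rightarrow> nat \<Rightarrow> int" where
  "moment X t = (\<lambda>i. if i \<in> X then int t ^ i else 0)"

definition outrep :: "nat \<Rightarrow> state \<Rightarrow> (nat \<Rightarrow> int) \<Rightarrow> bool" where
  "outrep n s b \<longleftrightarrow> (\<forall>i<n. s ''outnum'' (int i) = b i \<and> s ''outden'' (int i) = 1)"

lemma (in bounded) nn_ge1: "1 \<le> int (n * n)"
proof -
  have "int 1 \<le> int (n * n)" using mult_le_mono[OF n1 n1] by (simp only: of_nat_le_iff mult_1)
  then show ?thesis by simp
qed

context alg
begin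

abbreviation good :: "nat set \<Rightarrow> nat \<Rightarrow> bool" where
  "good X t \<equiv> full n (\<lambda>i j. real_of_int (A i j)) {\<lambda>i. real_of_int (moment X t i)}"

lemma power_bound:
  assumes "t < n * n" "i \<le> n"
  shows "int t ^ i \<le> int (n * n) ^ n"
proof -
  have "int t \<le> int (n * n)" using assms(1) by (simp only: of_nat_le_iff)
  then have "int t ^ i \<le> int (n * n) ^ i" by (intro power_mono) auto
  also have "\<dots> \<le> int (n * n) ^ n" using assms(2) nn_ge1 by (intro power_increasing)
  finally show ?thesis .
qed

lemma nn_power: "1 \<le> int (n * n) ^ n" "int (n * n) ^ n \<le> e"
proof -
  show 1: "1 \<le> int (n * n) ^ n" using nn_ge1 by (rule one_le_power)
  have "int (n * n) ^ n * 1 \<le> int (n * n) ^ n * int (n * n) ^ n" using 1 by (intro mult_left_mono) auto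
  then show "int (n * n) ^ n \<le> e" using powers_e by linarith
qed

lemma ok_powers:
  assumes s0: "sbound L s0" "s0 ''n'' 0 = int n" "setrep n s0 X" "s0 ''t'' 0 = int t" and t: "t < n * n"
  shows "ok n L powers_prog s0 (\<lambda>s'. frame {''w'', ''h'', ''b''} s0 s' \<and> (\<forall>i<n. s' ''b'' (int i) = moment X t i))"
proof -
  define I where "I k s \<longleftrightarrow> frame {''w'', ''h'', ''b''} s0 s \<and> s ''w'' 0 = int t ^ k \<and>
    (\<forall>i<k. s ''b'' (int i) = moment X t i)" for k s
  have pres: "s ''n'' 0 = int n" "setrep n s X" "s ''t'' 0 = int t" if "frame {''w'', ''h'', ''b''} s0 s" for s
    using frameD[OF that, of "''n''"] frameD[OF that, of "''t''"] setrep_frame[OF s0(3) that] s0 by auto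
  \<comment> \<open>Exponent \<open>n\<close> is included because the power is multiplied once more
    after the last entry has been stored.\<close>
  have pL: "int t ^ i \<le> 2 ^ L" if "i \<le> n" for i
    using power_bound[OF t that] nn_power(2) e_le by linarith
  show ?thesis unfolding powers_prog_def
  proof (rule ok_Seq[where ?Q1.0 = "I 0"])
    show "ok n L (assign ''w'' (Num 1)) s0 (I 0)"
      using s0 by (intro ok_assign) (auto simp: I_def frame_upd frame_refl)
    fix s1 assume s1: "sbound L s1" "I 0 s1"
    let ?b = "Seq (Store ''b'' (V ''h'') (Mul (Read ''S'' (V ''h'')) (V ''w''))) (assign ''w'' (Mul (V ''w'') (V ''t'')))"
    have "ok n L (For ''h'' (V ''n'') ?b) s1 (\<lambda>s'. I n s' \<and> s' ''h'' 0 = int n)"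
    proof (rule ok_For)
      show "n \<le> n * n" using n1 by simp
      show "I k (s(''h'' := z)) \<longleftrightarrow> I k s" for k s z by (simp add: I_def frame_upd)
      show "aval (V ''n'') s = int n" if "I k s" for k s using pres(1) that by (simp add: I_def)
      fix k s assume k: "k < n" and s: "sbound L s" "I k s" "s ''h'' 0 = int k"
      have f: "frame {''w'', ''h'', ''b''} s0 s" using s(2) by (simp add: I_def)
      let ?Q = "\<lambda>s'. frame {''w'', ''h'', ''b''} s0 s' \<and> s' ''w'' 0 = int t ^ k \<and> s' ''h'' 0 = int k \<and>
        (\<forall>i<Suc k. s' ''b'' (int i) = moment X t i)"
      show "ok n L ?b s (\<lambda>s'. s' ''h'' 0 = int k \<and> I (Suc k) s')"
      proof (rule ok_Seq[where ?Q1.0 = ?Q])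
        have "aval (Mul (Read ''S'' (V ''h'')) (V ''w'')) s = moment X t k"
          using s pres(2)[OF f] k by (simp add: I_def setrep_def moment_def)
        then show "ok n L (Store ''b'' (V ''h'') (Mul (Read ''S'' (V ''h'')) (V ''w''))) s ?Q"
          using s f pL[of k] k by (intro ok_Store) (auto simp: I_def frame_upd less_Suc_eq moment_def)
        fix s2 assume s2: "sbound L s2" "?Q s2"
        have "aval (Mul (V ''w'') (V ''t'')) s2 = int t ^ Suc k"
          using s2 pres(3)[OF conjunct1[OF s2(2)]] by (simp add: mult.commute)
        moreover have "\<bar>int t ^ Suc k\<bar> \<le> 2 ^ L" using pL[of "Suc k"] k by simp
        ultimately show "ok n L (assign ''w'' (Mul (V ''w'') (V ''t''))) s2 (\<lambda>s'. s' ''h'' 0 = int k \<and> I (Suc k) s')"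
          using s2 by (intro ok_assign) (simp_all only:, auto simp: I_def frame_upd)
      qed
    qed (use s1 in auto)
    then show "ok n L (For ''h'' (V ''n'') ?b) s1
      (\<lambda>s'. frame {''w'', ''h'', ''b''} s0 s' \<and> (\<forall>i<n. s' ''b'' (int i) = moment X t i))"
      by (rule ok_conseq) (simp add: I_def)
  qed
qed

lemma ok_copy:
  assumes s0: "sbound L s0" "s0 ''n'' 0 = int n" "\<forall>i<n. s0 ''b'' (int i) = b i"
  shows "ok n L copy_prog s0 (\<lambda>s'. frame {''outnum'', ''outden'', ''h''} s0 s' \<and> outrep n s' b)"
proof -
  define I where "I k s \<longleftrightarrow> frame {''outnum'', ''outden'', ''h''} s0 s \<and> outrep k s b" for k s
  have "ok n L copy_prog s0 (\<lambda>s'. I n s' \<and> s' ''h'' 0 = int n)"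
    unfolding copy_prog_def
  proof (rule ok_For)
    show "n \<le> n * n" using n1 by simp
    show "I k (s(''h'' := z)) \<longleftrightarrow> I k s" for k s z by (simp add: I_def frame_upd outrep_def)
    show "aval (V ''n'') s = int n" if "I k s" for k s
      using that s0(2) by (auto simp: I_def frame_def)
    show "I 0 s0" by (simp add: I_def frame_refl outrep_def)
    fix k s assume k: "k < n" and s: "sbound L s" "I k s" "s ''h'' 0 = int k"
    have b: "s ''b'' (int k) = b k" using s s0(3) k by (auto simp: I_def frame_def)
    then have bL: "\<bar>b k\<bar> \<le> 2 ^ L" using s(1) by (metis sbound_def)
    let ?Q = "\<lambda>s'. I k s' \<and> s' ''h'' 0 = int k \<and> s' ''outnum'' (int k) = b k"
    show "ok n L (Seq (Store ''outnum'' (V ''h'') (Read ''b'' (V ''h''))) (Store ''outden'' (V ''h'') (Num 1))) s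
      (\<lambda>s'. s' ''h'' 0 = int k \<and> I (Suc k) s')"
    proof (rule ok_Seq[where ?Q1.0 = ?Q])
      show "ok n L (Store ''outnum'' (V ''h'') (Read ''b'' (V ''h''))) s ?Q"
        using s b bL by (intro ok_Store) (auto simp: I_def frame_upd outrep_def)
      fix s2 assume s2: "sbound L s2" "?Q s2"
      show "ok n L (Store ''outden'' (V ''h'') (Num 1)) s2 (\<lambda>s'. s' ''h'' 0 = int k \<and> I (Suc k) s')"
        using s2 by (intro ok_Store) (auto simp: I_def frame_upd outrep_def less_Suc_eq)
    qed
  qed (use s0 in auto)
  then show ?thesis by (rule ok_conseq) (simp add: I_def)
qed

abbreviation try_vars :: "vname set" where
  "try_vars \<equiv> {''w'', ''h'', ''b'', ''E'', ''outnum'', ''outden''} \<union> rank_vars"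

lemma ok_try:
  assumes s0: "sbound L s0" "env s0" "setrep n s0 X" "s0 ''t'' 0 = int t" and t: "t < n * n"
    and X: "X \<subseteq> {..<n}"
  shows "ok n L try_prog s0 (\<lambda>s'. frame try_vars s0 s' \<and>
    (if good X t then outrep n s' (moment X t)
     else s' ''outnum'' = s0 ''outnum'' \<and> s' ''outden'' = s0 ''outden''))" (is "ok n L try_prog s0 ?Q")
  unfolding try_prog_def
proof (rule ok_Seq[OF ok_powers[OF s0(1) env_n[OF s0(2)] s0(3,4) t]])
  fix s1 assume s1: "sbound L s1" "frame {''w'', ''h'', ''b''} s0 s1 \<and> (\<forall>i<n. s1 ''b'' (int i) = moment X t i)"
  have env1: "env s1" by (rule env_frame[OF s0(2) conjunct1[OF s1(2)]]) auto
  show "ok n L (Seq (fill ''E'' Skip (Mul (Read ''b'' (V ''i'')) (Read ''b'' (V ''j''))))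
     (Seq rank_prog (Cond (Less (V ''r'') (V ''n'')) Skip copy_prog))) s1 ?Q"
  proof (rule ok_fill_rank[OF s1(1) env1, where F = "\<lambda>i j. moment X t i * moment X t j"])
    fix i j s assume *: "i < n" "j < n" "frame (insert ''E'' scratch) s1 s" "s ''i'' 0 = int i" "s ''j'' 0 = int j"
    then show "aval (Mul (Read ''b'' (V ''i'')) (Read ''b'' (V ''j''))) s = moment X t i * moment X t j"
      using frameD[OF *(3), of "''b''"] s1(2) by simp
  next
    fix i j assume ij: "i < n" "j < n"
    have m: "\<bar>moment X t i\<bar> \<le> int (n * n) ^ n" if "i < n" for i
      using power_bound[OF t, of i] that nn_power(1) by (auto simp: moment_def)
    have "\<bar>moment X t i\<bar> * \<bar>moment X t j\<bar> \<le> int (n * n) ^ n * int (n * n) ^ n"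
      using m[OF ij(1)] m[OF ij(2)] nn_power(1) by (intro mult_mono) auto
    then show "\<bar>moment X t i * moment X t j\<bar> \<le> e" unfolding abs_mult using powers_e by (rule order_trans)
  next
    fix s2 assume s2: "sbound L s2"
      "s2 ''r'' 0 = int (flrank n (gramian n A (\<lambda>i j. moment X t i * moment X t j) n) n)"
      "frame (insert ''E'' rank_vars) s1 s2"
    have "moment X t \<in> nvecs n" using X by (auto simp: moment_def nvecs_def)
    then have eqv: "flrank n (gramian n A (\<lambda>i j. moment X t i * moment X t j) n) n = n \<longleftrightarrow> good X t"
      by (intro flrank_vec) auto
    have le: "flrank n (gramian n A (\<lambda>i j. moment X t i * moment X t j) n) n \<le> n"
      using flrank_spec by blast
    have f2: "frame try_vars s0 s2" using s1(2) s2(3) by (auto simp: frame_def)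
    have n2: "s2 ''n'' 0 = int n" using env_n[OF env_frame[OF s0(2) f2]] by simp
    have out2: "s2 ''outnum'' = s0 ''outnum''" "s2 ''outden'' = s0 ''outden''"
      using s1(2) s2(3) by (auto simp: frame_def)
    show "ok n L (Cond (Less (V ''r'') (V ''n'')) Skip copy_prog) s2 ?Q"
    proof (rule ok_Cond[OF s2(1)])
      assume "bval (Less (V ''r'') (V ''n'')) s2"
      then have "\<not> good X t" using s2(2) n2 eqv by auto
      then show "ok n L Skip s2 ?Q" using s2(1) f2 out2 by (intro ok_Skip) auto
    next
      assume "\<not> bval (Less (V ''r'') (V ''n'')) s2"
      then have g: "good X t" using s2(2) n2 eqv le by auto
      have "\<forall>i<n. s2 ''b'' (int i) = moment X t i" using frameD[OF s2(3), of "''b''"] s1(2) by simp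
      from ok_copy[OF s2(1) n2 this] show "ok n L copy_prog s2 ?Q"
        by (rule ok_conseq) (use f2 g in \<open>auto simp: frame_def\<close>)
    qed
  qed
qed

lemma ok_vec:
  assumes s0: "sbound L s0" "env s0" "setrep n s0 X" and X: "X \<subseteq> {..<n}"
  shows "ok n L vec_prog s0 (\<lambda>s'. (\<exists>t<n * n. good X t) \<longrightarrow> (\<exists>t. good X t \<and> outrep n s' (moment X t)))"
proof -
  define I where "I k s \<longleftrightarrow> frame (insert ''t'' try_vars) s0 s \<and>
    ((\<forall>t<k. \<not> good X t) \<or> (\<exists>t. good X t \<and> outrep n s (moment X t)))" for k s
  have envI: "env s" if "I k s" for k s
    by (rule env_frame[OF s0(2), of "insert ''t'' try_vars"]) (use that in \<open>auto simp: I_def\<close>)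
  have "ok n L vec_prog s0 (\<lambda>s'. I (n * n) s' \<and> s' ''t'' 0 = int (n * n))"
    unfolding vec_prog_def
  proof (rule ok_For)
    show "I 0 s0" by (simp add: I_def frame_refl)
    show "I k (s(''t'' := z)) \<longleftrightarrow> I k s" for k s z by (simp add: I_def frame_upd outrep_def)
    show "aval (Mul (V ''n'') (V ''n'')) s = int (n * n)" if "I k s" for k s
      using env_n[OF envI[OF that]] by simp
    fix k s assume k: "k < n * n" and s: "sbound L s" "I k s" "s ''t'' 0 = int k"
    have f: "frame (insert ''t'' try_vars) s0 s" using s(2) by (simp add: I_def)
    have "setrep n s X" by (rule setrep_frame[OF s0(3) f]) simp
    from ok_try[OF s(1) envI[OF s(2)] this s(3) k X]
    show "ok n L try_prog s (\<lambda>s'. s' ''t'' 0 = int k \<and> I (Suc k) s')"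
    proof (rule ok_conseq)
      fix s' assume s': "frame try_vars s s' \<and> (if good X k then outrep n s' (moment X k)
        else s' ''outnum'' = s ''outnum'' \<and> s' ''outden'' = s ''outden'')"
      have "frame (insert ''t'' try_vars) s0 s'" using f s' by (auto simp: frame_def)
      moreover have "s' ''t'' 0 = int k" using s(3) frameD[of try_vars s s' "''t''"] s' by simp
      moreover have "(\<forall>t<Suc k. \<not> good X t) \<or> (\<exists>t. good X t \<and> outrep n s' (moment X t))"
      proof (cases "good X k")
        case False
        then show ?thesis using s' s(2) by (auto simp: I_def less_Suc_eq outrep_def)
      qed (use s' in auto)
      ultimately show "s' ''t'' 0 = int k \<and> I (Suc k) s'" by (simp add: I_def)
    qed
  qed (use s0 in auto)
  then show ?thesis by (rule ok_conseq) (auto simp: I_def)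
qed

end

section \<open>Preparation of the input and output of a diagonal matrix\<close>

context bounded
begin

lemma ok_prep:
  fixes nm dn :: "nat \<Rightarrow> int"
  defines "D \<equiv> \<Prod>p<n * n. dn p"
  defines "A \<equiv> \<lambda>i j. nm (i * n + j) * (D div dn (i * n + j))"
  assumes s0: "sbound L s0" "s0 ''n'' 0 = int n"
    and nm: "\<And>p. p < n * n \<Longrightarrow> s0 ''num'' (int p) = nm p"
    and dn: "\<And>p. p < n * n \<Longrightarrow> s0 ''den'' (int p) = dn p" "\<And>p. 1 \<le> dn p"
    and DL: "D \<le> 2 ^ L" and AL: "\<And>i j. i < n \<Longrightarrow> j < n \<Longrightarrow> \<bar>A i j\<bar> \<le> 2 ^ L"
  shows "ok n L prep_prog s0 (\<lambda>s'. arr n s' ''A'' A \<and> arr n s' ''B'' (\<lambda>i j. A j i) \<and>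
    frame ({''d'', ''A'', ''B''} \<union> scratch) s0 s')"
proof -
  define I where "I k s \<longleftrightarrow> frame ({''d''} \<union> scratch) s0 s \<and> s ''d'' 0 = (\<Prod>p<k. dn p)" for k s
  \<comment> \<open>All denominators are at least 1, so each partial product is bounded by the full
    one.\<close>
  have part: "(\<Prod>p<k. dn p) \<le> D" "0 \<le> (\<Prod>p<k. dn p)" if "k \<le> n * n" for k
  proof -
    have pos: "1 \<le> (\<Prod>p\<in>Y. dn p)" for Y using dn(2) by (intro prod_ge_1) auto
    have "D = (\<Prod>p<k. dn p) * (\<Prod>p\<in>{..<n*n} - {..<k}. dn p)"
      unfolding D_def using that by (subst prod.subset_diff[of "{..<k}"]) (auto simp: mult.commute)
    moreover have "(\<Prod>p<k. dn p) * 1 \<le> (\<Prod>p<k. dn p) * (\<Prod>p\<in>{..<n*n} - {..<k}. dn p)"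
      by (intro mult_left_mono pos order_trans[OF zero_le_one pos])
    ultimately show "(\<Prod>p<k. dn p) \<le> D" by simp
    show "0 \<le> (\<Prod>p<k. dn p)" using pos[of "{..<k}"] by linarith
  qed
  let ?dl = "For ''p'' (Mul (V ''n'') (V ''n'')) (assign ''d'' (Mul (V ''d'') (Read ''den'' (V ''p''))))"
  let ?fA = "fill ''A'' Skip (Mul (Read ''num'' (V ''p'')) (Quo (V ''d'') (Read ''den'' (V ''p''))))"
  let ?fB = "fill ''B'' Skip (Read ''A'' (Add (Mul (V ''j'') (V ''n'')) (V ''i'')))"
  let ?Q = "\<lambda>s'. arr n s' ''A'' A \<and> arr n s' ''B'' (\<lambda>i j. A j i) \<and> frame ({''d'', ''A'', ''B''} \<union> scratch) s0 s'"
  show ?thesis unfolding prep_prog_def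
  proof (rule ok_Seq[where ?Q1.0 = "I 0"])
    show "ok n L (assign ''d'' (Num 1)) s0 (I 0)"
      using s0 by (intro ok_assign) (auto simp: I_def frame_upd frame_refl)
    fix s1 assume s1: "sbound L s1" "I 0 s1"
    show "ok n L (Seq ?dl (Seq ?fA ?fB)) s1 ?Q"
    proof (rule ok_Seq)
      show "ok n L ?dl s1 (\<lambda>s'. I (n * n) s' \<and> s' ''p'' 0 = int (n * n))"
      proof (rule ok_For)
        show "I k (s(''p'' := z)) \<longleftrightarrow> I k s" for k s z by (simp add: I_def frame_upd)
        show "aval (Mul (V ''n'') (V ''n'')) s = int (n * n)" if "I k s" for k s
          using that s0(2) by (auto simp: I_def frame_def)
        fix k s assume k: "k < n * n" and s: "sbound L s" "I k s" "s ''p'' 0 = int k"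
        have "s ''den'' = s0 ''den''" using s(2) by (auto simp: I_def frame_def)
        then have "aval (Mul (V ''d'') (Read ''den'' (V ''p''))) s = (\<Prod>p<Suc k. dn p)"
          using s dn(1)[OF k] by (simp add: I_def)
        then show "ok n L (assign ''d'' (Mul (V ''d'') (Read ''den'' (V ''p'')))) s
          (\<lambda>s'. s' ''p'' 0 = int k \<and> I (Suc k) s')"
          using s part[of "Suc k"] k DL by (intro ok_assign) (auto simp: I_def frame_upd simp del: prod.lessThan_Suc)
      qed (use s1 in auto)
      fix s2 assume s2: "sbound L s2" "I (n * n) s2 \<and> s2 ''p'' 0 = int (n * n)"
      have f2: "frame ({''d''} \<union> scratch) s0 s2" and d2: "s2 ''d'' 0 = D" using s2(2) by (auto simp: I_def D_def)
      have n2: "s2 ''n'' 0 = int n" using frameD[OF f2, of "''n''"] s0(2) by simp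
      show "ok n L (Seq ?fA ?fB) s2 ?Q"
      proof (rule ok_Seq)
        show "ok n L ?fA s2 (\<lambda>s'. arr n s' ''A'' A \<and> frame (insert ''A'' scratch) s2 s')"
        proof (rule ok_fill_Skip[OF s2(1) n2])
          fix i j s assume *: "i < n" "j < n" "frame (insert ''A'' scratch) s2 s" "s ''p'' 0 = int (i * n + j)"
          have "s ''num'' = s0 ''num''" "s ''den'' = s0 ''den''" "s ''d'' = s2 ''d''"
            using *(3) f2 by (auto simp: frame_def)
          then show "aval (Mul (Read ''num'' (V ''p'')) (Quo (V ''d'') (Read ''den'' (V ''p'')))) s = A i j"
            using *(4) d2 nm[OF index_less[OF *(1,2)]] dn(1)[OF index_less[OF *(1,2)]] by (simp add: A_def)
        qed (use AL in auto)
        fix s3 assume s3: "sbound L s3" "arr n s3 ''A'' A \<and> frame (insert ''A'' scratch) s2 s3"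
        have n3: "s3 ''n'' 0 = int n" using s3(2) n2 by (auto simp: frame_def)
        have "ok n L ?fB s3 (\<lambda>s'. arr n s' ''B'' (\<lambda>i j. A j i) \<and> frame (insert ''B'' scratch) s3 s')"
        proof (rule ok_fill_Skip[OF s3(1) n3])
          fix i j s assume *: "i < n" "j < n" "frame (insert ''B'' scratch) s3 s" "s ''i'' 0 = int i" "s ''j'' 0 = int j"
          have "s ''A'' = s3 ''A''" "s ''n'' 0 = int n" using *(3) n3 by (auto simp: frame_def)
          then show "aval (Read ''A'' (Add (Mul (V ''j'') (V ''n'')) (V ''i''))) s = A j i"
            using *(4,5) arrD[OF conjunct1[OF s3(2)] *(2,1)] by simp
        qed (use AL in auto)
        then show "ok n L ?fB s3 ?Q"
          by (rule ok_conseq) (use s3 f2 in \<open>auto simp: frame_def arr_def\<close>)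
      qed
    qed
  qed
qed

lemma ok_const_diag:
  assumes s0: "sbound L s0" "s0 ''n'' 0 = int n" "setrep n s0 X"
  shows "ok n L (Seq (fill ''outnum'' Skip diag_expr) (fill ''outden'' Skip (Num 1))) s0
    (\<lambda>s'. arr n s' ''outnum'' (\<lambda>i j. if i = j \<and> i \<in> X then 1 else 0) \<and> arr n s' ''outden'' (\<lambda>i j. 1))"
proof (rule ok_Seq)
  show "ok n L (fill ''outnum'' Skip diag_expr) s0 (\<lambda>s'. arr n s' ''outnum'' (\<lambda>i j. if i = j \<and> i \<in> X then 1 else 0) \<and>
      frame (insert ''outnum'' scratch) s0 s')"
  proof (rule ok_fill_Skip[OF s0(1,2)])
    fix i j s assume *: "i < n" "j < n" "frame (insert ''outnum'' scratch) s0 s" "s ''i'' 0 = int i" "s ''j'' 0 = int j"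
    have "s ''S'' = s0 ''S''" using *(3) by (auto simp: frame_def)
    then show "aval diag_expr s = (if i = j \<and> i \<in> X then 1 else 0)"
      using aval_delta[of s i j, OF *(4,5)] *(1,4) s0(3) by (simp add: diag_expr_def setrep_def)
  qed auto
  fix s1 assume s1: "sbound L s1" "arr n s1 ''outnum'' (\<lambda>i j. if i = j \<and> i \<in> X then 1 else 0) \<and>
      frame (insert ''outnum'' scratch) s0 s1"
  have "s1 ''n'' 0 = int n" using s1(2) s0(2) by (auto simp: frame_def)
  then have "ok n L (fill ''outden'' Skip (Num 1)) s1 (\<lambda>s'. arr n s' ''outden'' (\<lambda>i j. 1) \<and> frame (insert ''outden'' scratch) s1 s')"
    using s1(1) by (intro ok_fill_Skip) auto
  then show "ok n L (fill ''outden'' Skip (Num 1)) s1 (\<lambda>s'. arr n s' ''outnum'' (\<lambda>i j. if i = j \<and> i \<in> X then 1 else 0) \<and>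
      arr n s' ''outden'' (\<lambda>i j. 1))"
    by (rule ok_conseq) (use s1 in \<open>auto simp: frame_def arr_def\<close>)
qed

end

section \<open>Input, output and size bounds\<close>

lemma quotient_of_of_int: "quotient_of (of_int k) = (k, 1)"
  by (simp add: of_int_rat quotient_of_Fract Rat.normalize_def)

lemma sum_square_index:
  "(\<Sum>p<n * n. f (p div n) (p mod n)) = (\<Sum>i<n. \<Sum>j<n. f i j)"
  for f :: "nat \<Rightarrow> nat \<Rightarrow> nat"
proof (cases "n = 0")
  case False
  then have npos: "0 < n" by simp
  have "(\<Sum>p<n * n. f (p div n) (p mod n)) = (\<Sum>(i,j)\<in>{..<n} \<times> {..<n}. f i j)"
    by (rule sum.reindex_bij_witness[where i = "\<lambda>(i,j). i * n + j" and j = "\<lambda>p. (p div n, p mod n)"])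
      (use npos in \<open>auto simp: less_mult_imp_div_less index_less\<close>)
  then show ?thesis by (simp add: sum.cartesian_product)
qed simp

definition num_at :: "rat mat \<Rightarrow> nat \<Rightarrow> int" where
  "num_at A p = fst (quotient_of (A $$ (p div dim_row A, p mod dim_row A)))"

definition den_at :: "rat mat \<Rightarrow> nat \<Rightarrow> int" where
  "den_at A p = snd (quotient_of (A $$ (p div dim_row A, p mod dim_row A)))"

text \<open>Multiplying by the product of all denominators gives an integer matrix with the same
  controllable pairs.\<close>

definition cleared :: "rat mat \<Rightarrow> nat \<Rightarrow> nat \<Rightarrow> int" where
  "cleared A = (\<lambda>i j. num_at A (i * dim_row A + j) *
     ((\<Prod>p<dim_row A * dim_row A. den_at A p) div den_at A (i * dim_row A + j)))"

text \<open>The exponent of \<open>size_bound\<close>, where \<open>m\<close> stands for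
  \<open>n\<close> plus the input length: \<open>1 + 2 m\<close> bits for \<open>2 n^2\<close>,
  \<open>(6 m + 1) m\<close> for the growth of the Gramian and \<open>1 + 4 m^2\<close> for the
  bound on \<open>E\<close>, multiplied by \<open>n <= m\<close> because the coefficient recursion
  takes an \<open>n\<close>-th power.\<close>

definition bit_bound :: "nat \<Rightarrow> nat" where
  "bit_bound m = m * (2 + 3 * m + 10 * (m * m))"

lemma den_at_pos: "1 \<le> den_at A p"
  using quotient_of_denom_pos'[of "A $$ (p div dim_row A, p mod dim_row A)"] by (simp add: den_at_def)

lemma prod_den_le: "(\<Prod>p<m. den_at A p) \<le> 2 ^ (\<Sum>p<m. int_bits (den_at A p))"
proof (induction m)
  case (Suc m)
  have "(\<Prod>p<m. den_at A p) * den_at A m \<le> 2 ^ (\<Sum>p<m. int_bits (den_at A p)) * 2 ^ int_bits (den_at A m)"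
    using Suc abs_le_int_bits[of "den_at A m"] den_at_pos[of A m] by (intro mult_mono) auto
  then show ?case by (simp add: power_add)
qed simp

lemma input_bits_eq:
  assumes "A \<in> carrier_mat n n"
  shows "input_bits A = (\<Sum>p<n * n. int_bits (num_at A p) + int_bits (den_at A p))"
  using assms sum_square_index[of "\<lambda>i j. int_bits (fst (quotient_of (A $$ (i, j)))) + int_bits (snd (quotient_of (A $$ (i, j))))" n]
  by (simp add: input_bits_def num_at_def den_at_def)

lemma power2_mono: "x \<le> 2 ^ i \<Longrightarrow> i \<le> j \<Longrightarrow> x \<le> (2::int) ^ j"
  by (meson order_trans power_increasing one_le_numeral)

lemma size_bound:
  assumes n: "1 \<le> n" and m: "m = n + k"
  shows "(2 * int n * int n * (((int n * 2 ^ (2 * k)) * (int n * 2 ^ (2 * k)) + 1) ^ n * (2 * int (n * n) ^ (2 * n)))) ^ n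
    \<le> 2 ^ bit_bound m"
proof -
  have nm: "n \<le> m" by (simp add: m)
  have N: "int n \<le> 2 ^ m"
  proof -
    have "int n \<le> 2 ^ n" by (rule less_imp_le[OF of_nat_less_two_power])
    then show ?thesis by (rule power2_mono) (simp add: m)
  qed
  have na: "int n * 2 ^ (2 * k) \<le> 2 ^ (3 * m)"
  proof -
    have "int n * 2 ^ (2 * k) \<le> 2 ^ m * 2 ^ (2 * k)" using N by (intro mult_right_mono) auto
    also have "\<dots> = 2 ^ (m + 2 * k)" by (simp add: power_add)
    finally show ?thesis by (rule power2_mono) (simp add: m)
  qed
  define q where "q = (int n * 2 ^ (2 * k)) * (int n * 2 ^ (2 * k)) + 1"
  have "(int n * 2 ^ (2 * k)) * (int n * 2 ^ (2 * k)) \<le> 2 ^ (3 * m) * 2 ^ (3 * m)"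
    using na by (intro mult_mono) auto
  also have "\<dots> = 2 ^ (6 * m)" by (simp add: power_add[symmetric])
  finally have "q \<le> 2 ^ (6 * m) + 1" by (simp add: q_def)
  also have "\<dots> \<le> 2 ^ (6 * m + 1)" by simp
  finally have q: "q \<le> 2 ^ (6 * m + 1)" .
  have q0: "0 \<le> q" by (simp add: q_def)
  have "q ^ n \<le> (2 ^ (6 * m + 1)) ^ n" using q q0 by (rule power_mono)
  also have "\<dots> = 2 ^ ((6 * m + 1) * n)" by (simp only: power_mult)
  finally have qn: "q ^ n \<le> 2 ^ ((6 * m + 1) * m)" by (rule power2_mono) (rule mult_le_mono2[OF nm])
  have "int (n * n) \<le> 2 ^ m * 2 ^ m" using N by (simp only: of_nat_mult) (intro mult_mono, auto)
  then have "int (n * n) \<le> 2 ^ (2 * m)" by (simp only: power_add[symmetric] mult_2)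
  then have "int (n * n) ^ (2 * n) \<le> (2 ^ (2 * m)) ^ (2 * n)" by (intro power_mono) auto
  also have "\<dots> = 2 ^ (2 * m * (2 * n))" by (simp only: power_mult)
  finally have "int (n * n) ^ (2 * n) \<le> 2 ^ (4 * (m * m))"
    by (rule power2_mono) (use mult_le_mono2[OF nm, of "4 * m"] in \<open>simp add: ac_simps\<close>)
  then have e: "2 * int (n * n) ^ (2 * n) \<le> 2 ^ (1 + 4 * (m * m))" by simp
  have "q ^ n * (2 * int (n * n) ^ (2 * n)) \<le> 2 ^ ((6 * m + 1) * m) * 2 ^ (1 + 4 * (m * m))"
    using qn e by (intro mult_mono) auto
  then have w: "q ^ n * (2 * int (n * n) ^ (2 * n)) \<le> 2 ^ ((6 * m + 1) * m + (1 + 4 * (m * m)))"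
    by (simp only: power_add)
  have nn: "2 * int n * int n \<le> 2 ^ (1 + m + m)"
  proof -
    have "int n * int n \<le> 2 ^ m * 2 ^ m" using N by (intro mult_mono) auto
    then show ?thesis by (simp add: power_add)
  qed
  have w0: "0 \<le> q ^ n * (2 * int (n * n) ^ (2 * n))" using q0 by simp
  have "2 * int n * int n * (q ^ n * (2 * int (n * n) ^ (2 * n)))
      \<le> 2 ^ (1 + m + m) * 2 ^ ((6 * m + 1) * m + (1 + 4 * (m * m)))"
    using nn w w0 by (intro mult_mono) auto
  also have "\<dots> = 2 ^ (1 + m + m + ((6 * m + 1) * m + (1 + 4 * (m * m))))" by (simp only: power_add)
  also have "1 + m + m + ((6 * m + 1) * m + (1 + 4 * (m * m))) = 2 + 3 * m + 10 * (m * m)"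
    by (simp add: algebra_simps)
  finally have Y: "2 * int n * int n * (q ^ n * (2 * int (n * n) ^ (2 * n))) \<le> 2 ^ (2 + 3 * m + 10 * (m * m))" .
  have "(2 * int n * int n * (q ^ n * (2 * int (n * n) ^ (2 * n)))) ^ n \<le> (2 ^ (2 + 3 * m + 10 * (m * m))) ^ n"
    using Y w0 by (intro power_mono) auto
  also have "\<dots> = 2 ^ ((2 + 3 * m + 10 * (m * m)) * n)" by (simp only: power_mult)
  finally have "(2 * int n * int n * (q ^ n * (2 * int (n * n) ^ (2 * n)))) ^ n \<le> 2 ^ bit_bound m"
    by (rule power2_mono) (use mult_le_mono2[OF nm, of "2 + 3 * m + 10 * (m * m)"] in \<open>simp add: bit_bound_def mult.commute\<close>)
  then show ?thesis by (simp only: q_def)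
qed

lemma ok_prep_input:
  assumes A: "A \<in> carrier_mat n n" and n: "1 \<le> n"
  defines "k \<equiv> input_bits A"
  defines "L \<equiv> bit_bound (n + k)"
  shows "alg n L (cleared A) (2 ^ (2 * k)) (2 * int (n * n) ^ (2 * n))"
    and "ok n L prep_prog (input_state A) (\<lambda>s'. arr n s' ''A'' (cleared A) \<and>
      arr n s' ''B'' (\<lambda>i j. cleared A j i) \<and> frame ({''d'', ''A'', ''B''} \<union> scratch) (input_state A) s')"
    and "sbound L (input_state A)"
proof -
  have dim: "dim_row A = n" using A by simp
  define D where "D = (\<Prod>p<n * n. den_at A p)"
  have bits: "int_bits (num_at A p) \<le> k" "int_bits (den_at A p) \<le> k" if "p < n * n" for p
  proof -
    have "int_bits (num_at A p) + int_bits (den_at A p) \<le> k"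
      unfolding k_def input_bits_eq[OF A]
      by (rule member_le_sum[of p "{..<n * n}" "\<lambda>p. int_bits (num_at A p) + int_bits (den_at A p)"]) (use that in auto)
    then show "int_bits (num_at A p) \<le> k" "int_bits (den_at A p) \<le> k" by auto
  qed
  have num: "\<bar>num_at A p\<bar> \<le> 2 ^ k" and den: "\<bar>den_at A p\<bar> \<le> 2 ^ k" if "p < n * n" for p
    using power2_mono[OF abs_le_int_bits bits(1)[OF that]] power2_mono[OF abs_le_int_bits bits(2)[OF that]] by auto
  have D: "D \<le> 2 ^ k" unfolding D_def
    by (rule power2_mono[OF prod_den_le]) (auto simp: k_def input_bits_eq[OF A] intro!: sum_mono)
  have D0: "0 \<le> D" unfolding D_def using den_at_pos by (intro prod_nonneg) (metis order_trans zero_le_one)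
  \<comment> \<open>A numerator and the product of all denominators are each at most
    \<open>2^k\<close>, whence the exponent \<open>2 * k\<close>.\<close>
  have cl: "\<bar>cleared A i j\<bar> \<le> 2 ^ (2 * k)" if "i < n" "j < n" for i j
  proof -
    have "\<bar>D div den_at A (i * n + j)\<bar> \<le> 2 ^ k"
      using abs_div_le[of D "den_at A (i * n + j)"] D D0 by linarith
    then have "\<bar>num_at A (i * n + j)\<bar> * \<bar>D div den_at A (i * n + j)\<bar> \<le> 2 ^ k * 2 ^ k"
      using num[OF index_less[OF that]] by (intro mult_mono) auto
    then show ?thesis by (simp add: cleared_def dim D_def abs_mult mult_2 power_add)
  qed
  have ge: "n + k \<le> L"
  proof -
    have "(n + k) * 1 \<le> (n + k) * (2 + 3 * (n + k) + 10 * ((n + k) * (n + k)))" by (intro mult_le_mono2) simp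
    then show ?thesis by (simp add: L_def bit_bound_def)
  qed
  have ge2: "2 * (n + k) \<le> L"
  proof -
    have "(n + k) * 2 \<le> (n + k) * (2 + 3 * (n + k) + 10 * ((n + k) * (n + k)))" by (intro mult_le_mono2) simp
    then show ?thesis by (simp add: L_def bit_bound_def)
  qed
  have n2: "int n \<le> 2 ^ n" by (rule less_imp_le[OF of_nat_less_two_power])
  have nnL: "int (n * n) \<le> 2 ^ L"
  proof -
    have "int n * int n \<le> 2 ^ n * 2 ^ n" using n2 by (intro mult_mono) auto
    then have "int (n * n) \<le> 2 ^ (n + n)" by (simp add: power_add)
    then show ?thesis by (rule power2_mono) (use ge2 in simp)
  qed
  have bnd: "bounded n L" using n ge nnL by unfold_locales auto
  have nn1: "1 \<le> int (n * n)" by (rule bounded.nn_ge1[OF bnd])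
  show alg: "alg n L (cleared A) (2 ^ (2 * k)) (2 * int (n * n) ^ (2 * n))"
  proof (intro alg.intro[OF bnd] alg_axioms.intro)
    show "2 \<le> 2 * int (n * n) ^ (2 * n)" using one_le_power[OF nn1, of "2 * n"] by simp
    have "int (n * n) ^ n * int (n * n) ^ n = int (n * n) ^ (2 * n)" by (simp only: power_add[symmetric] mult_2)
    then show "int (n * n) ^ n * int (n * n) ^ n \<le> 2 * int (n * n) ^ (2 * n)"
      using one_le_power[OF nn1, of "2 * n"] by linarith
    show "(2 * int n * int n * ((int n * 2 ^ (2 * k) * (int n * 2 ^ (2 * k)) + 1) ^ n * (2 * int (n * n) ^ (2 * n)))) ^ n \<le> 2 ^ L"
      unfolding L_def by (rule size_bound[OF n refl])
  qed (use cl in auto)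
  have kL: "x \<le> 2 ^ k \<Longrightarrow> x \<le> 2 ^ L" for x :: int by (erule power2_mono) (use ge in simp)
  have st: "input_state A ''n'' 0 = int n" by (simp add: input_state_def dim)
  have stn: "input_state A ''num'' (int p) = num_at A p" "input_state A ''den'' (int p) = den_at A p" if "p < n * n" for p
    using that by (simp_all add: input_state_def dim num_at_def den_at_def Let_def flip: of_nat_mult)
  show sbound: "sbound L (input_state A)"
    unfolding sbound_def
  proof (intro allI)
    fix x z
    have "input_state A x z = 0 \<or> (x = ''n'' \<and> z = 0) \<or> ((x = ''num'' \<or> x = ''den'') \<and> (\<exists>p<n * n. z = int p))"
    proof (cases "0 \<le> z \<and> z < int (n * n)")
      case True
      then have "z = int (nat z)" "nat z < n * n" by (auto simp: nat_less_iff simp del: of_nat_mult)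
      then have "\<exists>p<n * n. z = int p" by blast
      then show ?thesis by (auto simp: input_state_def dim Let_def)
    next
      case False
      then show ?thesis by (auto simp: input_state_def dim Let_def simp del: of_nat_mult)
    qed
    then consider "x = ''n'' \<and> z = 0" | p where "x = ''num''" "z = int p" "p < n * n"
      | p where "x = ''den''" "z = int p" "p < n * n" | "input_state A x z = 0" by blast
    then show "\<bar>input_state A x z\<bar> \<le> 2 ^ L"
    proof cases
      case 1
      have "int n \<le> 2 ^ L" by (rule power2_mono[OF n2]) (use ge in simp)
      then show ?thesis using 1 st by simp
    qed (use stn num den kL in auto)
  qed
  interpret bounded n L by (rule bnd)
  have "ok n L prep_prog (input_state A) (\<lambda>s'.
      arr n s' ''A'' (\<lambda>i j. num_at A (i * n + j) * ((\<Prod>p<n * n. den_at A p) div den_at A (i * n + j))) \<and>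
      arr n s' ''B'' (\<lambda>i j. num_at A (j * n + i) * ((\<Prod>p<n * n. den_at A p) div den_at A (j * n + i))) \<and>
      frame ({''d'', ''A'', ''B''} \<union> scratch) (input_state A) s')"
  proof (rule ok_prep[OF sbound st stn den_at_pos])
    show "(\<Prod>p<n * n. den_at A p) \<le> 2 ^ L" using kL[OF D] by (simp add: D_def)
    fix i j assume "i < n" "j < n"
    then have "\<bar>cleared A i j\<bar> \<le> 2 ^ L" by (intro power2_mono[OF cl]) (use ge2 in auto)
    then show "\<bar>num_at A (i * n + j) * ((\<Prod>p<n * n. den_at A p) div den_at A (i * n + j))\<bar> \<le> 2 ^ L"
      by (simp add: cleared_def dim)
  qed
  then show "ok n L prep_prog (input_state A) (\<lambda>s'. arr n s' ''A'' (cleared A) \<and>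
      arr n s' ''B'' (\<lambda>i j. cleared A j i) \<and> frame ({''d'', ''A'', ''B''} \<union> scratch) (input_state A) s')"
    by (simp add: cleared_def dim)
qed

section \<open>Setup phase and uniform polynomial running time\<close>

definition setup_prog :: com where
  "setup_prog = Seq prep_prog greedy_prog"

lemma ok_setup:
  assumes A: "A \<in> carrier_mat n n" and n: "1 \<le> n"
  defines "L \<equiv> bit_bound (n + input_bits A)"
  shows "ok n L setup_prog (input_state A) (\<lambda>s'. alg.env n (cleared A) s' \<and>
    (\<exists>X. setrep n s' X \<and> greedy_inv n (cleared A) n X))"
proof -
  note prep = ok_prep_input[OF A n, folded L_def]
  interpret alg n L "cleared A" "2 ^ (2 * input_bits A)" "2 * int (n * n) ^ (2 * n)" by (rule prep(1))
  have dim: "dim_row A = n" using A by simp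
  show ?thesis unfolding setup_prog_def
  proof (rule ok_Seq[OF prep(2)])
    fix s1 assume s1: "sbound L s1" "arr n s1 ''A'' (cleared A) \<and> arr n s1 ''B'' (\<lambda>i j. cleared A j i) \<and>
      frame ({''d'', ''A'', ''B''} \<union> scratch) (input_state A) s1"
    then have f: "s1 ''n'' = input_state A ''n''" "s1 ''S'' = input_state A ''S''" "s1 ''u'' = input_state A ''u''"
      by (auto simp: frame_def)
    have env1: "env s1" using s1 f by (simp add: env_def input_state_def dim)
    have "setrep n s1 {}" "s1 ''u'' 0 = 0" using f by (simp_all add: setrep_def input_state_def Let_def)
    from ok_greedy[OF s1(1) env1 this]
    show "ok n L greedy_prog s1 (\<lambda>s'. env s' \<and> (\<exists>X. setrep n s' X \<and> greedy_inv n (cleared A) n X))"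
    proof (rule ok_conseq)
      fix s' assume s': "frame greedy_vars s1 s' \<and> (\<exists>X. setrep n s' X \<and> greedy_inv n (cleared A) n X)"
      have "env s'" by (rule env_frame[OF env1 conjunct1[OF s']]) auto
      then show "env s' \<and> (\<exists>X. setrep n s' X \<and> greedy_inv n (cleared A) n X)" using s' by blast
    qed
  qed
qed

lemma poly_nat_mono:
  assumes "a \<le> b"
  shows "poly (p :: nat poly) a \<le> poly p b"
proof (induction p)
  case (pCons c p)
  then show ?case using mult_le_mono[OF assms pCons(2)] by simp
qed simp

text \<open>The polynomial precedes the input and the postcondition, which is possible because the
  budget depends on the program text and \<open>n\<close> alone. The factor
  \<open>[:1, 2, 3, 10:]\<close> is \<open>bit_bound\<close> plus 1, the unit of the budget.\<close>

lemma ok_poly_time: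
  "\<exists>p :: nat poly. \<forall>n k s Q. ok n (bit_bound (n + k)) c s Q \<longrightarrow>
    (\<exists>t s'. run c s t s' \<and> t \<le> poly p (n + k) \<and> Q s')"
proof -
  obtain q :: "nat poly" where q: "\<And>n. budget (n * n) c \<le> poly q n" using budget_poly by blast
  show ?thesis
  proof (intro exI[of _ "q * [:1, 2, 3, 10:]"] allI impI)
    fix n k s Q assume "ok n (bit_bound (n + k)) c s Q"
    then obtain t s' where t: "run c s t s'" "t \<le> budget (n * n) c * (bit_bound (n + k) + 1)" "Q s'"
      unfolding ok_def by blast
    have "budget (n * n) c \<le> poly q (n + k)" using q[of n] poly_nat_mono[of n "n + k" q] by simp
    moreover have "bit_bound (n + k) + 1 = poly [:1, 2, 3, 10:] (n + k)" by (simp add: bit_bound_def algebra_simps)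
    ultimately have "budget (n * n) c * (bit_bound (n + k) + 1) \<le> poly (q * [:1, 2, 3, 10:]) (n + k)"
      by (simp only: poly_mult mult_le_mono1)
    then show "\<exists>t s'. run c s t s' \<and> t \<le> poly (q * [:1, 2, 3, 10:]) (n + k) \<and> Q s'"
      using t by (meson le_trans)
  qed
qed

section \<open>Translation to controllable vectors and diagonal matrices\<close>

lemma mulv_cong: "(\<And>i j. i < n \<Longrightarrow> j < n \<Longrightarrow> A i j = B i j) \<Longrightarrow> mulv n A = mulv n B"
  by (auto simp: mulv_def fun_eq_iff intro!: sum.cong)

lemma full_cleared:
  assumes A: "A \<in> carrier_mat n n"
  shows "full n (fmat (real_mat A)) Bs \<longleftrightarrow> full n (\<lambda>i j. real_of_int (cleared A i j)) Bs"
proof -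
  define D where "D = (\<Prod>p<n * n. den_at A p)"
  have dim: "dim_row A = n" using A by simp
  have "0 < den_at A p" for p using den_at_pos[of A p] by linarith
  then have "D > 0" unfolding D_def by (intro prod_pos)
  have "real_of_int (cleared A i j) = real_of_int D * fmat (real_mat A) i j" if ij: "i < n" "j < n" for i j
  proof -
    define p where "p = i * n + j"
    have p: "p < n * n" "p div n = i" "p mod n = j" using index_less[OF ij] ij by (auto simp: p_def)
    have "den_at A p dvd D" unfolding D_def using p(1) by (intro dvd_prodI) auto
    then have "real_of_int (D div den_at A p) = real_of_int D / real_of_int (den_at A p)"
      by (rule real_of_int_div)
    moreover have "A $$ (i, j) = of_int (num_at A p) / of_int (den_at A p)"
      using quotient_of_div[of "A $$ (i, j)" "num_at A p" "den_at A p"] by (simp add: num_at_def den_at_def dim p)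
    ultimately show ?thesis
      using A ij by (simp add: cleared_def dim fmat_def D_def p_def[symmetric] of_rat_divide)
  qed
  then have "mulv n (\<lambda>i j. real_of_int (cleared A i j)) = mulv n (\<lambda>i j. real_of_int D * fmat (real_mat A) i j)"
    by (intro mulv_cong)
  then have "full n (\<lambda>i j. real_of_int (cleared A i j)) Bs \<longleftrightarrow> full n (\<lambda>i j. real_of_int D * fmat (real_mat A) i j) Bs"
    by (simp only: full_def)
  then show ?thesis using full_scale[of "real_of_int D" n "fmat (real_mat A)" Bs] \<open>D > 0\<close> by simp
qed

text \<open>For \<open>n >= 2\<close> and nonempty \<open>T\<close> the summand 1 in the greedy
  bound is at most \<open>card T * ln n / ln 2\<close>; hence the constant
  \<open>1 + 1 / ln 2\<close>. For \<open>n = 1\<close> the logarithm vanishes and no bound of this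
  form can hold.\<close>

lemma greedy_result:
  assumes n: "1 \<le> n" and inv: "greedy_inv n A n X"
  shows "X \<subseteq> {..<n}" "full n (\<lambda>i j. real_of_int (A i j)) (uvec ` X)"
    and "2 \<le> n \<Longrightarrow> T \<subseteq> {..<n} \<Longrightarrow> full n (\<lambda>i j. real_of_int (A i j)) (uvec ` T) \<Longrightarrow>
      real (card X) \<le> (1 + 1 / ln 2) * ln (real n) * real (card T)"
proof -
  show X: "X \<subseteq> {..<n}" using inv by (simp add: greedy_inv_def)
  have "krylov_rank n A X = n" using inv krylov_rank_le[OF X, of A] by (simp add: greedy_inv_def)
  then show "full n (\<lambda>i j. real_of_int (A i j)) (uvec ` X)" using krylov_rank_eq_iff[OF X, of A] by simp
  assume n2: "2 \<le> n" and T: "T \<subseteq> {..<n}" "full n (\<lambda>i j. real_of_int (A i j)) (uvec ` T)"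
  have rT: "krylov_rank n A T = n" using krylov_rank_eq_iff[OF T(1), of A] T(2) by simp
  have "T \<noteq> {}"
  proof
    assume "T = {}"
    then have "krylov_rank n A T = 0" using fs.dim_le_card'[of "{}"] by (simp add: krylov_rank_def)
    then show False using rT n by simp
  qed
  then have T1: "1 \<le> real (card T)" using T(1) finite_subset[OF T(1)] by (simp add: Suc_le_eq card_gt_0_iff)
  have ln2: "0 < ln (2::real)" "ln 2 \<le> ln (real n)" using n2 by simp_all
  have "1 * ln 2 \<le> real (card T) * ln (real n)" using T1 ln2 by (intro mult_mono) auto
  then have "1 \<le> real (card T) * ln (real n) / ln 2" using ln2 by (simp add: field_simps)
  moreover have "real (card X) \<le> 1 + real (card T) * ln (real n)" using inv T(1) rT by (simp add: greedy_inv_def)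
  moreover have "(1 + 1 / ln 2) * ln (real n) * real (card T)
      = real (card T) * ln (real n) + real (card T) * ln (real n) / ln 2" by (simp add: algebra_simps)
  ultimately show "real (card X) \<le> (1 + 1 / ln 2) * ln (real n) * real (card T)" by linarith
qed

text \<open>The sum runs over the unit vectors themselves, with inner products as coefficients, to
  match the linear combinations in \<open>full_mono\<close>.\<close>

lemma fvec_eq_sum_uvec:
  fixes v :: "real vec"
  assumes "v \<in> carrier_vec n" 
  shows "fvec v = (\<lambda>i. \<Sum>b\<in>uvec ` {i. i < n \<and> v $ i \<noteq> 0}. ip n b (fvec v) * b i)"
proof
  fix i
  have inj: "inj_on (uvec :: nat \<Rightarrow> nat \<Rightarrow> real) Y" for Y
  proof (rule inj_onI)
    fix x y assume "uvec x = (uvec y :: nat \<Rightarrow> real)"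
    from fun_cong[OF this, of x] show "x = y" by (simp add: uvec_def split: if_splits)
  qed
  have ip: "ip n (uvec j) (fvec v) = v $ j" if "j < n" for j
  proof -
    have "ip n (uvec j) (fvec v) = (\<Sum>i<n. if i = j then v $ j else 0)"
      unfolding ip_def using that assms by (intro sum.cong) (auto simp: uvec_def fvec_def)
    then show ?thesis using that by simp
  qed
  have "(\<Sum>b\<in>uvec ` {i. i < n \<and> v $ i \<noteq> 0}. ip n b (fvec v) * b i)
      = (\<Sum>j | j < n \<and> v $ j \<noteq> 0. ip n (uvec j) (fvec v) * uvec j i)"
    by (rule sum.reindex[OF inj, unfolded comp_def])
  also have "\<dots> = (\<Sum>j | j < n \<and> v $ j \<noteq> 0. if j = i then v $ i else 0)"
    by (intro sum.cong refl) (simp add: ip, simp add: uvec_def)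
  also have "\<dots> = fvec v i" using assms by (simp add: fvec_def)
  finally show "fvec v i = (\<Sum>b\<in>uvec ` {i. i < n \<and> v $ i \<noteq> 0}. ip n b (fvec v) * b i)" by simp
qed

lemma ctrb_vecs_iff:
  assumes "A \<in> carrier_mat n n"
  shows "b \<in> ctrb_vecs A \<longleftrightarrow> b \<in> carrier_vec n \<and> full n (fmat A) {fvec b}"
proof -
  have "(\<lambda>j. fvec (col (mat_of_cols n [b]) j)) ` {..<1} = {fvec b}" if "b \<in> carrier_vec n"
  proof -
    have "col (mat_of_cols n [b]) 0 = b" using that col_mat_of_cols[of 0 "[b]" n] by simp
    then show ?thesis by (auto simp: lessThan_Suc)
  qed
  then show ?thesis
    using assms controllable_iff_full[OF assms mat_of_cols_carrier(1)[of n "[b]"]]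
    by (auto simp: ctrb_vecs_def)
qed

text \<open>A controllable vector is a combination of the unit vectors on its support, so the
  support of a sparsest one is a competitor for the greedy set.\<close>

lemma ctrb_vecs_support:
  assumes A: "A \<in> carrier_mat n n" and b: "b \<in> ctrb_vecs A"
  shows "full n (fmat A) (uvec ` {i. i < n \<and> b $ i \<noteq> 0})"
proof -
  have b': "b \<in> carrier_vec n" "full n (fmat A) {fvec b}" using b ctrb_vecs_iff[OF A] by auto
  from b'(2) show ?thesis
  proof (rule full_mono)
    fix f assume "f \<in> {fvec b}"
    then have f: "f = fvec b" by simp
    have "f = (\<lambda>i. \<Sum>a\<in>uvec ` {i. i < n \<and> b $ i \<noteq> 0}. ip n a (fvec b) * a i)"
      unfolding f by (rule fvec_eq_sum_uvec[OF b'(1)])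
    then show "\<exists>K c. f = (\<lambda>i. \<Sum>a\<in>K. c a * a i) \<and> K \<subseteq> uvec ` {i. i < n \<and> b $ i \<noteq> 0}"
      by (intro exI[of _ "uvec ` {i. i < n \<and> b $ i \<noteq> 0}"] exI[of _ "\<lambda>a. ip n a (fvec b)"] conjI subset_refl)
  qed
qed

lemma fvec_col_diag:
  fixes B :: "real mat"
  assumes "B \<in> carrier_mat n n" "diagonal_mat B" "j < n"
  shows "fvec (col B j) = (\<lambda>i. B $$ (j, j) * uvec j i)"
  using assms by (auto simp: fvec_def uvec_def diagonal_mat_def fun_eq_iff)

text \<open>The columns of a diagonal matrix are multiples of unit vectors, nonzero exactly on the
  support; so the values on the diagonal are immaterial and a sparsest element amounts to a smallest
  full index set.\<close>

lemma ctrb_diags_iff: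
  assumes A: "A \<in> carrier_mat n n"
  shows "B \<in> ctrb_diags A \<longleftrightarrow> B \<in> carrier_mat n n \<and> diagonal_mat B \<and>
    full n (fmat A) (uvec ` {i. i < n \<and> B $$ (i, i) \<noteq> 0})"
proof -
  have "controllable A B \<longleftrightarrow> full n (fmat A) (uvec ` {i. i < n \<and> B $$ (i, i) \<noteq> 0})"
    if B: "B \<in> carrier_mat n n" "diagonal_mat B"
    unfolding controllable_iff_full[OF A B(1)]
  proof
    assume "full n (fmat A) ((\<lambda>j. fvec (col B j)) ` {..<n})"
    then show "full n (fmat A) (uvec ` {i. i < n \<and> B $$ (i, i) \<noteq> 0})"
    proof (rule full_mono)
      fix f assume "f \<in> (\<lambda>j. fvec (col B j)) ` {..<n}"
      then obtain j where j: "j < n" "f = (\<lambda>i. B $$ (j, j) * uvec j i)" using fvec_col_diag[OF B] by auto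
      show "\<exists>K c. f = (\<lambda>i. \<Sum>a\<in>K. c a * a i) \<and> K \<subseteq> uvec ` {i. i < n \<and> B $$ (i, i) \<noteq> 0}"
      proof (cases "B $$ (j, j) = 0")
        case True
        then show ?thesis using j by (intro exI[of _ "{}"]) auto
      next
        case False
        then show ?thesis using j
          by (intro exI[of _ "{uvec j}"] exI[of _ "\<lambda>_. B $$ (j, j)"]) auto
      qed
    qed
  next
    assume "full n (fmat A) (uvec ` {i. i < n \<and> B $$ (i, i) \<noteq> 0})"
    then show "full n (fmat A) ((\<lambda>j. fvec (col B j)) ` {..<n})"
    proof (rule full_mono)
      fix f :: "nat \<Rightarrow> real" assume "f \<in> uvec ` {i. i < n \<and> B $$ (i, i) \<noteq> 0}"
      then obtain j where j: "j < n" "B $$ (j, j) \<noteq> 0" "f = uvec j" by auto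
      have "f = (\<lambda>i. \<Sum>a\<in>{fvec (col B j)}. 1 / B $$ (j, j) * a i)"
        using j(2,3) fvec_col_diag[OF B j(1)] by (simp add: fun_eq_iff)
      moreover have "{fvec (col B j)} \<subseteq> (\<lambda>j. fvec (col B j)) ` {..<n}" using j(1) by simp
      ultimately show "\<exists>K c. f = (\<lambda>i. \<Sum>a\<in>K. c a * a i) \<and> K \<subseteq> (\<lambda>j. fvec (col B j)) ` {..<n}"
        by (intro exI[of _ "{fvec (col B j)}"] exI[of _ "\<lambda>_. 1 / B $$ (j, j)"] conjI)
    qed
  qed
  then show ?thesis using A by (auto simp: ctrb_diags_def)
qed

lemma nnz_mat_diagonal:
  assumes "B \<in> carrier_mat n n" "diagonal_mat B"
  shows "nnz_mat B = card {i. i < n \<and> B $$ (i, i) \<noteq> 0}"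
proof -
  have "{(i, j). i < dim_row B \<and> j < dim_col B \<and> B $$ (i, j) \<noteq> 0} = (\<lambda>i. (i, i)) ` {i. i < n \<and> B $$ (i, i) \<noteq> 0}"
    using assms by (auto simp: diagonal_mat_def)
  then show ?thesis by (simp add: nnz_mat_def card_image inj_on_def)
qed

section \<open>Correctness of the two algorithms\<close>

definition vec_alg :: com where
  "vec_alg = Seq setup_prog vec_prog"

definition diag_alg :: com where
  "diag_alg = Seq setup_prog (Seq (fill ''outnum'' Skip diag_expr) (fill ''outden'' Skip (Num 1)))"

lemma vec_alg_correct:
  fixes A :: "rat mat"
  assumes A: "A \<in> carrier_mat n n" and n: "1 \<le> n"
  shows "ok n (bit_bound (n + input_bits A)) vec_alg (input_state A) (\<lambda>s. ctrb_vecs (real_mat A) \<noteq> {} \<longrightarrow>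
    (\<exists>b \<in> carrier_vec n. outputs_vec s b \<and> real_vec b \<in> ctrb_vecs (real_mat A) \<and>
      (n \<ge> 2 \<longrightarrow> (\<forall>b'. is_arg_min nnz_vec (\<lambda>x. x \<in> ctrb_vecs (real_mat A)) b' \<longrightarrow>
        real (nnz_vec (real_vec b)) \<le> (1 + 1 / ln 2) * ln (real n) * real (nnz_vec b')))))" (is "ok _ _ _ _ ?Q")
  unfolding vec_alg_def
proof (rule ok_Seq[OF ok_setup[OF A n]])
  interpret alg n "bit_bound (n + input_bits A)" "cleared A" "2 ^ (2 * input_bits A)" "2 * int (n * n) ^ (2 * n)"
    by (rule ok_prep_input(1)[OF A n])
  have RA: "real_mat A \<in> carrier_mat n n" using A by simp
  note iff = ctrb_vecs_iff[OF RA, unfolded full_cleared[OF A]]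
  fix s1 assume s1: "sbound (bit_bound (n + input_bits A)) s1"
    "env s1 \<and> (\<exists>X. setrep n s1 X \<and> greedy_inv n (cleared A) n X)"
  then obtain X where X: "setrep n s1 X" "greedy_inv n (cleared A) n X" by blast
  note greedy = greedy_result[OF n X(2)]
  show "ok n (bit_bound (n + input_bits A)) vec_prog s1 ?Q"
  proof (rule ok_conseq[OF ok_vec[OF s1(1) conjunct1[OF s1(2)] X(1) greedy(1)]], intro impI)
    fix s assume out: "(\<exists>t<n * n. good X t) \<longrightarrow> (\<exists>t. good X t \<and> outrep n s (moment X t))"
      and "ctrb_vecs (real_mat A) \<noteq> {}"
    then obtain b0 where "b0 \<in> ctrb_vecs (real_mat A)" by blast
    then have "full n (\<lambda>i j. real_of_int (cleared A i j)) {fvec b0}" using iff by blast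
    from exists_controllable_moment_vector[OF _ greedy(1) this greedy(2)] n
    obtain t where t: "t < n * n"
      "full n (\<lambda>i j. real_of_int (cleared A i j)) {\<lambda>i. if i \<in> X then real t ^ i else 0}" by auto
    have "(\<lambda>i. real_of_int (moment X t i)) = (\<lambda>i. if i \<in> X then real t ^ i else 0)" for t
      by (auto simp: moment_def)
    then have "good X t" using t(2) by simp
    \<comment> \<open>The output belongs to some good value \<open>u\<close>, possibly different
      from \<open>t\<close>, since later successes overwrite earlier ones.\<close>
    then obtain u where u: "good X u" "outrep n s (moment X u)" using out t(1) by blast
    define b :: "rat vec" where "b = vec n (\<lambda>i. of_int (moment X u i))"
    have b: "b \<in> carrier_vec n" by (simp add: b_def)
    have rb: "real_vec b \<in> carrier_vec n" using b by simp
    have "fvec (real_vec b) = (\<lambda>i. real_of_int (moment X u i))"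
      using greedy(1) by (auto simp: fvec_def b_def moment_def fun_eq_iff of_rat_of_int_eq)
    then have ctrb: "real_vec b \<in> ctrb_vecs (real_mat A)" using iff u(1) rb by simp
    have "outputs_vec s b"
      using u(2) by (simp add: outputs_vec_def outrep_def b_def quotient_of_of_int)
    moreover have "real (nnz_vec (real_vec b)) \<le> (1 + 1 / ln 2) * ln (real n) * real (nnz_vec b')"
      if n2: "2 \<le> n" and min: "is_arg_min nnz_vec (\<lambda>x. x \<in> ctrb_vecs (real_mat A)) b'" for b'
    proof -
      define T where "T = {i. i < n \<and> b' $ i \<noteq> 0}"
      have b': "b' \<in> ctrb_vecs (real_mat A)" using min by (simp add: is_arg_min_def)
      then have "dim_vec b' = n" using iff by auto
      then have cT: "nnz_vec b' = card T" by (simp add: nnz_vec_def T_def)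
      have "full n (\<lambda>i j. real_of_int (cleared A i j)) (uvec ` T)"
        using ctrb_vecs_support[OF RA b'] unfolding T_def full_cleared[OF A] .
      then have "real (card X) \<le> (1 + 1 / ln 2) * ln (real n) * real (card T)"
        by (intro greedy(3) n2) (auto simp: T_def)
      \<comment> \<open>Only an inequality: for \<open>u = 0\<close> the entries at positive indices
        of \<open>X\<close> vanish.\<close>
      moreover have "nnz_vec (real_vec b) \<le> card X"
        unfolding nnz_vec_def
      proof (rule card_mono)
        show "finite X" using greedy(1) finite_subset by blast
        show "{i. i < dim_vec (real_vec b) \<and> real_vec b $ i \<noteq> 0} \<subseteq> X"
          by (auto simp: b_def moment_def split: if_splits)
      qed
      ultimately show ?thesis by (simp add: cT)
    qed
    ultimately show "\<exists>b \<in> carrier_vec n. outputs_vec s b \<and> real_vec b \<in> ctrb_vecs (real_mat A) \<and>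
      (n \<ge> 2 \<longrightarrow> (\<forall>b'. is_arg_min nnz_vec (\<lambda>x. x \<in> ctrb_vecs (real_mat A)) b' \<longrightarrow>
        real (nnz_vec (real_vec b)) \<le> (1 + 1 / ln 2) * ln (real n) * real (nnz_vec b')))"
      using b ctrb by blast
  qed
qed

lemma diag_alg_correct:
  fixes A :: "rat mat"
  assumes A: "A \<in> carrier_mat n n" and n: "1 \<le> n"
  shows "ok n (bit_bound (n + input_bits A)) diag_alg (input_state A) (\<lambda>s.
    \<exists>B \<in> carrier_mat n n. outputs_mat s B \<and> real_mat B \<in> ctrb_diags (real_mat A) \<and>
      (n \<ge> 2 \<longrightarrow> (\<forall>B'. is_arg_min nnz_mat (\<lambda>X. X \<in> ctrb_diags (real_mat A)) B' \<longrightarrow>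
        real (nnz_mat (real_mat B)) \<le> (1 + 1 / ln 2) * ln (real n) * real (nnz_mat B'))))" (is "ok _ _ _ _ ?Q")
  unfolding diag_alg_def
proof (rule ok_Seq[OF ok_setup[OF A n]])
  interpret alg n "bit_bound (n + input_bits A)" "cleared A" "2 ^ (2 * input_bits A)" "2 * int (n * n) ^ (2 * n)"
    by (rule ok_prep_input(1)[OF A n])
  have RA: "real_mat A \<in> carrier_mat n n" using A by simp
  note iff = ctrb_diags_iff[OF RA, unfolded full_cleared[OF A]]
  fix s1 assume s1: "sbound (bit_bound (n + input_bits A)) s1"
    "env s1 \<and> (\<exists>X. setrep n s1 X \<and> greedy_inv n (cleared A) n X)"
  then obtain X where X: "setrep n s1 X" "greedy_inv n (cleared A) n X" by blast
  note greedy = greedy_result[OF n X(2)]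
  define B :: "rat mat" where "B = mat n n (\<lambda>(i,j). if i = j \<and> i \<in> X then 1 else 0)"
  have B: "B \<in> carrier_mat n n" by (simp add: B_def)
  have rB: "real_mat B \<in> carrier_mat n n" "diagonal_mat (real_mat B)"
    by (auto simp: B_def diagonal_mat_def)
  have supp: "{i. i < n \<and> real_mat B $$ (i, i) \<noteq> 0} = X" using greedy(1) by (auto simp: B_def split: if_splits)
  have ctrb: "real_mat B \<in> ctrb_diags (real_mat A)" unfolding iff supp using rB greedy(2) by simp
  have bound: "real (nnz_mat (real_mat B)) \<le> (1 + 1 / ln 2) * ln (real n) * real (nnz_mat B')"
    if n2: "2 \<le> n" and min: "is_arg_min nnz_mat (\<lambda>X. X \<in> ctrb_diags (real_mat A)) B'" for B'
  proof -
    have B': "B' \<in> carrier_mat n n" "diagonal_mat B'"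
      "full n (\<lambda>i j. real_of_int (cleared A i j)) (uvec ` {i. i < n \<and> B' $$ (i, i) \<noteq> 0})"
      using min iff by (auto simp: is_arg_min_def)
    show ?thesis
      unfolding nnz_mat_diagonal[OF rB] nnz_mat_diagonal[OF B'(1,2)] supp
      by (intro greedy(3) n2 B'(3)) auto
  qed
  show "ok n (bit_bound (n + input_bits A)) (Seq (fill ''outnum'' Skip diag_expr) (fill ''outden'' Skip (Num 1))) s1 ?Q"
  proof (rule ok_conseq[OF ok_const_diag[OF s1(1) env_n[OF conjunct1[OF s1(2)]] X(1)]])
    fix s assume s: "arr n s ''outnum'' (\<lambda>i j. if i = j \<and> i \<in> X then 1 else 0) \<and> arr n s ''outden'' (\<lambda>i j. 1)"
    have "outputs_mat s B"
      unfolding outputs_mat_def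
    proof (intro allI impI)
      fix i j assume "i < dim_row B" "j < dim_col B"
      then have ij: "i < n" "j < n" by (auto simp: B_def)
      define v :: int where "v = (if i = j \<and> i \<in> X then 1 else 0)"
      have "B $$ (i, j) = of_int v" using ij by (auto simp: B_def v_def)
      moreover have "s ''outnum'' (int (i * n + j)) = v"
        unfolding v_def by (rule arrD[OF conjunct1[OF s] ij])
      moreover have "s ''outden'' (int (i * n + j)) = 1" by (rule arrD[OF conjunct2[OF s] ij])
      moreover have "dim_col B = n" by (simp add: B_def)
      ultimately show "(s ''outnum'' (int (i * dim_col B + j)), s ''outden'' (int (i * dim_col B + j))) = quotient_of (B $$ (i, j))"
        by (simp only: quotient_of_of_int)
    qed
    then show "\<exists>B \<in> carrier_mat n n. outputs_mat s B \<and> real_mat B \<in> ctrb_diags (real_mat A) \<and>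
      (n \<ge> 2 \<longrightarrow> (\<forall>B'. is_arg_min nnz_mat (\<lambda>X. X \<in> ctrb_diags (real_mat A)) B' \<longrightarrow>
        real (nnz_mat (real_mat B)) \<le> (1 + 1 / ln 2) * ln (real n) * real (nnz_mat B')))"
      using B ctrb bound by blast
  qed
qed

theorem theorem1p2:
  shows
    "(\<exists>(alg :: com) (p :: nat poly) (c' :: real). c' > 0 \<and>
       (\<forall>n (A :: rat mat). n \<ge> 1 \<longrightarrow> A \<in> carrier_mat n n \<longrightarrow>
         (\<exists>t s. run alg (input_state A) t s \<and> t \<le> poly p (n + input_bits A) \<and>
           (ctrb_vecs (real_mat A) \<noteq> {} \<longrightarrow>
             (\<exists>b \<in> carrier_vec n. outputs_vec s b \<and> real_vec b \<in> ctrb_vecs (real_mat A) \<and>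
               (n \<ge> 2 \<longrightarrow> (\<forall>b'. is_arg_min nnz_vec (\<lambda>x. x \<in> ctrb_vecs (real_mat A)) b' \<longrightarrow>
                  real (nnz_vec (real_vec b)) \<le> c' * ln (real n) * real (nnz_vec b'))))))))
     \<and>
     (\<exists>(alg :: com) (p :: nat poly) (c' :: real). c' > 0 \<and>
       (\<forall>n (A :: rat mat). n \<ge> 1 \<longrightarrow> A \<in> carrier_mat n n \<longrightarrow>
         (\<exists>t s. run alg (input_state A) t s \<and> t \<le> poly p (n + input_bits A) \<and>
           (ctrb_diags (real_mat A) \<noteq> {} \<longrightarrow>
             (\<exists>B \<in> carrier_mat n n. outputs_mat s B \<and> real_mat B \<in> ctrb_diags (real_mat A) \<and>
               (n \<ge> 2 \<longrightarrow> (\<forall>B'. is_arg_min nnz_mat (\<lambda>X. X \<in> ctrb_diags (real_mat A)) B' \<longrightarrow>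
                  real (nnz_mat (real_mat B)) \<le> c' * ln (real n) * real (nnz_mat B'))))))))"
    (is "?V \<and> ?D")
proof
  have c: "(0::real) < 1 + 1 / ln 2" by (simp add: add_pos_pos)
  obtain p :: "nat poly" where p: "\<forall>n k s Q. ok n (bit_bound (n + k)) vec_alg s Q \<longrightarrow>
    (\<exists>t s'. run vec_alg s t s' \<and> t \<le> poly p (n + k) \<and> Q s')"
    using ok_poly_time[of vec_alg] by (elim exE)
  show ?V
    by (intro exI[of _ vec_alg] exI[of _ p] exI[of _ "1 + 1 / ln 2"] conjI c allI impI p[rule_format, OF vec_alg_correct])
  obtain q :: "nat poly" where q: "\<forall>n k s Q. ok n (bit_bound (n + k)) diag_alg s Q \<longrightarrow>
    (\<exists>t s'. run diag_alg s t s' \<and> t \<le> poly q (n + k) \<and> Q s')"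
    using ok_poly_time[of diag_alg] by (elim exE)
  show ?D
    by (intro exI[of _ diag_alg] exI[of _ q] exI[of _ "1 + 1 / ln 2"] conjI c allI impI
        q[rule_format, OF ok_conseq[OF diag_alg_correct]])
qed

end
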